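(* Let $d\ge2$. Then $\Omega_{d,1}=\Omega_{d,0}=\Omega'_{d,1}$; that is, every continuous $\mathrm{SO}(d)$-invariant valuation $\varphi:\mathcal{K}^d\to\mathbb{C}$ which is polynomial of degree at most $1$ is translation invariant (and is in fact $\mathrm{O}(d)$-invariant).
   Context: $\mathcal{K}^d$: nonempty compact convex subsets of $\mathbb{R}^d$ with the Hausdorff metric. A valuation satisfies $\varphi(K_1\cup K_2)+\varphi(K_1\cap K_2)=\varphi(K_1)+\varphi(K_2)$ whenever $K_1,K_2,K_1\cup K_2\in\mathcal{K}^d$. A valuation is polynomial of degree at most $\ell$ if $x\mapsto\varphi(K+x)$ is a polynomial of degree at most $\ell$ for each $K$. $\Omega_{d,\ell}$ (resp. $\Omega'_{d,\ell}$) denotes the complex vector space of continuous (Hausdorff metric) $\mathrm{SO}(d)$-invariant (resp. $\mathrm{O}(d)$-invariant) valuations $\mathcal{K}^d\to\mathbb{C}$ that are polynomial of degree at most $\ell$. Degree at most $0$ means translation invariant. *)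

theory Defs
  imports "HOL-Analysis.Analysis"
begin

definition convex_bodies :: "(real^'n) set set" where
  "convex_bodies = {K. compact K \<and> convex K \<and> K \<noteq> {}}"

definition is_valuation :: "((real^'n) set \<Rightarrow> complex) \<Rightarrow> bool" where
  "is_valuation \<phi> \<longleftrightarrow>
     (\<forall>K1 K2. K1 \<in> convex_bodies \<longrightarrow> K2 \<in> convex_bodies \<longrightarrow> K1 \<union> K2 \<in> convex_bodies \<longrightarrow>
        \<phi> (K1 \<union> K2) + \<phi> (K1 \<inter> K2) = \<phi> K1 + \<phi> K2)"

definition hausdorff_dist :: "(real^'n) set \<Rightarrow> (real^'n) set \<Rightarrow> real" where
  "hausdorff_dist K L = max (SUP x\<in>K. infdist x L) (SUP y\<in>L. infdist y K)"

definition hausdorff_continuous :: "((real^'n) set \<Rightarrow> complex) \<Rightarrow> bool" where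
  "hausdorff_continuous \<phi> \<longleftrightarrow>
     (\<forall>K\<in>convex_bodies. \<forall>e>0. \<exists>\<delta>>0. \<forall>L\<in>convex_bodies.
        hausdorff_dist K L < \<delta> \<longrightarrow> norm (\<phi> L - \<phi> K) < e)"

definition is_polynomial_valuation :: "nat \<Rightarrow> ((real^'n) set \<Rightarrow> complex) \<Rightarrow> bool" where
  "is_polynomial_valuation l \<phi> \<longleftrightarrow>
     (\<forall>K\<in>convex_bodies. \<exists>c :: ('n \<Rightarrow> nat) \<Rightarrow> complex.
        \<forall>x :: real^'n. \<phi> ((\<lambda>y. y + x) ` K) =
          (\<Sum>\<alpha>\<in>{\<alpha> :: 'n \<Rightarrow> nat. (\<Sum>i\<in>UNIV. \<alpha> i) \<le> l}.
              c \<alpha> * (\<Prod>i\<in>UNIV. complex_of_real ((x $ i) ^ \<alpha> i))))"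

definition SO_invariant :: "((real^'n) set \<Rightarrow> complex) \<Rightarrow> bool" where
  "SO_invariant \<phi> \<longleftrightarrow>
     (\<forall>A :: real^'n^'n. orthogonal_matrix A \<longrightarrow> det A = 1 \<longrightarrow>
        (\<forall>K\<in>convex_bodies. \<phi> ((\<lambda>x. A *v x) ` K) = \<phi> K))"

definition O_invariant :: "((real^'n) set \<Rightarrow> complex) \<Rightarrow> bool" where
  "O_invariant \<phi> \<longleftrightarrow>
     (\<forall>A :: real^'n^'n. orthogonal_matrix A \<longrightarrow>
        (\<forall>K\<in>convex_bodies. \<phi> ((\<lambda>x. A *v x) ` K) = \<phi> K))"

definition Omega :: "nat \<Rightarrow> ((real^'n) set \<Rightarrow> complex) set" where
  "Omega l = {\<phi>. is_valuation \<phi> \<and> hausdorff_continuous \<phi> \<and> SO_invariant \<phi>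
                  \<and> is_polynomial_valuation l \<phi>}"

definition Omega' :: "nat \<Rightarrow> ((real^'n) set \<Rightarrow> complex) set" where
  "Omega' l = {\<phi>. is_valuation \<phi> \<and> hausdorff_continuous \<phi> \<and> O_invariant \<phi>
                  \<and> is_polynomial_valuation l \<phi>}"

end

theory Submission
  imports Defs
begin

text \<open>
  If \<open>\<phi>\<close> has degree at most \<open>1\<close>, then \<open>\<phi> (K + x) - \<phi> K = \<Phi> K \<bullet> x\<close>, where (the real and imaginary
  parts of) \<open>\<Phi>\<close> are translation invariant, continuous, rotation equivariant vector valuations. All
  such \<open>\<Phi>\<close> vanish in dimension at least \<open>2\<close>, by induction on the dimension. On an orthogonal product
  \<open>A + B\<close> the two components of \<open>\<Phi>\<close> vanish by induction and by the scalar result below, so \<open>\<Phi>\<close> is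
  simple, and cutting orthoschemes into products shows that it is homogeneous of degree \<open>1\<close>. A
  simplex is the signed sum of the shadows that its facets cast in a direction \<open>v\<close> on a far hyperplane
  orthogonal to \<open>v\<close>; averaging over \<open>v\<close> writes \<open>\<Phi>\<close> of a simplex as a sum over its facets of a
  valuation that is equivariant under the rotations of the facet hyperplane. The tangential part of the
  latter vanishes by induction, and its normal part is a rotation invariant scalar valuation of
  degree \<open>1\<close>, which vanishes by the same averaging. In the plane the facets are edges, the facet
  valuation is linear in the edge vector, and the edge vectors of a triangle add up to \<open>0\<close>.

  The scalar result is that a continuous translation invariant valuation which changes sign under
  every reflection is zero: on a simplex this follows by joining the incentre to the points of contact
  with the facets, which dissects the simplex into pairs of mirror images. It also gives the invariance
  under \<open>O(d)\<close>, applied to the difference of \<open>\<phi>\<close> and its composition with a reflection.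
\<close>

section \<open>Valuations on a subspace and simplicial dissections\<close>

text \<open>The induction needs spaces of every lower dimension, so all notions are relative to a
  subspace \<open>W\<close> of one fixed type. Rotations of \<open>W\<close> enter only as products
  of two reflections with normals in \<open>W\<close>: for normals in a smaller subspace such a
  product fixes every vector orthogonal to it, so equivariance passes to the factors of a product
  and to facet hyperplanes without a group being set up on them. A shadow in one direction destroys
  equivariance; averaging restores it but keeps the sign of \<open>n \<bullet> v\<close>, which
  makes the facet valuation odd in the normal \<open>n\<close>. It is this oddness that lets the
  result on odd valuations settle the scalar case. The position of the far hyperplane is harmless
  only because the valuation vanishes on cylinders. For \<open>\<Phi>\<close> this is a case of
  vanishing on products, but the normal part of the facet valuation is not known to vanish on
  products; there it follows from homogeneity, which is therefore proved for \<open>\<Phi>\<close>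
  beforehand and handed down through the averages. The plane is exceptional because its facets span
  lines, which have no nontrivial rotations.\<close>

text \<open>The empty set counts as a body, with value \<open>0\<close>, so that intersections need no case distinction.\<close>

definition cbody :: "'a::euclidean_space set \<Rightarrow> 'a set \<Rightarrow> bool" where
  "cbody W K \<longleftrightarrow> compact K \<and> convex K \<and> K \<subseteq> W"

text \<open>The normal \<open>a\<close> is taken in \<open>W\<close>: thin means of lower dimension than \<open>W\<close>.\<close>

definition thin :: "'a::euclidean_space set \<Rightarrow> 'a set \<Rightarrow> bool" where
  "thin W K \<longleftrightarrow> (\<exists>a\<in>W. a \<noteq> 0 \<and> (\<exists>b. \<forall>x\<in>K. a \<bullet> x = b))"

definition val :: "'a::euclidean_space set \<Rightarrow> ('a set \<Rightarrow> 'b::real_normed_vector) \<Rightarrow> bool" where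
  "val W f \<longleftrightarrow> f {} = 0 \<and>
     (\<forall>K L. cbody W K \<longrightarrow> cbody W L \<longrightarrow> convex (K \<union> L) \<longrightarrow> f (K \<union> L) + f (K \<inter> L) = f K + f L)"

text \<open>Hausdorff distance at most \<open>d\<close>, expressed by witnesses, so that images,
  sums and shadows are compared point by point without suprema; \<open>hausdorff_dist_near\<close>
  connects it with \<open>hausdorff_dist\<close>.\<close>

definition near :: "real \<Rightarrow> 'a::metric_space set \<Rightarrow> 'a set \<Rightarrow> bool" where
  "near d K L \<longleftrightarrow> (\<forall>x\<in>K. \<exists>y\<in>L. dist x y \<le> d) \<and> (\<forall>y\<in>L. \<exists>x\<in>K. dist x y \<le> d)"

definition hcont :: "'a::euclidean_space set \<Rightarrow> ('a set \<Rightarrow> 'b::real_normed_vector) \<Rightarrow> bool" where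
  "hcont W f \<longleftrightarrow> (\<forall>K. cbody W K \<longrightarrow> K \<noteq> {} \<longrightarrow> (\<forall>e>0. \<exists>d>0. \<forall>L. cbody W L \<longrightarrow> L \<noteq> {} \<longrightarrow>
      near d K L \<longrightarrow> norm (f L - f K) < e))"

definition tinv :: "'a::euclidean_space set \<Rightarrow> ('a set \<Rightarrow> 'b) \<Rightarrow> bool" where
  "tinv W f \<longleftrightarrow> (\<forall>K x. cbody W K \<longrightarrow> x \<in> W \<longrightarrow> f ((+) x ` K) = f K)"

definition simple :: "'a::euclidean_space set \<Rightarrow> ('a set \<Rightarrow> 'b::zero) \<Rightarrow> bool" where
  "simple W f \<longleftrightarrow> (\<forall>K. cbody W K \<longrightarrow> thin W K \<longrightarrow> f K = 0)"

lemma thin_subset: "thin W L \<Longrightarrow> K \<subseteq> L \<Longrightarrow> thin W K"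
  unfolding thin_def by blast

lemma cbody_Int: "cbody W K \<Longrightarrow> cbody W L \<Longrightarrow> cbody W (K \<inter> L)"
  unfolding cbody_def by (auto intro: compact_Int convex_Int)

lemma cbody_Int_closed: "cbody W K \<Longrightarrow> closed H \<Longrightarrow> convex H \<Longrightarrow> cbody W (K \<inter> H)"
  unfolding cbody_def by (auto intro: compact_Int_closed convex_Int)

lemma cbody_hull: "finite S \<Longrightarrow> S \<subseteq> W \<Longrightarrow> subspace W \<Longrightarrow> cbody W (convex hull S)"
  unfolding cbody_def
  by (auto simp: finite_imp_compact_convex_hull hull_minimal subspace_imp_convex)

section \<open>Cuts by hyperplanes and additivity over dissections\<close>

lemma val_cut:
  fixes f :: "'a::euclidean_space set \<Rightarrow> 'b::real_normed_vector"
  assumes "val W f" "simple W f" "cbody W K" "a \<in> W" "a \<noteq> 0"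
  shows "f K = f (K \<inter> {x. a \<bullet> x \<le> b}) + f (K \<inter> {x. a \<bullet> x \<ge> b})"
proof -
  let ?K1 = "K \<inter> {x. a \<bullet> x \<le> b}" and ?K2 = "K \<inter> {x. a \<bullet> x \<ge> b}"
  have 1: "cbody W ?K1" "cbody W ?K2"
    using assms(3) by (auto intro!: cbody_Int_closed simp: closed_halfspace_le closed_halfspace_ge
        convex_halfspace_le convex_halfspace_ge)
  have U: "?K1 \<union> ?K2 = K" by auto
  have "thin W (?K1 \<inter> ?K2)" unfolding thin_def using assms(4,5) by force
  then have "f (?K1 \<inter> ?K2) = 0" using assms(2) 1 cbody_Int unfolding simple_def by blast
  moreover have "f (?K1 \<union> ?K2) + f (?K1 \<inter> ?K2) = f ?K1 + f ?K2"
    using assms(1,3) 1 U unfolding val_def cbody_def by metis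
  ultimately show ?thesis using U by simp
qed

text \<open>If \<open>Q\<close> lies in none of the hyperplanes, a point avoiding all of them is
  built by induction: on the segment from a point that avoids those of \<open>J\<close> to a point
  off the hyperplane of \<open>j\<close>, each hyperplane excludes at most one parameter, so some
  parameter remains.\<close>

lemma convex_in_hyperplanes:
  fixes Q :: "'a::euclidean_space set"
  assumes "finite I" "convex Q" "Q \<noteq> {}" "Q \<subseteq> (\<Union>i\<in>I. {x. a i \<bullet> x = b i})"
  shows "\<exists>i\<in>I. Q \<subseteq> {x. a i \<bullet> x = b i}"
proof (rule ccontr)
  assume no: "\<not> ?thesis"
  have "\<exists>x\<in>Q. \<forall>i\<in>J. a i \<bullet> x \<noteq> b i" if "finite J" "J \<subseteq> I" for J
    using that
  proof (induction J rule: finite_induct)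
    case empty then show ?case using assms by auto
  next
    case (insert j J)
    then obtain x where x: "x \<in> Q" "\<forall>i\<in>J. a i \<bullet> x \<noteq> b i" by auto
    obtain y where y: "y \<in> Q" "a j \<bullet> y \<noteq> b j" using no insert by blast
    define g where "g t = x + t *\<^sub>R (y - x)" for t :: real
    have g: "a i \<bullet> g t = a i \<bullet> x + t * (a i \<bullet> y - a i \<bullet> x)" for i t
      by (simp add: g_def inner_diff_right inner_add_right)
    define B where "B = (\<Union>i\<in>insert j J. {t. a i \<bullet> g t = b i})"
    have fin: "finite {t. a i \<bullet> g t = b i}" if "i \<in> insert j J" for i
    proof (cases "a i \<bullet> y - a i \<bullet> x = 0")
      case True
      then have "{t. a i \<bullet> g t = b i} = {}" using that x y g by auto
      then show ?thesis by simp
    next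
      case False
      then have "{t. a i \<bullet> g t = b i} \<subseteq> {(b i - a i \<bullet> x) / (a i \<bullet> y - a i \<bullet> x)}"
        unfolding g by (auto simp: field_simps)
      then show ?thesis using finite_subset by blast
    qed
    then have "finite B" unfolding B_def using insert by blast
    moreover have "infinite {0..1::real}" by simp
    ultimately have "\<not> {0..1} \<subseteq> B" using finite_subset by blast
    then obtain t where t: "t \<in> {0..1}" "t \<notin> B" by blast
    have "g t \<in> Q" using t x y assms(2) convexD_alt[of Q x y t]
      by (simp add: g_def algebra_simps)
    then show ?case using t unfolding B_def by auto
  qed
  from this[of I] assms show False by blast
qed

text \<open>Near a point \<open>x\<close> outside the closed set \<open>C\<close> only the thin sets
  are left to cover \<open>P\<close>. A small homothetic copy of \<open>P\<close> about
  \<open>x\<close> then lies in finitely many hyperplanes, hence in one of them, and enlarging it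
  again about \<open>x\<close> shows that \<open>P\<close> itself is thin.\<close>

lemma cover_nonthin:
  fixes P :: "'a::euclidean_space set"
  assumes "convex P" "bounded P" "\<not> thin W P" "closed C" "finite I" "P \<subseteq> C \<union> (\<Union>i\<in>I. N i)"
    "\<And>i. i \<in> I \<Longrightarrow> thin W (N i)"
  shows "P \<subseteq> C"
proof
  fix x assume x: "x \<in> P"
  show "x \<in> C"
  proof (rule ccontr)
    assume "x \<notin> C"
    then obtain e where e: "e > 0" "ball x e \<inter> C = {}"
      using assms(4) open_contains_ball[of "-C"] by (force simp: closed_def)
    obtain B where B: "B > 0" "\<And>y. y \<in> P \<Longrightarrow> norm (y - x) \<le> B"
    proof -
      obtain B0 where B0: "\<And>y. y \<in> P \<Longrightarrow> norm y \<le> B0" using assms(2) unfolding bounded_iff by blast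
      have "norm (y - x) \<le> \<bar>B0 + norm x\<bar> + 1" if "y \<in> P" for y
        using B0[OF that] norm_triangle_ineq4[of y x] by linarith
      then show ?thesis by (intro that[of "\<bar>B0 + norm x\<bar> + 1"]) auto
    qed
    \<comment> \<open>\<open>t \<le> 1\<close> keeps the copy inside \<open>P\<close>, and
      \<open>t * B < e\<close> keeps it away from \<open>C\<close>.\<close>
    define t where "t = min 1 (e / (2 * B))"
    have t: "0 < t" "t \<le> 1" "t * B < e"
      using e B by (auto simp: t_def min_def field_simps)
    define Q where "Q = (\<lambda>y. x + t *\<^sub>R (y - x)) ` P"
    have Qeq: "Q = (+) ((1 - t) *\<^sub>R x) ` ((*\<^sub>R) t ` P)"
      unfolding Q_def image_image by (auto simp: algebra_simps)
    have "convex Q" unfolding Qeq using assms(1) convex_translation convex_scaling by blast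
    have "Q \<subseteq> P" using assms(1) x t convexD_alt[of P x] by (auto simp: Q_def algebra_simps)
    have "Q \<subseteq> ball x e"
    proof
      fix z assume "z \<in> Q"
      then obtain y where y: "y \<in> P" "z = x + t *\<^sub>R (y - x)" by (auto simp: Q_def)
      have "t * norm (y - x) \<le> t * B" by (rule mult_left_mono) (use B(2)[OF y(1)] t in auto)
      then have "norm (t *\<^sub>R (y - x)) < e" using t unfolding norm_scaleR by linarith
      then show "z \<in> ball x e" using y by (simp add: dist_norm)
    qed
    have "\<forall>i\<in>I. \<exists>a b. a \<in> W \<and> a \<noteq> 0 \<and> (\<forall>x\<in>N i. a \<bullet> x = b)"
      using assms(7) unfolding thin_def by blast
    then obtain a where "\<forall>i\<in>I. \<exists>b. a i \<in> W \<and> a i \<noteq> 0 \<and> (\<forall>x\<in>N i. a i \<bullet> x = b)"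
      by (rule bchoice[THEN exE])
    then obtain b where ab: "\<forall>i\<in>I. a i \<in> W \<and> a i \<noteq> 0 \<and> (\<forall>x\<in>N i. a i \<bullet> x = b i)"
      by (rule bchoice[THEN exE])
    have "Q \<subseteq> (\<Union>i\<in>I. {x. a i \<bullet> x = b i})"
    proof
      fix z assume "z \<in> Q"
      then have "z \<in> P" "z \<notin> C" using \<open>Q \<subseteq> P\<close> \<open>Q \<subseteq> ball x e\<close> e(2) by blast+
      then obtain i where "i \<in> I" "z \<in> N i" using assms(6) by blast
      then show "z \<in> (\<Union>i\<in>I. {x. a i \<bullet> x = b i})" using ab by blast
    qed
    moreover have "Q \<noteq> {}" using x by (auto simp: Q_def)
    ultimately obtain i where i: "i \<in> I" "Q \<subseteq> {x. a i \<bullet> x = b i}"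
      using convex_in_hyperplanes[OF assms(5) \<open>convex Q\<close>] by blast
    have "a i \<bullet> y = a i \<bullet> x" if "y \<in> P" for y
    proof -
      have "a i \<bullet> (x + t *\<^sub>R (y - x)) = b i" "a i \<bullet> (x + t *\<^sub>R (x - x)) = b i"
        using i that x by (auto simp: Q_def)
      then have "t * (a i \<bullet> (y - x)) = 0" by (simp add: inner_add_right)
      then show ?thesis using t by (simp add: inner_diff_right)
    qed
    then have "thin W P" unfolding thin_def using ab i by blast
    then show False using assms by blast
  qed
qed

lemma thin_cases_span:
  fixes K :: "'a::euclidean_space set"
  assumes W: "subspace W" and K: "K \<subseteq> W" and x: "x \<in> K" and n: "\<not> thin W K"
  shows "span ((\<lambda>y. y - x) ` K) = W"
proof (rule ccontr)
  let ?D = "(\<lambda>y. y - x) ` K"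
  assume ne: "span ?D \<noteq> W"
  have "?D \<subseteq> W" using W K x subspace_diff by blast
  then have "span ?D \<subseteq> W" using W span_minimal by blast
  then have "span ?D \<subset> span W" using ne W by (metis psubsetI span_eq_iff)
  then obtain a where a: "a \<noteq> 0" "a \<in> span W" "\<And>y. y \<in> span ?D \<Longrightarrow> orthogonal a y"
    using orthogonal_to_subspace_exists_gen by blast
  have "a \<bullet> y = a \<bullet> x" if "y \<in> K" for y
    using a(3)[OF span_base, of "y - x"] that by (auto simp: orthogonal_def inner_diff_right)
  then have "thin W K" unfolding thin_def using a W by (metis span_eq_iff)
  then show False using n by simp
qed

lemma nonthin_affine_hull:
  fixes K :: "'a::euclidean_space set"
  assumes W: "subspace W" and K: "K \<subseteq> W" "K \<noteq> {}" and n: "\<not> thin W K"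
  shows "affine hull K = W"
proof -
  obtain x where x: "x \<in> K" using K by auto
  have "affine hull K = (+) x ` span ((+) (- x) ` K)"
    using affine_hull_span_gen[of x K] x hull_inc by metis
  also have "(+) (- x) ` K = (\<lambda>y. y - x) ` K" by (rule image_cong) auto
  also have "span \<dots> = W" using thin_cases_span[OF W K(1) x n] .
  also have "(+) x ` W = W"
  proof
    show "(+) x ` W \<subseteq> W" using W K x subspace_add by blast
    show "W \<subseteq> (+) x ` W"
    proof
      fix y assume "y \<in> W"
      then have "y - x \<in> W" using W K x subspace_diff by blast
      then have "x + (y - x) \<in> (+) x ` W" by blast
      then show "y \<in> (+) x ` W" by simp
    qed
  qed
  finally show ?thesis .
qed

lemma thin_empty: "a \<in> W \<Longrightarrow> a \<noteq> 0 \<Longrightarrow> thin W {}"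
  unfolding thin_def by blast

text \<open>Both affine hulls are all of \<open>W\<close>, so a common point of the relative
  interiors would put a ball of \<open>W\<close> into \<open>K \<inter> L\<close>, which fits into
  no hyperplane. Hence the relative interiors are disjoint and can be separated, and closures carry
  the inequality over to \<open>K\<close> and \<open>L\<close>.\<close>

lemma nonthin_separate:
  fixes K L :: "'a::euclidean_space set"
  assumes W: "subspace W" "c \<in> W" "c \<noteq> 0" and K: "cbody W K" and L: "cbody W L"
    and nK: "\<not> thin W K" and nL: "\<not> thin W L" and KL: "thin W (K \<inter> L)"
  shows "\<exists>a b. a \<in> W \<and> a \<noteq> 0 \<and> (\<forall>x\<in>K. a \<bullet> x \<ge> b) \<and> (\<forall>x\<in>L. a \<bullet> x \<le> b)"
proof -
  have KW: "K \<subseteq> W" "L \<subseteq> W" "convex K" "convex L" "compact K" "compact L"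
    using K L unfolding cbody_def by auto
  have ne: "K \<noteq> {}" "L \<noteq> {}" using nK nL thin_empty W by blast+
  have ah: "affine hull K = W" "affine hull L = W"
    using nonthin_affine_hull W KW ne nK nL by blast+
  have disj: "rel_interior K \<inter> rel_interior L = {}"
  proof (rule ccontr)
    assume "\<not> ?thesis"
    then obtain z where z: "z \<in> rel_interior K" "z \<in> rel_interior L" by blast
    obtain e1 where e1: "e1 > 0" "cball z e1 \<inter> W \<subseteq> K"
      using z(1) ah unfolding mem_rel_interior_cball by auto
    obtain e2 where e2: "e2 > 0" "cball z e2 \<inter> W \<subseteq> L"
      using z(2) ah unfolding mem_rel_interior_cball by auto
    define e where "e = min e1 e2"
    obtain a b where ab: "a \<in> W" "a \<noteq> 0" "\<And>x. x \<in> K \<inter> L \<Longrightarrow> a \<bullet> x = b"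
      using KL unfolding thin_def by blast
    have zW: "z \<in> W" using z(1) rel_interior_subset KW by blast
    let ?y = "z + (e / norm a) *\<^sub>R a"
    have "?y \<in> W" using zW ab W subspace_add subspace_scale by blast
    moreover have "dist z ?y \<le> e" using ab e1 e2 by (simp add: dist_norm e_def)
    ultimately have "?y \<in> K \<inter> L" using e1 e2 by (auto simp: e_def subset_iff)
    moreover have "z \<in> K \<inter> L" using z rel_interior_subset by blast
    ultimately have "a \<bullet> ?y = a \<bullet> z" using ab by metis
    then show False using ab e1 e2 by (auto simp: inner_add_right e_def)
  qed
  define D where "D = {x - y | x y. x \<in> rel_interior K \<and> y \<in> rel_interior L}"
  have "D = (\<Union>x\<in>rel_interior K. \<Union>y\<in>rel_interior L. {x - y})" unfolding D_def by auto
  then have D: "convex D"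
    using convex_differences[OF convex_rel_interior[OF KW(3)] convex_rel_interior[OF KW(4)]] by simp
  have "D \<noteq> {}" 
  proof -
    have "rel_interior K \<noteq> {}" "rel_interior L \<noteq> {}" using ne KW rel_interior_eq_empty by blast+
    then obtain x y where "x \<in> rel_interior K" "y \<in> rel_interior L" by blast
    then show ?thesis unfolding D_def by blast
  qed
  moreover have "0 \<notin> D" unfolding D_def using disj by auto
  \<comment> \<open>Separating \<open>0\<close> from the difference set inside the span of that set
    is what produces a normal in \<open>W\<close>.\<close>
  ultimately obtain a where a: "a \<in> span D" "a \<noteq> 0" "\<And>x. x \<in> D \<Longrightarrow> 0 \<le> a \<bullet> x"
    using separating_hyperplane_set_0_inspan[OF D] by blast
  have "D \<subseteq> W" unfolding D_def using KW W rel_interior_subset subspace_diff by blast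
  then have aW: "a \<in> W" using a W span_minimal by blast
  have 1: "a \<bullet> y \<le> a \<bullet> x" if "x \<in> rel_interior K" "y \<in> rel_interior L" for x y
  proof -
    have "0 \<le> a \<bullet> (x - y)" using that a(3)[of "x - y"] unfolding D_def by blast
    then show ?thesis by (simp add: inner_diff_right)
  qed
  have 2: "a \<bullet> y \<le> a \<bullet> x" if "x \<in> K" "y \<in> rel_interior L" for x y
  proof -
    have "rel_interior K \<subseteq> {x. a \<bullet> x \<ge> a \<bullet> y}" using 1 that by auto
    then have "closure (rel_interior K) \<subseteq> {x. a \<bullet> x \<ge> a \<bullet> y}"
      by (rule closure_minimal) (rule closed_halfspace_ge)
    then show ?thesis using that convex_closure_rel_interior[OF KW(3)] closure_subset by fastforce
  qed
  have 3: "a \<bullet> y \<le> a \<bullet> x" if "x \<in> K" "y \<in> L" for x y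
  proof -
    have "rel_interior L \<subseteq> {y. a \<bullet> y \<le> a \<bullet> x}" using 2 that by auto
    then have "closure (rel_interior L) \<subseteq> {y. a \<bullet> y \<le> a \<bullet> x}"
      by (rule closure_minimal) (rule closed_halfspace_le)
    then show ?thesis using that convex_closure_rel_interior[OF KW(4)] closure_subset by fastforce
  qed
  have "\<forall>x\<in>K. a \<bullet> x \<ge> Sup ((\<bullet>) a ` L)" using 3 ne by (auto intro!: cSUP_least)
  moreover have "\<forall>x\<in>L. a \<bullet> x \<le> Sup ((\<bullet>) a ` L)"
  proof
    fix x assume x: "x \<in> L"
    obtain x0 where "x0 \<in> K" using ne by blast
    then have "bdd_above ((\<bullet>) a ` L)" using 3 by (auto intro!: bdd_aboveI[of _ "a \<bullet> x0"])
    then show "a \<bullet> x \<le> Sup ((\<bullet>) a ` L)" using x by (intro cSUP_upper)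
  qed
  ultimately show ?thesis using aW a(2) by blast
qed

text \<open>Induction on the number of pieces that are not thin. Two such pieces are separated by a
  hyperplane; on either side of it one of the two becomes thin, so both halves have fewer. With at
  most one such piece left, \<open>P\<close> is that piece by \<open>cover_nonthin\<close>, or
  everything is thin. Dissections that are not face to face are thereby covered.\<close>

lemma dissection_sum:
  fixes f :: "'a::euclidean_space set \<Rightarrow> 'b::real_normed_vector"
  assumes W: "subspace W" "c \<in> W" "c \<noteq> 0" and f: "val W f" "simple W f" and I: "finite I"
    and P: "cbody W P" and K: "\<And>i. i \<in> I \<Longrightarrow> cbody W (K i)" and PU: "P = (\<Union>i\<in>I. K i)"
    and disj: "\<And>i j. i \<in> I \<Longrightarrow> j \<in> I \<Longrightarrow> i \<noteq> j \<Longrightarrow> thin W (K i \<inter> K j)"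
  shows "f P = (\<Sum>i\<in>I. f (K i))"
  using P K PU disj
proof (induction "card {i\<in>I. \<not> thin W (K i)}" arbitrary: P K rule: less_induct)
  case less
  let ?N = "{i\<in>I. \<not> thin W (K i)}"
  have f0: "f L = 0" if "cbody W L" "thin W L" for L using f that unfolding simple_def by blast
  have finN: "finite ?N" using I by simp
  show ?case
  proof (cases "\<exists>i\<in>?N. \<exists>j\<in>?N. i \<noteq> j")
    case True
    then obtain i j where ij: "i \<in> ?N" "j \<in> ?N" "i \<noteq> j" by blast
    then obtain a b where ab: "a \<in> W" "a \<noteq> 0" "\<forall>x\<in>K i. a \<bullet> x \<ge> b" "\<forall>x\<in>K j. a \<bullet> x \<le> b"
      using nonthin_separate[OF W, of "K i" "K j"] less.prems by auto
    let ?L = "{x. a \<bullet> x \<le> b}" and ?G = "{x. a \<bullet> x \<ge> b}"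
    have cb: "cbody W (M \<inter> ?L)" "cbody W (M \<inter> ?G)" if "cbody W M" for M
      using that by (auto intro!: cbody_Int_closed simp: closed_halfspace_le closed_halfspace_ge
        convex_halfspace_le convex_halfspace_ge)
    have part: "f (P \<inter> H) = (\<Sum>l\<in>I. f (K l \<inter> H))"
      if H: "H = ?L \<or> H = ?G" and m: "m \<in> ?N" "thin W (K m \<inter> H)" for H m
    proof (rule less.hyps)
      have "{l\<in>I. \<not> thin W (K l \<inter> H)} \<subset> ?N"
        using m thin_subset[of W _ ] by (blast intro: thin_subset[of W "K _"])
      then show "card {l\<in>I. \<not> thin W (K l \<inter> H)} < card ?N" using psubset_card_mono finN by blast
      show "cbody W (P \<inter> H)" using H cb less.prems by auto
      show "\<And>i. i \<in> I \<Longrightarrow> cbody W (K i \<inter> H)" using H cb less.prems by auto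
      show "P \<inter> H = (\<Union>i\<in>I. K i \<inter> H)" using less.prems by blast
      show "\<And>i j. i \<in> I \<Longrightarrow> j \<in> I \<Longrightarrow> i \<noteq> j \<Longrightarrow> thin W (K i \<inter> H \<inter> (K j \<inter> H))"
        by (rule thin_subset[OF less.prems(4)]) auto
    qed
    \<comment> \<open>\<open>K i\<close> lies on the upper side, so its part in the lower half is
      contained in the cutting hyperplane; the same holds for \<open>K j\<close> with the sides
      exchanged.\<close>
    have ti: "thin W (K i \<inter> ?L)" "thin W (K j \<inter> ?G)"
      unfolding thin_def using ab by (force intro!: bexI[of _ a] exI[of _ b])+
    have "f P = f (P \<inter> ?L) + f (P \<inter> ?G)" using val_cut[OF f less.prems(1) ab(1,2)] .
    also have "\<dots> = (\<Sum>l\<in>I. f (K l \<inter> ?L)) + (\<Sum>l\<in>I. f (K l \<inter> ?G))"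
      using part[OF _ ij(1) ti(1)] part[OF _ ij(2) ti(2)] by simp
    also have "\<dots> = (\<Sum>l\<in>I. f (K l))"
      unfolding sum.distrib[symmetric] using val_cut[OF f _ ab(1,2)] less.prems(2)
      by (intro sum.cong) auto
    finally show ?thesis .
  next
    case False
    show ?thesis
    proof (cases "thin W P")
      case True
      then have "\<And>i. i \<in> I \<Longrightarrow> f (K i) = 0" using f0 less.prems thin_subset by blast
      then show ?thesis using f0 True less.prems by simp
    next
      case nP: False
      have "?N \<noteq> {}"
      proof
        assume "?N = {}"
        have "P \<subseteq> {}"
        proof (rule cover_nonthin[where W = W and I = I and N = K])
          show "convex P" "bounded P"
            using less.prems(1) by (auto simp: cbody_def compact_imp_bounded)
          show "P \<subseteq> {} \<union> (\<Union>l\<in>I. K l)" using less.prems(3) by blast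
          show "thin W (K l)" if "l \<in> I" for l using \<open>?N = {}\<close> that by blast
        qed (use nP I in auto)
        then show False using nP thin_empty W by auto
      qed
      then obtain i where i: "i \<in> ?N" by blast
      then have N: "?N = {i}" using False by blast
      have "P \<subseteq> K i"
      proof (rule cover_nonthin[where W = W and I = "I - {i}" and N = K])
        show "convex P" "bounded P" "closed (K i)"
          using less.prems(1,2) i by (auto simp: cbody_def compact_imp_bounded compact_imp_closed)
        show "P \<subseteq> K i \<union> (\<Union>l\<in>I - {i}. K l)" using less.prems(3) by blast
        show "thin W (K l)" if "l \<in> I - {i}" for l using N that by blast
      qed (use nP I in auto)
      then have "P = K i" using less.prems i by blast
      moreover have "(\<Sum>l\<in>I. f (K l)) = f (K i)"
      proof -
        have "(\<Sum>l\<in>I. f (K l)) = f (K i) + (\<Sum>l\<in>I - {i}. f (K l))"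
          using sum.remove[OF I, of i] i by simp
        also have "(\<Sum>l\<in>I - {i}. f (K l)) = 0"
          using N f0 less.prems(2) by (intro sum.neutral) blast
        finally show ?thesis by simp
      qed
      ultimately show ?thesis by simp
    qed
  qed
qed

section \<open>Simplices, polytopes and approximation\<close>

lemma small_thin:
  fixes S :: "'a::euclidean_space set"
  assumes W: "subspace W" "S \<subseteq> W" "finite S" "card S \<le> dim W" "dim W > 0"
  shows "thin W (convex hull S)"
proof -
  have "\<exists>a\<in>W. a \<noteq> 0 \<and> (\<exists>b. \<forall>x\<in>S. a \<bullet> x = b)"
  proof (cases "S = {}")
    case True
    have "W \<noteq> {0}" using assms(5) by (auto)
    then show ?thesis using True subspace_0[OF W(1)] by blast
  next
    case False
    then obtain s where s: "s \<in> S" by blast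
    let ?D = "(\<lambda>y. y - s) ` (S - {s})"
    have "dim ?D \<le> card ?D" using W by (simp add: dim_le_card')
    also have "\<dots> \<le> card (S - {s})" using W card_image_le by blast
    also have "\<dots> < card S" using s W by (meson card_Diff1_less)
    finally have d: "dim ?D < dim W" using W by simp
    have "?D \<subseteq> W" using W s subspace_diff by blast
    then have "span ?D \<subseteq> span W" using span_mono by blast
    moreover have "span ?D \<noteq> span W" using d by (metis dim_span less_irrefl)
    ultimately obtain a where a: "a \<noteq> 0" "a \<in> span W" "\<And>y. y \<in> span ?D \<Longrightarrow> orthogonal a y"
      using orthogonal_to_subspace_exists_gen by blast
    have "a \<bullet> y = a \<bullet> s" if "y \<in> S" for y
    proof (cases "y = s")
      case False
      then show ?thesis using a(3)[OF span_base, of "y - s"] that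
        by (auto simp: orthogonal_def inner_diff_right)
    qed simp
    then show ?thesis using a W by (metis span_eq_iff)
  qed
  then obtain a b where ab: "a \<in> W" "a \<noteq> 0" "\<forall>x\<in>S. a \<bullet> x = b" by blast
  have "convex hull S \<subseteq> {x. a \<bullet> x = b}"
    by (rule hull_minimal) (use ab in \<open>auto simp: convex_hyperplane\<close>)
  then show ?thesis unfolding thin_def using ab by blast
qed

lemma affine_hull_card:
  fixes S :: "'a::euclidean_space set"
  assumes W: "subspace W" "S \<subseteq> W" "\<not> affine_dependent S" "card S = dim W + 1"
  shows "affine hull S = W"
proof -
  have "finite S" using W(3) aff_independent_finite by blast
  have "aff_dim S = int (dim W)" using aff_dim_affine_independent[OF W(3)] W(4) by simp
  also have "\<dots> = aff_dim W" using aff_dim_subspace[OF W(1)] by simp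
  finally have "aff_dim (affine hull S) = aff_dim W" by simp
  moreover have "affine hull S \<subseteq> W" using W by (simp add: hull_minimal subspace_imp_affine)
  moreover have "S \<noteq> {}" using W by auto
  ultimately show ?thesis
    by (metis W(1) affine_affine_hull affine_dim_equal affine_hull_eq_empty subspace_imp_affine)
qed

text \<open>The cones from \<open>p\<close> over the facets cover the simplex, and two of them meet
  in the hull of \<open>p\<close> and the \<open>dim W - 1\<close> common vertices, which is thin.
  For \<open>p\<close> on a facet, the cone over that facet degenerates to the facet and contributes
  \<open>0\<close>.\<close>

lemma star_sum:
  fixes f :: "'a::euclidean_space set \<Rightarrow> 'b::real_normed_vector"
  assumes W: "subspace W" "dim W > 0" and f: "val W f" "simple W f"
    and S: "S \<subseteq> W" "\<not> affine_dependent S" "card S = dim W + 1" and p: "p \<in> convex hull S"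
  shows "f (convex hull S) = (\<Sum>b\<in>S. f (convex hull (insert p (S - {b}))))"
proof -
  have fin: "finite S" using S(2) aff_independent_finite by blast
  have pW: "p \<in> W" using p hull_minimal[OF S(1), of convex] W(1) subspace_imp_convex by blast
  obtain c where c: "c \<in> W" "c \<noteq> 0" using W(2) by (metis dim_eq_0 less_irrefl subsetI singleton_iff)
  show ?thesis
  proof (rule dissection_sum[where W = W and I = S and f = f and P = "convex hull S" and c = c and K = "\<lambda>b. convex hull (insert p (S - {b}))"])
    show "cbody W (convex hull S)" using cbody_hull fin S W by blast
    show "cbody W (convex hull (insert p (S - {i})))" if "i \<in> S" for i
      using cbody_hull[of "insert p (S - {i})" W] fin S(1) W(1) pW by auto
    show "convex hull S = (\<Union>i\<in>S. convex hull (insert p (S - {i})))"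
      using convex_hull_exchange_Union[OF p] .
    show "thin W (convex hull (insert p (S - {i})) \<inter> convex hull (insert p (S - {j})))"
      if ij: "i \<in> S" "j \<in> S" "i \<noteq> j" for i j
    proof -
      have "convex hull (insert p (S - {i})) \<inter> convex hull (insert p (S - {j}))
          = convex hull (insert p ((S - {i}) \<inter> (S - {j})))"
        by (rule convex_hull_exchange_Int[OF S(2) p]) auto
      also have "(S - {i}) \<inter> (S - {j}) = S - {i,j}" by auto
      also have "thin W (convex hull (insert p (S - {i,j})))"
      proof (rule small_thin[OF W(1) _ _ _ W(2)])
        have "card (S - {i,j}) = card S - 2" using ij fin by (subst card_Diff_subset) auto
        then show "card (insert p (S - {i,j})) \<le> dim W"
          using S(3) card_insert_le_m1[of "dim W" "S - {i,j}" p] W(2) by simp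
      qed (use pW S(1) fin in auto)
      finally show ?thesis .
    qed
  qed (fact W(1) c f fin)+
qed

lemma aff_dim_thin:
  fixes K :: "'a::euclidean_space set"
  assumes W: "subspace W" "dim W > 0" and K: "K \<subseteq> W" "aff_dim K < int (dim W)"
  shows "thin W K"
proof (rule ccontr)
  assume n: "\<not> thin W K"
  obtain c where c: "c \<in> W" "c \<noteq> 0" using W(2) by (metis dim_eq_0 less_irrefl subsetI singleton_iff)
  have "K \<noteq> {}" using n thin_empty[OF c] by blast
  then have "affine hull K = W" using nonthin_affine_hull[OF W(1) K(1) _ n] by blast
  then have "aff_dim K = int (dim W)" using aff_dim_subspace[OF W(1)] aff_dim_affine_hull[of K] by simp
  then show False using K by simp
qed

lemma polytope_zero:
  fixes f :: "'a::euclidean_space set \<Rightarrow> 'b::real_normed_vector"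
  assumes W: "subspace W" "dim W > 0" and f: "val W f" "simple W f"
    and s: "\<And>S. S \<subseteq> W \<Longrightarrow> \<not> affine_dependent S \<Longrightarrow> card S = dim W + 1 \<Longrightarrow> f (convex hull S) = 0"
    and V: "finite V" "V \<subseteq> W"
  shows "f (convex hull V) = 0"
proof -
  let ?P = "convex hull V"
  have P: "cbody W ?P" using cbody_hull V W by blast
  obtain c where c: "c \<in> W" "c \<noteq> 0" using W(2) by (metis dim_eq_0 less_irrefl subsetI singleton_iff)
  show ?thesis
  proof (cases "thin W ?P")
    case True then show ?thesis using f P unfolding simple_def by blast
  next
    case False
    have PW: "?P \<subseteq> W" using P unfolding cbody_def by blast
    have "\<not> aff_dim ?P < int (dim W)" using aff_dim_thin[OF W PW] False by blast
    moreover have "aff_dim ?P \<le> int (dim W)"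
      using aff_dim_subset[OF PW] aff_dim_subspace[OF W(1)] by simp
    ultimately have d: "aff_dim ?P = int (dim W)" by simp
    have pol: "polytope ?P" using V polytope_def by blast
    obtain T where T: "triangulation T" "\<And>k. k \<in> T \<Longrightarrow> aff_dim k = int (dim W)" "\<Union>T = \<Union>{?P}"
      "\<And>k. k \<in> T \<Longrightarrow> \<exists>C\<in>{?P}. k \<subseteq> C"
    \<comment> \<open>The mesh bound \<open>1\<close> is arbitrary: any triangulation of the
      polytope into full-dimensional simplices serves.\<close>
    proof (rule fine_triangular_subdivision_of_cell_complex[of 1 "{?P}" "int (dim W)"])
    qed (use pol d in \<open>auto simp: face_of_refl_eq\<close>)
    have simp: "\<exists>S. S \<subseteq> W \<and> \<not> affine_dependent S \<and> card S = dim W + 1 \<and> k = convex hull S" if k: "k \<in> T" for k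
    proof -
      obtain n where "n simplex k" using T(1) k unfolding triangulation_def by blast
      then obtain S where S: "\<not> affine_dependent S" "int (card S) = n + 1" "k = convex hull S"
        unfolding simplex_def by blast
      have "aff_dim k = n" using aff_dim_affine_independent[OF S(1)] S by (simp add: aff_dim_convex_hull)
      then have "n = int (dim W)" using T(2)[OF k] by simp
      moreover have "S \<subseteq> W" using T(4)[OF k] PW S(3) hull_subset[of S convex] by blast
      ultimately show ?thesis using S by auto
    qed
    have kb: "cbody W k" if k: "k \<in> T" for k
      using simp[OF k] cbody_hull W aff_independent_finite by blast
    have kcv: "convex k" if k: "k \<in> T" for k using kb[OF k] unfolding cbody_def by blast
    have "f ?P = (\<Sum>k\<in>T. f k)"
    proof (rule dissection_sum[where W = W and I = T and f = f and P = ?P and c = c and K = "\<lambda>k. k"])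
      show "finite T" using T(1) unfolding triangulation_def by blast
      show "?P = (\<Union>k\<in>T. k)" using T(3) by simp
      fix k l assume kl: "k \<in> T" "l \<in> T" "k \<noteq> l"
      have F: "k \<inter> l face_of k" "k \<inter> l face_of l"
        using T(1) kl unfolding triangulation_def by (blast, metis Int_commute)
      \<comment> \<open>The common face of two distinct simplices is a proper face of at least one
        of them.\<close>
      have "aff_dim (k \<inter> l) < int (dim W)"
      proof (cases "k \<inter> l = k")
        case False
        then show ?thesis using face_of_aff_dim_lt[OF kcv[OF kl(1)] F(1)] T(2)[OF kl(1)] by simp
      next
        case True
        then have "k \<inter> l \<noteq> l" using kl by simp
        then show ?thesis using face_of_aff_dim_lt[OF kcv[OF kl(2)] F(2)] T(2)[OF kl(2)] by simp
      qed
      moreover have "k \<inter> l \<subseteq> W" using kb[OF kl(1)] unfolding cbody_def by blast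
      ultimately show "thin W (k \<inter> l)" using aff_dim_thin[OF W] by blast
    qed (use W c f P kb in auto)
    also have "\<dots> = 0" using simp s by (intro sum.neutral) metis
    finally show ?thesis .
  qed
qed

text \<open>The hull of a finite \<open>d\<close>-net of \<open>K\<close> is a polytope inside
  \<open>K\<close> at Hausdorff distance at most \<open>d\<close>, so continuity at \<open>K\<close>
  passes the value \<open>0\<close> from polytopes to \<open>K\<close>.\<close>

lemma zero_of_simplices:
  fixes f :: "'a::euclidean_space set \<Rightarrow> 'b::real_normed_vector"
  assumes W: "subspace W" "dim W > 0" and f: "val W f" "simple W f" "hcont W f"
    and s: "\<And>S. S \<subseteq> W \<Longrightarrow> \<not> affine_dependent S \<Longrightarrow> card S = dim W + 1 \<Longrightarrow> f (convex hull S) = 0"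
    and K: "cbody W K"
  shows "f K = 0"
proof (cases "K = {}")
  case True then show ?thesis using f(1) unfolding val_def by simp
next
  case False
  have KK: "compact K" "convex K" "K \<subseteq> W" using K unfolding cbody_def by auto
  have "norm (f K) < e" if e: "e > 0" for e
  proof -
    obtain d where d: "d > 0" "\<And>L. cbody W L \<Longrightarrow> L \<noteq> {} \<Longrightarrow> near d K L \<Longrightarrow> norm (f L - f K) < e"
      using f(3) K False e unfolding hcont_def by blast
    have "\<exists>V. finite V \<and> V \<subseteq> K \<and> K \<subseteq> (\<Union>x\<in>V. ball x d)"
      using seq_compact_imp_totally_bounded[OF compact_imp_seq_compact[OF KK(1)]] d(1) by simp
    then obtain V where V: "finite V" "V \<subseteq> K" "K \<subseteq> (\<Union>x\<in>V. ball x d)" by blast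
    have VK: "convex hull V \<subseteq> K" using V KK hull_minimal by blast
    have VW: "V \<subseteq> W" using V KK by blast
    have "near d K (convex hull V)" unfolding near_def
    proof (intro conjI ballI)
      fix x assume "x \<in> K"
      then obtain v where "v \<in> V" "dist v x < d" using V(3) by auto
      then show "\<exists>y\<in>convex hull V. dist x y \<le> d"
        by (intro bexI[of _ v]) (auto simp: dist_commute hull_inc)
    next
      fix y assume "y \<in> convex hull V"
      then show "\<exists>x\<in>K. dist x y \<le> d" using VK d(1) by (intro bexI[of _ y]) auto
    qed
    moreover have "convex hull V \<noteq> {}" using V(3) False by auto
    ultimately have "norm (f (convex hull V) - f K) < e"
      using d(2) cbody_hull[OF V(1) VW W(1)] by blast
    then show ?thesis using polytope_zero[OF W f(1,2) s V(1) VW] by simp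
  qed
  then have "norm (f K) \<le> 0" by (meson less_irrefl not_le)
  then show ?thesis by simp
qed

text \<open>Facet data for all later work with a simplex: \<open>u s\<close> is the inner unit
  normal of the facet opposite \<open>s\<close>, \<open>b s\<close> the level of that facet and
  \<open>h s\<close> the height of \<open>s\<close> over it. The barycentric coordinate of
  \<open>x\<close> at \<open>s\<close> is \<open>(u s \<bullet> x - b s) / h s\<close>.\<close>

lemma simplex_halfspaces:
  fixes S :: "'a::euclidean_space set"
  assumes W: "subspace W" "dim W > 0"
    and S: "S \<subseteq> W" "\<not> affine_dependent S" "card S = dim W + 1"
  obtains u b h where "\<And>s. s \<in> S \<Longrightarrow> u s \<in> W" "\<And>s. s \<in> S \<Longrightarrow> norm (u s) = 1"
    "\<And>s. s \<in> S \<Longrightarrow> h s > (0::real)" "\<And>s t. s \<in> S \<Longrightarrow> t \<in> S \<Longrightarrow> t \<noteq> s \<Longrightarrow> u s \<bullet> t = b s"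
    "\<And>s. s \<in> S \<Longrightarrow> u s \<bullet> s = b s + h s"
    "convex hull S = {x\<in>W. \<forall>s\<in>S. b s \<le> u s \<bullet> x}"
    "\<And>s. s \<in> S \<Longrightarrow> convex hull (S - {s}) = {x\<in>convex hull S. u s \<bullet> x = b s}"
proof -
  have fin: "finite S" using S(2) aff_independent_finite by blast
  have ah: "affine hull S = W" using affine_hull_card[OF W(1) S] .
  have "\<forall>s\<in>S. \<exists>ub. fst ub \<in> W \<and> norm (fst ub) = 1 \<and> (\<forall>t\<in>S - {s}. fst ub \<bullet> t = snd ub) \<and> fst ub \<bullet> s > snd ub"
  proof
    fix s assume s: "s \<in> S"
    have "thin W (convex hull (S - {s}))"
      by (rule small_thin[OF W(1) _ _ _ W(2)]) (use s S fin in auto)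
    then obtain a b where ab: "a \<in> W" "a \<noteq> 0" "\<And>x. x \<in> convex hull (S - {s}) \<Longrightarrow> a \<bullet> x = b"
      unfolding thin_def by blast
    have at: "a \<bullet> t = b" if "t \<in> S - {s}" for t using ab(3) hull_inc that by metis
    have as: "a \<bullet> s \<noteq> b"
    proof
      assume "a \<bullet> s = b"
      then have "S \<subseteq> {x. a \<bullet> x = b}" using at by blast
      then have "affine hull S \<subseteq> {x. a \<bullet> x = b}" by (simp add: hull_minimal affine_hyperplane)
      then have "a \<bullet> 0 = b" "a \<bullet> a = b" using ah ab(1) subspace_0[OF W(1)] by blast+
      then show False using ab(2) by simp
    qed
    \<comment> \<open>The factor normalises \<open>a\<close> and turns it towards
      \<open>s\<close>.\<close>
    define k where "k = sgn (a \<bullet> s - b) / norm a"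
    have k: "\<bar>k\<bar> = 1 / norm a" "k * (a \<bullet> s - b) > 0"
      using as ab(2) by (auto simp: k_def abs_mult sgn_if)
    show "\<exists>ub. fst ub \<in> W \<and> norm (fst ub) = 1 \<and> (\<forall>t\<in>S - {s}. fst ub \<bullet> t = snd ub) \<and> fst ub \<bullet> s > snd ub"
      by (rule exI[of _ "(k *\<^sub>R a, k * b)"])
        (use ab k at W in \<open>auto simp: subspace_scale right_diff_distrib\<close>)
  qed
  then obtain ub where ub: "\<forall>s\<in>S. fst (ub s) \<in> W \<and> norm (fst (ub s)) = 1 \<and>
      (\<forall>t\<in>S - {s}. fst (ub s) \<bullet> t = snd (ub s)) \<and> fst (ub s) \<bullet> s > snd (ub s)"
    by (rule bchoice[THEN exE])
  define u b h where "u s = fst (ub s)" and "b s = snd (ub s)" and "h s = u s \<bullet> s - b s" for s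
  have u: "u s \<in> W" "norm (u s) = 1" "h s > 0" "u s \<bullet> s = b s + h s" if "s \<in> S" for s
    using ub that by (auto simp: u_def b_def h_def)
  have ut: "u s \<bullet> t = b s" if "s \<in> S" "t \<in> S" "t \<noteq> s" for s t using ub that by (auto simp: u_def b_def)
  have bary: "(\<Sum>s\<in>S. (u s \<bullet> x - b s) / h s) = 1 \<and> (\<Sum>s\<in>S. ((u s \<bullet> x - b s) / h s) *\<^sub>R s) = x" if x: "x \<in> W" for x
  proof -
    obtain l where l: "sum l S = 1" "(\<Sum>v\<in>S. l v *\<^sub>R v) = x"
      using x ah affine_hull_finite[OF fin] by auto
    have "(u s \<bullet> x - b s) / h s = l s" if s: "s \<in> S" for s
    proof -
      have "u s \<bullet> x - b s = (\<Sum>v\<in>S. l v * (u s \<bullet> v)) - (\<Sum>v\<in>S. l v * b s)"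
        unfolding l(2)[symmetric] sum_distrib_right[symmetric] using l(1) by (simp add: inner_sum_right)
      also have "\<dots> = (\<Sum>v\<in>S. l v * (u s \<bullet> v - b s))" by (simp add: sum_subtractf right_diff_distrib)
      also have "\<dots> = (\<Sum>v\<in>S. if v = s then l s * h s else 0)"
        using u(4)[OF s] ut[OF s] by (intro sum.cong) auto
      also have "\<dots> = l s * h s" using fin s by simp
      finally show ?thesis using u(3)[OF s] by simp
    qed
    then show ?thesis using l by simp
  qed
  have hull: "convex hull S = {x\<in>W. \<forall>s\<in>S. b s \<le> u s \<bullet> x}"
  proof
    have "S \<subseteq> {x\<in>W. \<forall>s\<in>S. b s \<le> u s \<bullet> x}"
    proof
      fix t assume t: "t \<in> S"
      have "b s \<le> u s \<bullet> t" if "s \<in> S" for s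
        using ut[OF that t] u(3,4)[OF that] by (cases "t = s") auto
      then show "t \<in> {x\<in>W. \<forall>s\<in>S. b s \<le> u s \<bullet> x}" using t S by auto
    qed
    moreover have "{x\<in>W. \<forall>s\<in>S. b s \<le> u s \<bullet> x} = W \<inter> (\<Inter>s\<in>S. {x. b s \<le> u s \<bullet> x})" by auto
    moreover have "convex (W \<inter> (\<Inter>s\<in>S. {x. b s \<le> u s \<bullet> x}))"
      by (intro convex_Int subspace_imp_convex W convex_INT convex_halfspace_ge)
    ultimately show "convex hull S \<subseteq> {x\<in>W. \<forall>s\<in>S. b s \<le> u s \<bullet> x}"
      by (metis (no_types, lifting) hull_minimal)
    show "{x\<in>W. \<forall>s\<in>S. b s \<le> u s \<bullet> x} \<subseteq> convex hull S"
    proof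
      fix x assume x: "x \<in> {x\<in>W. \<forall>s\<in>S. b s \<le> u s \<bullet> x}"
      then have "\<forall>s\<in>S. 0 \<le> (u s \<bullet> x - b s) / h s" using u(3) by (auto simp: less_imp_le)
      moreover have "x \<in> W" using x by blast
      ultimately show "x \<in> convex hull S" unfolding convex_hull_finite[OF fin]
        using bary by (intro CollectI exI[of _ "\<lambda>s. (u s \<bullet> x - b s) / h s"] conjI) auto
    qed
  qed
  have face: "convex hull (S - {s}) = {x\<in>convex hull S. u s \<bullet> x = b s}" if s: "s \<in> S" for s
  proof
    have "S - {s} \<subseteq> {x\<in>convex hull S. u s \<bullet> x = b s}" using ut[OF s] by (auto intro: hull_inc)
    moreover have "{x\<in>convex hull S. u s \<bullet> x = b s} = convex hull S \<inter> {x. u s \<bullet> x = b s}" by auto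
    moreover have "convex (convex hull S \<inter> {x. u s \<bullet> x = b s})"
      by (intro convex_Int convex_convex_hull convex_hyperplane)
    ultimately show "convex hull (S - {s}) \<subseteq> {x\<in>convex hull S. u s \<bullet> x = b s}"
      by (metis (no_types, lifting) hull_minimal)
    show "{x\<in>convex hull S. u s \<bullet> x = b s} \<subseteq> convex hull (S - {s})"
    proof
      fix x assume x: "x \<in> {x\<in>convex hull S. u s \<bullet> x = b s}"
      then have xx: "x \<in> W" "\<forall>s\<in>S. 0 \<le> (u s \<bullet> x - b s) / h s" "(u s \<bullet> x - b s) / h s = 0"
        using u(3) hull by (auto simp: less_imp_le)
      have "(\<Sum>s\<in>S - {s}. (u s \<bullet> x - b s) / h s) = 1" "(\<Sum>s\<in>S - {s}. ((u s \<bullet> x - b s) / h s) *\<^sub>R s) = x"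
        using bary[OF xx(1)] sum.remove[OF fin s, of "\<lambda>s. (u s \<bullet> x - b s) / h s"]
          sum.remove[OF fin s, of "\<lambda>s. ((u s \<bullet> x - b s) / h s) *\<^sub>R s"] xx(3) by auto
      then show "x \<in> convex hull (S - {s})"
        unfolding convex_hull_finite[OF finite_Diff[OF fin]]
        using xx(2) by (intro CollectI exI[of _ "\<lambda>s. (u s \<bullet> x - b s) / h s"] conjI) auto
    qed
  qed
  show ?thesis by (rule that[of u h b]) (use u ut hull face in auto)
qed

section \<open>Valuations that are odd under reflections\<close>

text \<open>The normal is not normalised, and division by zero makes \<open>mirror 0\<close> the
  identity, so most identities hold without a side condition.\<close>

definition mirror :: "'a::euclidean_space \<Rightarrow> 'a \<Rightarrow> 'a" where
  "mirror v x = x - (2 * (x \<bullet> v) / (v \<bullet> v)) *\<^sub>R v"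

lemma linear_mirror: "linear (mirror v)"
  unfolding mirror_def by (rule linearI) (auto simp: algebra_simps inner_add_left add_divide_distrib)

lemma mirror_add: "mirror v (x + y) = mirror v x + mirror v y"
  and mirror_diff: "mirror v (x - y) = mirror v x - mirror v y"
  and mirror_scale: "mirror v (c *\<^sub>R x) = c *\<^sub>R mirror v x"
  using linear_mirror[of v] by (auto simp: linear_add linear_diff linear_scale)

lemma mirror_inner: "mirror v x \<bullet> mirror v y = x \<bullet> y"
  by (cases "v = 0") (auto simp: mirror_def inner_diff_left inner_diff_right inner_commute field_simps)

lemma mirror_mirror [simp]: "mirror v (mirror v x) = x"
  by (cases "v = 0") (auto simp: mirror_def inner_diff_left algebra_simps)

lemma mirror_self: "v \<noteq> 0 \<Longrightarrow> mirror v v = - v"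
  by (simp add: mirror_def algebra_simps scaleR_2)

lemma mirror_fix: "x \<bullet> v = 0 \<Longrightarrow> mirror v x = x"
  by (simp add: mirror_def)

lemma norm_mirror [simp]: "norm (mirror v x) = norm x"
  using mirror_inner[of v x x] by (simp add: norm_eq_sqrt_inner)

lemma mirror_in: "subspace W \<Longrightarrow> v \<in> W \<Longrightarrow> x \<in> W \<Longrightarrow> mirror v x \<in> W"
  unfolding mirror_def by (intro subspace_diff subspace_scale)

lemma cbody_linear: "linear g \<Longrightarrow> g ` W \<subseteq> W \<Longrightarrow> cbody W K \<Longrightarrow> cbody W (g ` K)"
  unfolding cbody_def
  by (auto intro!: compact_continuous_image convex_linear_image linear_continuous_on
      simp: linear_conv_bounded_linear)

lemma cbody_mirror: "subspace W \<Longrightarrow> v \<in> W \<Longrightarrow> cbody W K \<Longrightarrow> cbody W (mirror v ` K)"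
  by (rule cbody_linear[OF linear_mirror]) (auto intro: mirror_in)

lemma cbody_translate: "subspace W \<Longrightarrow> x \<in> W \<Longrightarrow> cbody W K \<Longrightarrow> cbody W ((+) x ` K)"
  unfolding cbody_def by (auto intro!: compact_translation convex_translation subspace_add)

text \<open>A translate of a thin body lies in a hyperplane through the origin and is fixed by the
  reflection in it, so its value equals its own negative.\<close>

lemma odd_valuation_simple:
  fixes f :: "'a::euclidean_space set \<Rightarrow> real"
  assumes W: "subspace W" and f: "val W f" "tinv W f"
    and odd: "\<And>v K. v \<in> W \<Longrightarrow> v \<noteq> 0 \<Longrightarrow> cbody W K \<Longrightarrow> f (mirror v ` K) = - f K"
  shows "simple W f"
  unfolding simple_def
proof (intro allI impI)
  fix K assume K: "cbody W K" "thin W K"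
  show "f K = 0"
  proof (cases "K = {}")
    case True then show ?thesis using f(1) unfolding val_def by simp
  next
    case False
    then obtain x where x: "x \<in> K" by blast
    obtain a b where ab: "a \<in> W" "a \<noteq> 0" "\<And>x. x \<in> K \<Longrightarrow> a \<bullet> x = b"
      using K(2) unfolding thin_def by blast
    have xW: "- x \<in> W" using x K(1) W subspace_neg unfolding cbody_def by blast
    let ?L = "(+) (- x) ` K"
    have L: "cbody W ?L" using cbody_translate[OF W xW K(1)] .
    have "mirror a y = y" if y: "y \<in> ?L" for y
    proof (rule mirror_fix)
      obtain z where "z \<in> K" "y = - x + z" using y by blast
      then show "y \<bullet> a = 0" using ab(3)[of z] ab(3)[OF x] by (simp add: inner_diff_right inner_commute)
    qed
    then have "mirror a ` ?L = ?L" by force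
    then have "f ?L = 0" using odd[OF ab(1,2) L] by simp
    moreover have "f ?L = f K" using f(2) K(1) xW unfolding tinv_def by blast
    ultimately show ?thesis by simp
  qed
qed

text \<open>\<open>g i j\<close> is the value on the hull of the ridge \<open>S - {i,j}\<close>, the
  incentre \<open>z\<close> and the contact point \<open>t i\<close>. The reflection in the
  hyperplane through \<open>z\<close> and that ridge exchanges \<open>t i\<close> with
  \<open>t j\<close>, so \<open>g\<close> is antisymmetric; its sum over all pairs, which is the
  value on the simplex, equals its own negative.\<close>

lemma odd_simplex_zero:
  fixes f :: "'a::euclidean_space set \<Rightarrow> real"
  assumes W: "subspace W" "dim W > 0" and f: "val W f" "tinv W f"
    and odd: "\<And>v K. v \<in> W \<Longrightarrow> v \<noteq> 0 \<Longrightarrow> cbody W K \<Longrightarrow> f (mirror v ` K) = - f K"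
    and S: "S \<subseteq> W" "\<not> affine_dependent S" "card S = dim W + 1"
  shows "f (convex hull S) = 0"
proof -
  have sm: "simple W f" using odd_valuation_simple[OF W(1) f odd] .
  have fin: "finite S" using S(2) aff_independent_finite by blast
  obtain u b h where u: "\<And>s. s \<in> S \<Longrightarrow> u s \<in> W" "\<And>s. s \<in> S \<Longrightarrow> norm (u s) = 1"
    "\<And>s. s \<in> S \<Longrightarrow> h s > (0::real)" "\<And>s t. s \<in> S \<Longrightarrow> t \<in> S \<Longrightarrow> t \<noteq> s \<Longrightarrow> u s \<bullet> t = b s"
    "\<And>s. s \<in> S \<Longrightarrow> u s \<bullet> s = b s + h s"
    "convex hull S = {x\<in>W. \<forall>s\<in>S. b s \<le> u s \<bullet> x}"
    "\<And>s. s \<in> S \<Longrightarrow> convex hull (S - {s}) = {x\<in>convex hull S. u s \<bullet> x = b s}"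
    by (rule simplex_halfspaces[OF W S]) (rule that)
  \<comment> \<open>A point at distance \<open>r\<close> from every facet has barycentric
    coordinates \<open>r / h s\<close>; they add up to \<open>1\<close> exactly for
    \<open>r = 1 / H\<close>.\<close>
  define H where "H = (\<Sum>s\<in>S. 1 / h s)"
  define r where "r = 1 / H"
  define z where "z = (\<Sum>s\<in>S. (1 / (H * h s)) *\<^sub>R s)" \<comment> \<open>the incentre, at distance \<open>r\<close> from each facet\<close>
  have "S \<noteq> {}" using S(3) by auto
  then have H: "H > 0" unfolding H_def using u(3) fin by (intro sum_pos) auto
  have r: "r > 0" using H by (simp add: r_def)
  have one: "(\<Sum>s\<in>S. 1 / (H * h s)) = 1"
  proof -
    have "(\<Sum>s\<in>S. 1 / (H * h s)) = (\<Sum>s\<in>S. (1 / H) * (1 / h s))" by (intro sum.cong) auto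
    also have "\<dots> = (1 / H) * H" unfolding sum_distrib_left[symmetric] H_def ..
    finally show ?thesis using H by simp
  qed
  have zu: "u s \<bullet> z = b s + r" if s: "s \<in> S" for s
  proof -
    have "u s \<bullet> z = (\<Sum>t\<in>S. (1 / (H * h t)) * (u s \<bullet> t))" by (simp add: z_def inner_sum_right)
    also have "\<dots> = (\<Sum>t\<in>S. (1 / (H * h t)) * b s + (if t = s then r else 0))"
    proof (rule sum.cong[OF refl])
      fix t assume t: "t \<in> S"
      show "(1 / (H * h t)) * (u s \<bullet> t) = (1 / (H * h t)) * b s + (if t = s then r else 0)"
        using u(4)[OF s t] u(5)[OF s] u(3)[OF s] H by (auto simp: r_def field_simps)
    qed
    also have "\<dots> = (\<Sum>t\<in>S. 1 / (H * h t)) * b s + r"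
      using fin s by (simp add: sum.distrib sum_distrib_right)
    also have "\<dots> = b s + r" using one by simp
    finally show ?thesis .
  qed
  have zW: "z \<in> W" unfolding z_def using S W by (intro subspace_sum subspace_scale) auto
  have zS: "z \<in> convex hull S" unfolding u(6) using zW zu r by (auto simp: less_imp_le)
  define t where "t s = z - r *\<^sub>R u s" for s \<comment> \<open>the point of contact of the inscribed ball\<close>
  have tS: "t s \<in> convex hull (S - {s})" if s: "s \<in> S" for s
  proof -
    have "u s \<bullet> u s = 1" using u(2)[OF s] by (simp add: norm_eq_1)
    then have 1: "u s \<bullet> t s = b s" using zu[OF s] by (simp add: t_def inner_diff_right)
    have "b k \<le> u k \<bullet> t s" if k: "k \<in> S" for k
    proof -
      have "u k \<bullet> u s \<le> 1" using norm_cauchy_schwarz[of "u k" "u s"] u(2) s k by simp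
      then have "r * (u k \<bullet> u s) \<le> r" using r by (simp add: mult_left_le)
      then show ?thesis using zu[OF k] by (simp add: t_def inner_diff_right)
    qed
    then show ?thesis using 1 u(1)[OF s] zW W(1) unfolding u(7)[OF s] u(6)
      by (auto simp: t_def intro!: subspace_diff subspace_scale)
  qed
  define g where "g i j = (if i = j then 0 else f (convex hull (insert (t i) (insert z (S - {i,j})))))" for i j
  have piece: "f (convex hull (insert z (S - {i}))) = (\<Sum>j\<in>S. g i j)" if i: "i \<in> S" for i
  proof -
    let ?Si = "insert z (S - {i})"
    have zn: "z \<notin> affine hull (S - {i})"
    proof
      assume "z \<in> affine hull (S - {i})"
      moreover have "affine hull (S - {i}) \<subseteq> {x. u i \<bullet> x = b i}"
        using u(4)[OF i] by (intro hull_minimal affine_hyperplane) auto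
      ultimately show False using zu[OF i] r by auto
    qed
    then have zn': "z \<notin> S - {i}" using hull_inc by metis
    have Si: "?Si \<subseteq> W" "\<not> affine_dependent ?Si" "card ?Si = dim W + 1"
      using S zW zn' fin i affine_independent_insert[OF affine_independent_Diff[OF S(2)] zn] by auto
    have ti: "t i \<in> convex hull ?Si" using tS[OF i] hull_mono[of "S - {i}" ?Si convex] by blast
    have "f (convex hull ?Si) = (\<Sum>j\<in>?Si. f (convex hull (insert (t i) (?Si - {j}))))"
      by (rule star_sum[OF W f(1) sm Si ti])
    \<comment> \<open>The summand for \<open>z\<close> is the facet opposite \<open>i\<close>, which
      already contains \<open>t i\<close> and is thin.\<close>
    also have "\<dots> = f (convex hull (insert (t i) (?Si - {z})))
        + (\<Sum>j\<in>S - {i}. f (convex hull (insert (t i) (?Si - {j}))))"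
      using zn' fin by simp
    also have "insert (t i) (?Si - {z}) = insert (t i) (S - {i})" using zn' by auto
    also have "convex hull \<dots> = convex hull (S - {i})" using hull_redundant[OF tS[OF i]] .
    also have "f \<dots> = 0"
    proof -
      have "thin W (convex hull (S - {i}))"
        by (rule small_thin[OF W(1) _ _ _ W(2)]) (use i S fin in auto)
      moreover have "cbody W (convex hull (S - {i}))" using S fin W by (intro cbody_hull) auto
      ultimately show ?thesis using sm unfolding simple_def by blast
    qed
    also have "(\<Sum>j\<in>S - {i}. f (convex hull (insert (t i) (?Si - {j})))) = (\<Sum>j\<in>S - {i}. g i j)"
    proof (rule sum.cong[OF refl])
      fix j assume j: "j \<in> S - {i}"
      then have "?Si - {j} = insert z (S - {i,j})" using zn' by auto
      then show "f (convex hull (insert (t i) (?Si - {j}))) = g i j" using j by (auto simp: g_def)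
    qed
    also have "0 + \<dots> = (\<Sum>j\<in>S. g i j)" using sum.remove[OF fin i, of "g i"] by (simp add: g_def)
    finally show ?thesis .
  qed
  have anti: "g j i = - g i j" if ij: "i \<in> S" "j \<in> S" for i j
  proof (cases "i = j")
    case True then show ?thesis by (simp add: g_def)
  next
    case False
    \<comment> \<open>Normal to the hyperplane that bisects the angle between the two facets; the
      points of the ridge and \<open>z\<close> are equally far from both.\<close>
    define n where "n = u i - u j"
    define A where "A = insert (t i) (insert z (S - {i,j}))"
    define B where "B = insert (t j) (insert z (S - {i,j}))"
    have nW: "n \<in> W" using u(1) ij W subspace_diff unfolding n_def by blast
    have n0: "n \<noteq> 0"
    proof
      assume "n = 0"
      then have e: "u i = u j" by (simp add: n_def)
      have "u i \<bullet> z = b i + r" "u j \<bullet> z = b j + r" using zu ij by auto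
      then have "b i = b j" using e by simp
      then show False using u(5)[OF ij(1)] u(4)[OF ij(2,1)] False u(3)[OF ij(1)] e by simp
    qed
    \<comment> \<open>Reflection in the hyperplane through \<open>z\<close> with normal
      \<open>n\<close>. Its linear part is \<open>mirror n\<close>, and translation invariance
      absorbs the rest.\<close>
    define R where "R x = (z - mirror n z) + mirror n x" for x
    have Rz: "R z = z" by (simp add: R_def)
    have Rk: "R k = k" if k: "k \<in> S - {i,j}" for k
    proof -
      have "u i \<bullet> k = b i" "u j \<bullet> k = b j" using u(4) ij k by auto
      then have "(k - z) \<bullet> n = 0" using zu ij by (simp add: n_def inner_diff_left inner_diff_right inner_commute)
      then have "mirror n (k - z) = k - z" by (rule mirror_fix)
      then show ?thesis by (simp add: R_def mirror_diff algebra_simps)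
    qed
    have Rt: "R (t i) = t j"
    proof -
      have nn: "n \<bullet> n = 2 - 2 * (u i \<bullet> u j)" "u i \<bullet> n = 1 - u i \<bullet> u j"
        using u(2) ij by (auto simp: n_def inner_diff_left inner_diff_right inner_commute norm_eq_1)
      have "n \<bullet> n \<noteq> 0" using n0 by simp
      moreover have "2 * (u i \<bullet> n) = n \<bullet> n" using nn by simp
      ultimately have "2 * (u i \<bullet> n) / (n \<bullet> n) = 1" by (metis divide_self)
      then have "mirror n (u i) = u i - 1 *\<^sub>R n" by (simp only: mirror_def)
      then have "mirror n (u i) = u j" by (simp add: n_def)
      then show ?thesis by (simp add: R_def t_def mirror_diff mirror_scale)
    qed
    have "R ` A = B" unfolding A_def B_def using Rz Rt Rk by (auto simp: image_iff)
    moreover have "R ` A = (+) (z - mirror n z) ` (mirror n ` A)" unfolding image_image R_def ..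
    ultimately have "convex hull B = convex hull ((+) (z - mirror n z) ` (mirror n ` A))" by simp
    also have "\<dots> = (+) (z - mirror n z) ` (convex hull (mirror n ` A))"
      by (rule convex_hull_translation)
    also have "convex hull (mirror n ` A) = mirror n ` (convex hull A)"
      by (rule convex_hull_linear_image[OF linear_mirror, symmetric])
    finally have eq: "convex hull B = (+) (z - mirror n z) ` (mirror n ` (convex hull A))" .
    have tW: "t i \<in> W" using u(1) ij zW W unfolding t_def by (intro subspace_diff subspace_scale) auto
    have "A \<subseteq> W" "finite A" unfolding A_def using tW zW S fin by auto
    then have cA: "cbody W (convex hull A)" using cbody_hull W by blast
    have "z - mirror n z \<in> W" using zW nW W mirror_in subspace_diff by blast
    then have "f (convex hull B) = f (mirror n ` (convex hull A))"
      unfolding eq by (rule f(2)[unfolded tinv_def, rule_format, OF cbody_mirror[OF W(1) nW cA]])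
    also have "\<dots> = - f (convex hull A)" using odd[OF nW n0 cA] .
    finally show ?thesis using False by (simp add: g_def A_def B_def insert_commute)
  qed
  have "f (convex hull S) = (\<Sum>i\<in>S. \<Sum>j\<in>S. g i j)"
    using star_sum[OF W f(1) sm S zS] piece by simp
  also have "\<dots> = (\<Sum>j\<in>S. \<Sum>i\<in>S. g i j)" by (rule sum.swap)
  also have "\<dots> = (\<Sum>j\<in>S. \<Sum>i\<in>S. - g j i)" by (intro sum.cong refl anti)
  also have "\<dots> = - (\<Sum>j\<in>S. \<Sum>i\<in>S. g j i)" by (simp add: sum_negf)
  finally have "f (convex hull S) = - f (convex hull S)"
    using star_sum[OF W f(1) sm S zS] piece by simp
  then show ?thesis by simp
qed

theorem odd_valuation_zero:
  fixes f :: "'a::euclidean_space set \<Rightarrow> real"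
  assumes W: "subspace W" "dim W > 0" and f: "val W f" "tinv W f" "hcont W f"
    and odd: "\<And>v K. v \<in> W \<Longrightarrow> v \<noteq> 0 \<Longrightarrow> cbody W K \<Longrightarrow> f (mirror v ` K) = - f K"
    and K: "cbody W K"
  shows "f K = 0"
  using zero_of_simplices[OF W f(1) odd_valuation_simple[OF W(1) f(1,2) odd] f(3)
      odd_simplex_zero[OF W f(1,2) odd] K] .

section \<open>Reduction to orthoschemes and homogeneity\<close>

lemma dependent_thin:
  fixes S :: "'a::euclidean_space set"
  assumes W: "subspace W" "dim W > 0" and S: "S \<subseteq> W" "finite S" "card S \<le> dim W + 1"
    and d: "affine_dependent S \<or> card S \<le> dim W"
  shows "thin W (convex hull S)"
proof (cases "card S \<le> dim W")
  case True
  then show ?thesis using small_thin[OF W(1) S(1,2) _ W(2)] by blast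
next
  case False
  then have "affine_dependent S" using d by blast
  then have "aff_dim S \<noteq> int (card S) - 1" using affine_independent_iff_card[of S] S(2) by blast
  then have "aff_dim S < int (card S) - 1" using aff_dim_le_card[OF S(2)] by simp
  then have "aff_dim (convex hull S) < int (dim W)" using S(3) by (simp add: aff_dim_convex_hull)
  moreover have "convex hull S \<subseteq> W" using S W by (simp add: hull_minimal subspace_imp_convex)
  ultimately show ?thesis using aff_dim_thin[OF W] by blast
qed

text \<open>Compared with \<open>star_sum\<close>, the terms for \<open>b\<close> outside
  \<open>X\<close> drop out: there \<open>q\<close> lies in the facet opposite \<open>b\<close>, so
  the cone is that facet and thin.\<close>

lemma star_sum_face:
  fixes f :: "'a::euclidean_space set \<Rightarrow> 'b::real_normed_vector"
  assumes W: "subspace W" "dim W > 0" and f: "val W f" "simple W f"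
    and S: "S \<subseteq> W" "\<not> affine_dependent S" "card S = dim W + 1"
    and X: "X \<subseteq> S" "q \<in> convex hull X"
  shows "f (convex hull S) = (\<Sum>b\<in>X. f (convex hull (insert q (S - {b}))))"
proof -
  have fin: "finite S" using S(2) aff_independent_finite by blast
  have "q \<in> convex hull S" using X hull_mono by blast
  then have "f (convex hull S) = (\<Sum>b\<in>S. f (convex hull (insert q (S - {b}))))"
    by (rule star_sum[OF W f S])
  also have "\<dots> = (\<Sum>b\<in>X. f (convex hull (insert q (S - {b}))))"
  proof (rule sum.mono_neutral_right[OF fin X(1)], rule ballI)
    fix b assume b: "b \<in> S - X"
    then have "q \<in> convex hull (S - {b})" using X hull_mono[of X "S - {b}" convex] by blast
    then have "convex hull (insert q (S - {b})) = convex hull (S - {b})" by (rule hull_redundant)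
    moreover have "thin W (convex hull (S - {b}))"
      by (rule small_thin[OF W(1) _ _ _ W(2)]) (use b S fin in auto)
    moreover have "cbody W (convex hull (S - {b}))" using S fin W by (intro cbody_hull) auto
    ultimately show "f (convex hull (insert q (S - {b}))) = 0" using f(2) unfolding simple_def by simp
  qed
  finally show ?thesis .
qed

text \<open>The point \<open>p\<close> may lie outside the simplex, where its cones overlap with signs. The Radon
  partition of \<open>insert p R\<close> has a point in common with both parts, and starring from that
  point relates the simplex to the cones.\<close>

lemma cone_pieces_zero:
  fixes f :: "'a::euclidean_space set \<Rightarrow> 'b::real_normed_vector"
  assumes W: "subspace W" "dim W > 0" and f: "val W f" "simple W f"
    and S: "S \<subseteq> W" "\<not> affine_dependent S" "card S = dim W + 1"
    and R: "R \<subseteq> S" "p \<in> affine hull R"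
    and zero: "\<And>s. s \<in> R \<Longrightarrow> f (convex hull (insert p (S - {s}))) = 0"
  shows "f (convex hull S) = 0"
proof (cases "p \<in> R")
  case True
  then have "insert p (S - {p}) = S" using R by blast
  then show ?thesis using zero[OF True] by simp
next
  case False
  have fin: "finite S" "finite R" using S(2) aff_independent_finite R finite_subset by blast+
  have pS: "p \<notin> S"
  proof
    assume p: "p \<in> S"
    have "R \<subseteq> S - {p}" using R False by blast
    then have "p \<in> affine hull (S - {p})" using R(2) hull_mono by blast
    then show False using S(2) p unfolding affine_dependent_def by blast
  qed
  obtain l where l: "sum l R = 1" "(\<Sum>v\<in>R. l v *\<^sub>R v) = p"
    using R(2) affine_hull_finite[OF fin(2)] by auto
  obtain u b h where u: "\<And>s. s \<in> S \<Longrightarrow> u s \<in> W" "\<And>s. s \<in> S \<Longrightarrow> norm (u s) = 1"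
    "\<And>s. s \<in> S \<Longrightarrow> h s > (0::real)" "\<And>s t. s \<in> S \<Longrightarrow> t \<in> S \<Longrightarrow> t \<noteq> s \<Longrightarrow> u s \<bullet> t = b s"
    "\<And>s. s \<in> S \<Longrightarrow> u s \<bullet> s = b s + h s"
    "convex hull S = {x\<in>W. \<forall>s\<in>S. b s \<le> u s \<bullet> x}"
    "\<And>s. s \<in> S \<Longrightarrow> convex hull (S - {s}) = {x\<in>convex hull S. u s \<bullet> x = b s}"
    by (rule simplex_halfspaces[OF W S]) (rule that)
  have "R \<subseteq> W" using R S by blast
  then have pW: "p \<in> W" using R(2) W(1) hull_minimal[of R W affine] subspace_imp_affine by blast
  \<comment> \<open>Exchanging \<open>s\<close> for \<open>p\<close> gives a simplex again whenever
    \<open>p\<close> has a nonzero barycentric coordinate \<open>l s\<close>, because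
    \<open>u s \<bullet> p - b s = l s * h s\<close>.\<close>
  have indep: "insert p (S - {s}) \<subseteq> W \<and> \<not> affine_dependent (insert p (S - {s}))
      \<and> card (insert p (S - {s})) = dim W + 1" if s: "s \<in> R" "l s \<noteq> 0" for s
  proof -
    have sS: "s \<in> S" using s R by blast
    have "u s \<bullet> p = (\<Sum>t\<in>R. l t * (u s \<bullet> t))" unfolding l(2)[symmetric] by (simp add: inner_sum_right)
    also have "\<dots> = (\<Sum>t\<in>R. l t * b s + (if t = s then l s * h s else 0))"
      using u(4)[OF sS] u(5)[OF sS] R(1) by (intro sum.cong) (auto simp: algebra_simps)
    also have "\<dots> = b s + l s * h s" using fin(2) s l(1) by (simp add: sum.distrib sum_distrib_right[symmetric])
    finally have up: "u s \<bullet> p \<noteq> b s" using s u(3)[OF sS] by simp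
    have "affine hull (S - {s}) \<subseteq> {x. u s \<bullet> x = b s}"
      using u(4)[OF sS] by (intro hull_minimal affine_hyperplane) auto
    then have "p \<notin> affine hull (S - {s})" using up by blast
    then have "\<not> affine_dependent (insert p (S - {s}))"
      by (rule affine_independent_insert[OF affine_independent_Diff[OF S(2)]])
    then show ?thesis using pS pW S fin sS by auto
  qed
  define A where "A = {s\<in>R. l s > 0}"
  define B where "B = {s\<in>R. l s < 0}"
  \<comment> \<open>In the barycentric expansion of \<open>p\<close>, the negative terms are moved
    to the side of \<open>p\<close>, and \<open>c\<close> is then the total weight of either side.
    Division by \<open>c\<close> represents one point \<open>q\<close> as a convex combination over
    \<open>A\<close> and also over \<open>insert p B\<close>.\<close>
  define c where "c = sum l A"
  define q where "q = (\<Sum>s\<in>A. (l s / c) *\<^sub>R s)"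
  have AB: "A \<subseteq> R" "B \<subseteq> R" "A \<inter> B = {}" "finite A" "finite B" using fin by (auto simp: A_def B_def)
  have split: "sum g R = sum g A + sum g B" if "\<And>s. s \<in> R \<Longrightarrow> l s = 0 \<Longrightarrow> g s = 0" for g :: "'a \<Rightarrow> 'c::comm_monoid_add"
  proof -
    have "sum g R = sum g (A \<union> B)"
      by (rule sum.mono_neutral_right) (use fin that in \<open>auto simp: A_def B_def\<close>, meson not_less_iff_gr_or_eq)
    then show ?thesis using AB by (simp add: sum.union_disjoint)
  qed
  have c: "c = 1 + (\<Sum>s\<in>B. - l s)" using split[of l] l(1) by (simp add: c_def sum_negf)
  have c0: "c > 0"
    unfolding c by (intro add_pos_nonneg sum_nonneg) (auto simp: B_def)
  have qA: "q \<in> convex hull A"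
    unfolding convex_hull_finite[OF AB(4)] q_def
    by (intro CollectI exI[of _ "\<lambda>s. l s / c"] conjI)
      (use c0 in \<open>auto simp: A_def c_def sum_divide_distrib[symmetric]\<close>)
  have qB: "q \<in> convex hull (insert p B)"
  proof -
    have "c *\<^sub>R q = (\<Sum>s\<in>A. l s *\<^sub>R s)" using c0 by (simp add: q_def scaleR_sum_right)
    also have "\<dots> = p + (\<Sum>s\<in>B. (- l s) *\<^sub>R s)"
      using split[of "\<lambda>s. l s *\<^sub>R s"] l(2) by (simp add: sum_negf)
    finally have "(1 / c) *\<^sub>R (c *\<^sub>R q) = (1 / c) *\<^sub>R p + (\<Sum>s\<in>B. (- l s / c) *\<^sub>R s)"
      by (simp add: scaleR_right_diff_distrib scaleR_sum_right sum_negf)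
    then have q: "q = (1 / c) *\<^sub>R p + (\<Sum>s\<in>B. (- l s / c) *\<^sub>R s)" using c0 by simp
    have pB: "p \<notin> B" using pS AB R by blast
    have 1: "(1 / c) + (\<Sum>s\<in>B. - l s / c) = 1"
      using c c0 by (simp add: sum_divide_distrib[symmetric] diff_divide_distrib[symmetric] sum_negf)
    show ?thesis
      unfolding convex_hull_finite[OF finite.insertI[OF AB(5)]]
    proof (intro CollectI exI[of _ "\<lambda>s. if s = p then 1 / c else - l s / c"] conjI ballI)
      have e: "(\<Sum>s\<in>B. (if s = p then 1 / c else - l s / c)) = (\<Sum>s\<in>B. - l s / c)"
        "(\<Sum>s\<in>B. (if s = p then 1 / c else - l s / c) *\<^sub>R s) = (\<Sum>s\<in>B. (- l s / c) *\<^sub>R s)"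
        using pB by (auto intro!: sum.cong)
      show "0 \<le> (if s = p then 1 / c else - l s / c)" if "s \<in> insert p B" for s
        using that c0 by (auto simp: B_def divide_nonpos_nonneg)
      show "(\<Sum>s\<in>insert p B. if s = p then 1 / c else - l s / c) = 1" using pB AB(5) 1 e by simp
      show "(\<Sum>s\<in>insert p B. (if s = p then 1 / c else - l s / c) *\<^sub>R s) = q"
        using pB AB(5) q e by simp
    qed
  qed
  \<comment> \<open>The value on the simplex in which \<open>s\<close> and \<open>b\<close> are
    exchanged for \<open>q\<close> and \<open>p\<close>. Such simplices arise when the cone without
    \<open>s\<close> is starred from \<open>q\<close> as a point over \<open>insert p B\<close>, and
    when the cone without \<open>b\<close> is starred from \<open>q\<close> as a point over
    \<open>A\<close>; summing both ways eliminates them.\<close>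
  define G where "G s b = f (convex hull (insert q (insert p (S - {s,b}))))" for s b
  have 1: "f (convex hull S) = (\<Sum>s\<in>A. f (convex hull (insert q (S - {s}))))"
    by (rule star_sum_face[OF W f S _ qA]) (use AB R in auto)
  have 2: "f (convex hull (insert q (S - {s}))) + (\<Sum>b\<in>B. G s b) = 0" if s: "s \<in> A" for s
  proof -
    have sR: "s \<in> R" "l s \<noteq> 0" using s by (auto simp: A_def)
    have sub: "insert p B \<subseteq> insert p (S - {s})" using AB R s by blast
    have pB: "p \<notin> B" using pS AB R by blast
    have "0 = f (convex hull (insert p (S - {s})))" using zero[OF sR(1)] by simp
    also have "\<dots> = (\<Sum>b\<in>insert p B. f (convex hull (insert q (insert p (S - {s}) - {b}))))"
      using star_sum_face[OF W f _ _ _ sub qB] indep[OF sR] by blast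
    also have "\<dots> = f (convex hull (insert q (S - {s}))) + (\<Sum>b\<in>B. f (convex hull (insert q (insert p (S - {s}) - {b}))))"
      using pB AB(5) pS by simp
    also have "(\<Sum>b\<in>B. f (convex hull (insert q (insert p (S - {s}) - {b})))) = (\<Sum>b\<in>B. G s b)"
    proof (rule sum.cong[OF HOL.refl])
      fix b assume "b \<in> B"
      then have "insert p (S - {s}) - {b} = insert p (S - {s,b})" using pB by auto
      then show "f (convex hull (insert q (insert p (S - {s}) - {b}))) = G s b" by (simp add: G_def)
    qed
    finally show ?thesis by simp
  qed
  have 3: "(\<Sum>s\<in>A. G s b) = 0" if b: "b \<in> B" for b
  proof -
    have bR: "b \<in> R" "l b \<noteq> 0" using b by (auto simp: B_def)
    have sub: "A \<subseteq> insert p (S - {b})" using AB R b by blast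
    have "0 = f (convex hull (insert p (S - {b})))" using zero[OF bR(1)] by simp
    also have "\<dots> = (\<Sum>s\<in>A. f (convex hull (insert q (insert p (S - {b}) - {s}))))"
      using star_sum_face[OF W f _ _ _ sub qA] indep[OF bR] by blast
    also have "\<dots> = (\<Sum>s\<in>A. G s b)"
    proof (rule sum.cong[OF HOL.refl])
      fix s assume "s \<in> A"
      then have "insert p (S - {b}) - {s} = insert p (S - {s,b})" using pS AB R by auto
      then show "f (convex hull (insert q (insert p (S - {b}) - {s}))) = G s b" by (simp add: G_def)
    qed
    finally show ?thesis by simp
  qed
  have "f (convex hull S) = (\<Sum>s\<in>A. - (\<Sum>b\<in>B. G s b))"
    unfolding 1 using 2 by (intro sum.cong) (auto simp: eq_neg_iff_add_eq_0)
  also have "\<dots> = - (\<Sum>s\<in>A. \<Sum>b\<in>B. G s b)" by (simp add: sum_negf)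
  also have "(\<Sum>s\<in>A. \<Sum>b\<in>B. G s b) = (\<Sum>b\<in>B. \<Sum>s\<in>A. G s b)" by (rule sum.swap)
  also have "\<dots> = 0" using 3 by simp
  finally show ?thesis by simp
qed

lemma foot_of_perpendicular:
  fixes x :: "'a::euclidean_space"
  assumes "R \<noteq> {}"
  obtains p where "p \<in> affine hull R" "\<And>r. r \<in> affine hull R \<Longrightarrow> (p - x) \<bullet> (r - p) = 0"
proof -
  obtain r0 where r0: "r0 \<in> R" using assms by blast
  let ?D = "(+) (- r0) ` R"
  have ah: "affine hull R = (+) r0 ` span ?D" using affine_hull_span_gen[of r0 R] r0 hull_inc by metis
  obtain y z where yz: "y \<in> span ?D" "\<And>w. w \<in> span ?D \<Longrightarrow> orthogonal z w" "x - r0 = y + z"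
    by (rule orthogonal_subspace_decomp_exists[of ?D "x - r0"]) (rule that)
  show ?thesis
  proof (rule that[of "r0 + y"])
    show "r0 + y \<in> affine hull R" using ah yz(1) by blast
    fix r assume "r \<in> affine hull R"
    then obtain w where w: "w \<in> span ?D" "r = r0 + w" using ah by blast
    have "orthogonal z (w - y)" by (rule yz(2)[OF span_diff[OF w(1) yz(1)]])
    moreover have "r0 + y - x = - z" using yz(3) by (simp add: algebra_simps)
    ultimately show "(r0 + y - x) \<bullet> (r - (r0 + y)) = 0" using w(2) by (simp add: orthogonal_def)
  qed
qed

text \<open>Grow an orthogonal path \<open>q 0, ..., q m\<close> by replacing the remaining vertices \<open>R\<close>
  with the foot of the perpendicular from \<open>q m\<close> to their affine hull.\<close>

lemma orthoscheme_reduction_aux: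
  fixes f :: "'a::euclidean_space set \<Rightarrow> 'b::real_normed_vector"
  assumes W: "subspace W" "dim W > 0" and f: "val W f" "simple W f"
    and ortho: "\<And>q. q ` {..dim W} \<subseteq> W \<Longrightarrow> inj_on q {..dim W} \<Longrightarrow>
      (\<And>i j. i < j \<Longrightarrow> j < dim W \<Longrightarrow> (q (Suc i) - q i) \<bullet> (q (Suc j) - q j) = 0) \<Longrightarrow>
      f (convex hull (q ` {..dim W})) = 0"
    and q: "q ` {..m} \<union> R \<subseteq> W" "\<not> affine_dependent (q ` {..m} \<union> R)" "card (q ` {..m} \<union> R) = dim W + 1"
      "inj_on q {..m}" "q ` {..m} \<inter> R = {}"
      "\<And>i j. i < j \<Longrightarrow> j < m \<Longrightarrow> (q (Suc i) - q i) \<bullet> (q (Suc j) - q j) = 0"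
      "\<And>i r. i < m \<Longrightarrow> r \<in> R \<Longrightarrow> (q (Suc i) - q i) \<bullet> (r - q m) = 0"
  shows "f (convex hull (q ` {..m} \<union> R)) = 0"
  using q
proof (induction "card R" arbitrary: q m R rule: less_induct)
  case less
  note q = less.prems
  let ?S = "q ` {..m} \<union> R"
  have finS: "finite ?S" using q(2) aff_independent_finite by blast
  then have finR: "finite R" by simp
  show ?case
  proof (cases "R = {}")
    case True
    have "m = dim W" using q(3,4) True by (simp add: card_image)
    then show ?thesis using ortho[of q] q True by simp
  next
    case False
    obtain p where p: "p \<in> affine hull R" "\<And>r. r \<in> affine hull R \<Longrightarrow> (p - q m) \<bullet> (r - p) = 0"
      using foot_of_perpendicular[OF False] by blast
    have pperp: "(q (Suc i) - q i) \<bullet> (y - q m) = 0" if i: "i < m" and y: "y \<in> affine hull R" for i y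
    proof -
      have "R \<subseteq> {y. (q (Suc i) - q i) \<bullet> y = (q (Suc i) - q i) \<bullet> q m}"
        using q(7)[OF i] by (auto simp: inner_diff_right)
      then have "affine hull R \<subseteq> {y. (q (Suc i) - q i) \<bullet> y = (q (Suc i) - q i) \<bullet> q m}"
        by (intro hull_minimal affine_hyperplane)
      then show ?thesis using y by (auto simp: inner_diff_right)
    qed
    have "R \<subseteq> W" using q(1) by blast
    then have pW: "p \<in> W" using p(1) W(1) hull_minimal[of R W affine] subspace_imp_affine by blast
    show ?thesis
    proof (rule cone_pieces_zero[OF W f q(1-3) _ p(1)])
      show "R \<subseteq> ?S" by blast
      fix s assume s: "s \<in> R"
      let ?S' = "insert p (?S - {s})"
      have sW: "?S' \<subseteq> W" "finite ?S'" using pW q(1) finS by auto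
      have cS: "card (?S - {s}) = dim W" using q(3) finS s by simp
      then have cS': "card ?S' \<le> dim W + 1" using card_insert_le_m1[of "dim W + 1" "?S - {s}" p] by simp
      show "f (convex hull ?S') = 0"
      proof (cases "affine_dependent ?S' \<or> card ?S' \<le> dim W")
        case True
        have "thin W (convex hull ?S')" using dependent_thin[OF W sW cS' True] .
        moreover have "cbody W (convex hull ?S')" using cbody_hull sW W by blast
        ultimately show ?thesis using f(2) unfolding simple_def by blast
      next
        case nd: False
        then have pn: "p \<notin> ?S - {s}" using cS by (metis insert_absorb le_refl)
        \<comment> \<open>The foot becomes the next vertex of the path: \<open>p - q m\<close> is
          orthogonal to \<open>r - p\<close> for every remaining \<open>r\<close>, and the earlier
          steps are orthogonal to \<open>y - q m\<close> for all \<open>y\<close> in the affine hull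
          of \<open>R\<close>, in particular for \<open>y = p\<close>.\<close>
        define q' where "q' = q(Suc m := p)"
        have im: "q' ` {..m} = q ` {..m}" unfolding q'_def by (intro image_cong) auto
        have im': "q' ` {..Suc m} = insert p (q ` {..m})"
          unfolding atMost_Suc image_insert im by (simp add: q'_def)
        have eq: "q' ` {..Suc m} \<union> (R - {s}) = ?S'" using im' q(5) s by auto
        have qq: "q' i = q i" if "i \<le> m" for i using that by (simp add: q'_def)
        have qS: "q' (Suc m) = p" by (simp add: q'_def)
        have "f (convex hull (q' ` {..Suc m} \<union> (R - {s}))) = 0"
        proof (rule less.hyps)
          show "card (R - {s}) < card R" using s finR by (meson card_Diff1_less)
          show "q' ` {..Suc m} \<union> (R - {s}) \<subseteq> W" unfolding eq using sW by blast
          show "\<not> affine_dependent (q' ` {..Suc m} \<union> (R - {s}))" unfolding eq using nd by blast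
          show "card (q' ` {..Suc m} \<union> (R - {s})) = dim W + 1" unfolding eq using nd cS' by linarith
          have pim: "p \<notin> q ` {..m}" using pn q(5) s by blast
          have "inj_on q' {..m}" using q(4) qq by (metis atMost_iff inj_on_cong)
          then show "inj_on q' {..Suc m}"
            unfolding atMost_Suc inj_on_insert using pim im qS by (auto simp: image_iff)
          show "q' ` {..Suc m} \<inter> (R - {s}) = {}" unfolding im' using q(5) pn by auto
          show "(q' (Suc i) - q' i) \<bullet> (q' (Suc j) - q' j) = 0" if ij: "i < j" "j < Suc m" for i j
          proof (cases "j = m")
            case True
            then show ?thesis using pperp[of i p] p(1) ij qq[of i] qq[of "Suc i"] qq[of m] qS by simp
          next
            case False
            then have "j < m" using ij by simp
            then show ?thesis using q(6)[OF ij(1)] ij qq[of i] qq[of "Suc i"] qq[of j] qq[of "Suc j"] by simp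
          qed
          show "(q' (Suc i) - q' i) \<bullet> (r - q' (Suc m)) = 0" if ir: "i < Suc m" "r \<in> R - {s}" for i r
          proof (cases "i = m")
            case True
            then show ?thesis using p(2)[of r] ir qq[of m] qS by (simp add: hull_inc)
          next
            case False
            then have i: "i < m" using ir by simp
            have "(q (Suc i) - q i) \<bullet> (r - p) = 0"
              using pperp[OF i, of r] pperp[OF i p(1)] ir by (simp add: hull_inc inner_diff_right)
            then show ?thesis using i qq[of i] qq[of "Suc i"] qS by simp
          qed
        qed
        then show ?thesis unfolding eq .
      qed
    qed
  qed
qed

lemma orthoscheme_reduction:
  fixes f :: "'a::euclidean_space set \<Rightarrow> 'b::real_normed_vector"
  assumes W: "subspace W" "dim W > 0" and f: "val W f" "simple W f"
    and ortho: "\<And>q. q ` {..dim W} \<subseteq> W \<Longrightarrow> inj_on q {..dim W} \<Longrightarrow>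
      (\<And>i j. i < j \<Longrightarrow> j < dim W \<Longrightarrow> (q (Suc i) - q i) \<bullet> (q (Suc j) - q j) = 0) \<Longrightarrow>
      f (convex hull (q ` {..dim W})) = 0"
    and S: "S \<subseteq> W" "\<not> affine_dependent S" "card S = dim W + 1"
  shows "f (convex hull S) = 0"
proof -
  obtain s where s: "s \<in> S" using S(3) by fastforce
  \<comment> \<open>A path consisting of the single vertex \<open>s\<close> meets the orthogonality
    conditions vacuously.\<close>
  have eq: "(\<lambda>_::nat. s) ` {..0} \<union> (S - {s}) = S" using s by auto
  have "f (convex hull ((\<lambda>_::nat. s) ` {..0} \<union> (S - {s}))) = 0"
    by (rule orthoscheme_reduction_aux[OF W f ortho]) (use S eq in auto)
  then show ?thesis unfolding eq .
qed

section \<open>Orthoschemes in coordinates\<close>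

definition coord :: "(nat \<Rightarrow> 'a::euclidean_space) \<Rightarrow> nat \<Rightarrow> 'a \<Rightarrow> real" where
  "coord v i x = (x \<bullet> v i) / (v i \<bullet> v i)"

text \<open>For an \<open>orthobasis\<close> and \<open>s \<ge> 0\<close> this is the orthoscheme
  with vertices \<open>0\<close>, \<open>s v 0\<close>, \<open>s (v 0 + v 1)\<close> and so on. The
  description by inequalities makes cuts at a fixed level of all coordinates explicit.\<close>

definition staircase :: "'a::euclidean_space set \<Rightarrow> (nat \<Rightarrow> 'a) \<Rightarrow> real \<Rightarrow> 'a set" where
  "staircase W v s = {x\<in>W. (\<forall>i<dim W. 0 \<le> coord v i x \<and> coord v i x \<le> s) \<and>
     (\<forall>i j. i \<le> j \<longrightarrow> j < dim W \<longrightarrow> coord v j x \<le> coord v i x)}"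

definition orthobasis :: "'a::euclidean_space set \<Rightarrow> (nat \<Rightarrow> 'a) \<Rightarrow> bool" where
  "orthobasis W v \<longleftrightarrow> (\<forall>i<dim W. v i \<in> W \<and> v i \<noteq> 0) \<and>
     (\<forall>i<dim W. \<forall>j<dim W. i \<noteq> j \<longrightarrow> v i \<bullet> v j = 0)"

text \<open>Both factors have positive dimension, hence smaller dimension than \<open>W\<close>;
  this is the form in which the induction on the dimension supplies information.\<close>

definition prod_zero :: "'a::euclidean_space set \<Rightarrow> ('a set \<Rightarrow> 'b::zero) \<Rightarrow> bool" where
  "prod_zero W f \<longleftrightarrow> (\<forall>U V A B. subspace U \<longrightarrow> subspace V \<longrightarrow> U \<subseteq> W \<longrightarrow> V \<subseteq> W \<longrightarrow>
     dim U > 0 \<longrightarrow> dim V > 0 \<longrightarrow> dim U + dim V = dim W \<longrightarrow> (\<forall>x\<in>U. \<forall>y\<in>V. x \<bullet> y = 0) \<longrightarrow>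
     cbody U A \<longrightarrow> cbody V B \<longrightarrow> f {a + b | a b. a \<in> A \<and> b \<in> B} = 0)"

lemma coord_linear [simp]:
  "coord v i (x + y) = coord v i x + coord v i y"
  "coord v i (c *\<^sub>R x) = c * coord v i x"
  "coord v i (x - y) = coord v i x - coord v i y"
  by (simp_all add: coord_def inner_add_left inner_diff_left add_divide_distrib diff_divide_distrib)

lemma coord_inner: "coord v i x = (inverse (v i \<bullet> v i) *\<^sub>R v i) \<bullet> x"
  by (simp add: coord_def inner_commute divide_inverse mult.commute)

lemma coord_basis:
  assumes "orthobasis W v" "i < dim W" "j < dim W"
  shows "coord v i (v j) = (if i = j then 1 else 0)"
  using assms unfolding orthobasis_def coord_def by (auto simp: inner_commute)

lemma coord_sum: "coord v i (sum g A) = (\<Sum>a\<in>A. coord v i (g a))"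
  by (simp add: coord_def inner_sum_left sum_divide_distrib)

lemma orthobasis_dim:
  assumes v: "orthobasis W v" and J: "J \<subseteq> {..<dim W}"
  shows "dim (span (v ` J)) = card J" "independent (v ` J)"
proof -
  have inj: "inj_on v J"
  proof
    fix i j assume ij: "i \<in> J" "j \<in> J" "v i = v j"
    then have l: "i < dim W" "j < dim W" using J by auto
    show "i = j"
    proof (rule ccontr)
      assume "i \<noteq> j"
      then have "v i \<bullet> v j = 0" using v l unfolding orthobasis_def by blast
      then show False using ij v l unfolding orthobasis_def by auto
    qed
  qed
  show ind: "independent (v ` J)"
  proof (rule pairwise_orthogonal_independent)
    show "pairwise orthogonal (v ` J)"
      unfolding pairwise_def orthogonal_def using v J unfolding orthobasis_def by blast
    show "0 \<notin> v ` J" using v J unfolding orthobasis_def by auto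
  qed
  show "dim (span (v ` J)) = card J"
    using dim_eq_card_independent[OF ind] card_image[OF inj] by (simp add: dim_span)
qed

lemma orthobasis_expand:
  fixes v :: "nat \<Rightarrow> 'a::euclidean_space"
  assumes W: "subspace W" and v: "orthobasis W v" and x: "x \<in> W"
  shows "(\<Sum>i<dim W. coord v i x *\<^sub>R v i) = x"
proof -
  let ?B = "v ` {..<dim W}"
  have sub: "?B \<subseteq> W" using v unfolding orthobasis_def by auto
  have "dim (span ?B) = dim W" using orthobasis_dim(1)[OF v order_refl] by simp
  moreover have "span ?B \<subseteq> W" using sub W span_minimal by blast
  ultimately have sp: "span ?B = W" using subspace_dim_equal[OF subspace_span W] by simp
  define y where "y = x - (\<Sum>i<dim W. coord v i x *\<^sub>R v i)"
  have yW: "y \<in> W" unfolding y_def using W x sub by (intro subspace_diff subspace_sum subspace_scale) auto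
  have "y \<bullet> v j = 0" if j: "j < dim W" for j
  proof -
    have "(\<Sum>i<dim W. coord v i x *\<^sub>R v i) \<bullet> v j = (\<Sum>i<dim W. coord v i x * (v i \<bullet> v j))"
      by (simp add: inner_sum_left)
    also have "\<dots> = (\<Sum>i<dim W. if i = j then x \<bullet> v j else 0)"
      using v j unfolding orthobasis_def by (intro sum.cong) (auto simp: coord_def)
    also have "\<dots> = x \<bullet> v j" using j by simp
    finally show ?thesis by (simp add: y_def inner_diff_left)
  qed
  then have "\<forall>b\<in>?B. orthogonal y b" by (auto simp: orthogonal_def)
  moreover have "y \<in> span ?B" using sp yW by simp
  ultimately have "orthogonal y y" by (meson orthogonal_to_span)
  then show ?thesis by (simp add: orthogonal_def y_def)
qed

lemma staircase_cbody:
  fixes v :: "nat \<Rightarrow> 'a::euclidean_space"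
  assumes W: "subspace W" and v: "orthobasis W v"
  shows "cbody W (staircase W v s)"
proof -
  have hs: "{x. coord v i x \<le> c} = {x. (inverse (v i \<bullet> v i) *\<^sub>R v i) \<bullet> x \<le> c}"
    "{x. c \<le> coord v i x} = {x. (inverse (v i \<bullet> v i) *\<^sub>R v i) \<bullet> x \<ge> c}"
    "{x. coord v j x \<le> coord v i x} = {x. (inverse (v j \<bullet> v j) *\<^sub>R v j - inverse (v i \<bullet> v i) *\<^sub>R v i) \<bullet> x \<le> 0}" for i j c
    by (auto simp: coord_inner inner_diff_left)
  have eq: "staircase W v s = W \<inter> (\<Inter>i\<in>{..<dim W}. {x. 0 \<le> coord v i x} \<inter> {x. coord v i x \<le> s})
      \<inter> (\<Inter>j\<in>{..<dim W}. \<Inter>i\<in>{..j}. {x. coord v j x \<le> coord v i x})"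
    unfolding staircase_def by auto
  have conv: "convex (staircase W v s)"
    unfolding eq hs
    by (intro convex_Int convex_INT subspace_imp_convex W convex_halfspace_le convex_halfspace_ge)
  have clo: "closed (staircase W v s)"
    unfolding eq hs
    by (intro closed_Int closed_INT ballI closed_subspace W closed_halfspace_le closed_halfspace_ge)
  have "norm x \<le> (\<Sum>i<dim W. \<bar>s\<bar> * norm (v i))" if x: "x \<in> staircase W v s" for x
  proof -
    have "norm x = norm (\<Sum>i<dim W. coord v i x *\<^sub>R v i)"
      using orthobasis_expand[OF W v] x unfolding staircase_def by auto
    also have "\<dots> \<le> (\<Sum>i<dim W. norm (coord v i x *\<^sub>R v i))" by (rule norm_sum)
    also have "\<dots> \<le> (\<Sum>i<dim W. \<bar>s\<bar> * norm (v i))"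
      using x unfolding staircase_def by (intro sum_mono) (auto intro!: mult_right_mono)
    finally show ?thesis .
  qed
  then have "bounded (staircase W v s)" unfolding bounded_iff by blast
  then show ?thesis unfolding cbody_def using clo conv compact_eq_bounded_closed
    by (auto simp: staircase_def)
qed

lemma linear_coord_part: "linear (\<lambda>x. \<Sum>i\<in>J. coord v i x *\<^sub>R v i)"
  by (rule linearI) (simp_all add: scaleR_left_distrib sum.distrib scaleR_sum_right)

text \<open>Cut at \<open>coord v i x = s\<close> for all \<open>i\<close>: the pieces are products of two smaller staircases, so
  only the two extreme ones contribute.\<close>

lemma staircase_add:
  fixes f :: "'a::euclidean_space set \<Rightarrow> 'b::real_normed_vector"
  assumes W: "subspace W" "dim W > 0" and f: "val W f" "simple W f" "tinv W f" "prod_zero W f"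
    and v: "orthobasis W v" and st: "s \<ge> 0" "t \<ge> 0"
  shows "f (staircase W v (s + t)) = f (staircase W v s) + f (staircase W v t)"
proof -
  let ?k = "dim W" and ?P = "staircase W v (s + t)"
  let ?c = "coord v"
  \<comment> \<open>Coordinates decrease with the index, so those above the level \<open>s\<close>
    form an initial segment; \<open>j\<close> is its length.\<close>
  define C where "C j = {x\<in>?P. (\<forall>i<j. s \<le> ?c i x) \<and> (\<forall>i. j \<le> i \<longrightarrow> i < ?k \<longrightarrow> ?c i x \<le> s)}" for j
  obtain c where c: "c \<in> W" "c \<noteq> 0" using W(2) by (metis dim_eq_0 less_irrefl subsetI singleton_iff)
  have v0: "v i \<in> W" "v i \<noteq> 0" if "i < ?k" for i using v that unfolding orthobasis_def by auto
  have hs: "{x. ?c i x \<le> d} = {x. (inverse (v i \<bullet> v i) *\<^sub>R v i) \<bullet> x \<le> d}"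
    "{x. d \<le> ?c i x} = {x. (inverse (v i \<bullet> v i) *\<^sub>R v i) \<bullet> x \<ge> d}" for i d
    by (auto simp: coord_inner)
  have Cb: "cbody W (C j)" if "j \<le> ?k" for j
  proof -
    have eq: "C j = ?P \<inter> ((\<Inter>i\<in>{..<j}. {x. s \<le> ?c i x}) \<inter> (\<Inter>i\<in>{j..<?k}. {x. ?c i x \<le> s}))"
      unfolding C_def by auto
    show ?thesis
      unfolding eq
    proof (rule cbody_Int_closed[OF staircase_cbody[OF W(1) v]])
      show "closed ((\<Inter>i\<in>{..<j}. {x. s \<le> ?c i x}) \<inter> (\<Inter>i\<in>{j..<?k}. {x. ?c i x \<le> s}))"
        unfolding hs by (intro closed_Int closed_INT ballI closed_halfspace_le closed_halfspace_ge)
      show "convex ((\<Inter>i\<in>{..<j}. {x. s \<le> ?c i x}) \<inter> (\<Inter>i\<in>{j..<?k}. {x. ?c i x \<le> s}))"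
        unfolding hs by (intro convex_Int convex_INT convex_halfspace_le convex_halfspace_ge)
    qed
  qed
  have thinC: "thin W (C i \<inter> C j)" if "i < j" "j \<le> ?k" for i j
  proof -
    have i: "i < ?k" using that by simp
    have "v i \<bullet> x = s * (v i \<bullet> v i)" if x: "x \<in> C i \<inter> C j" for x
    proof -
      have "?c i x = s" using x \<open>i < j\<close> i unfolding C_def by (auto intro: antisym)
      then show ?thesis using v0(2)[OF i] by (simp add: coord_def field_simps inner_commute)
    qed
    then show ?thesis unfolding thin_def using v0[OF i] by blast
  qed
  have cover: "?P = (\<Union>j\<in>{..?k}. C j)"
  proof
    show "?P \<subseteq> (\<Union>j\<in>{..?k}. C j)"
    proof
      fix x assume x: "x \<in> ?P"
      define j where "j = (LEAST j. j = ?k \<or> ?c j x < s)"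
      have j1: "j = ?k \<or> ?c j x < s" unfolding j_def by (rule LeastI[of _ ?k]) simp
      have j2: "\<not> (i = ?k \<or> ?c i x < s)" if "i < j" for i using not_less_Least that unfolding j_def by blast
      have jk: "j \<le> ?k" unfolding j_def by (rule Least_le) simp
      have "?c i x \<le> s" if "j \<le> i" "i < ?k" for i
      proof -
        have "?c i x \<le> ?c j x" using x that unfolding staircase_def by blast
        then show ?thesis using j1 that by auto
      qed
      then have "x \<in> C j" unfolding C_def using x j2 by force
      then show "x \<in> (\<Union>j\<in>{..?k}. C j)" using jk by blast
    qed
  qed (auto simp: C_def)
  have "f ?P = (\<Sum>j\<in>{..?k}. f (C j))"
  proof (rule dissection_sum[where W = W and I = "{..?k}" and f = f and P = ?P and c = c and K = C])
    show "thin W (C i \<inter> C j)" if ij: "i \<in> {..?k}" "j \<in> {..?k}" "i \<noteq> j" for i j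
      using thinC[of i j] thinC[of j i] ij by (cases "i < j") (auto simp: Int_commute)
    show "cbody W ?P" by (rule staircase_cbody[OF W(1) v])
    show "?P = (\<Union>j\<in>{..?k}. C j)" by (rule cover)
  qed (use W c f Cb in auto)
  also have "\<dots> = f (C 0) + f (C ?k)"
  proof -
    have mid: "f (C j) = 0" if j: "0 < j" "j < ?k" for j
    proof -
      let ?p = "\<lambda>J x. \<Sum>i\<in>J. ?c i x *\<^sub>R v i"
      let ?U = "span (v ` {..<j})" and ?V = "span (v ` {j..<?k})"
      let ?A = "?p {..<j} ` C j" and ?B = "?p {j..<?k} ` C j"
      have pc: "?c i (?p J x) = (if i \<in> J then ?c i x else 0)" if "J \<subseteq> {..<?k}" "i < ?k" for i J x
      proof -
        have "?c i (?p J x) = (\<Sum>l\<in>J. ?c l x * ?c i (v l))" by (simp add: coord_sum)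
        also have "\<dots> = (\<Sum>l\<in>J. if l = i then ?c i x else 0)"
          using coord_basis[OF v that(2)] that(1) by (intro sum.cong) (auto simp: subset_iff)
        finally show ?thesis using that(1) by (simp add: finite_subset[OF that(1)])
      qed
      have J: "{..<j} \<subseteq> {..<?k}" "{j..<?k} \<subseteq> {..<?k}" using j by auto
      have un: "{..<j} \<union> {j..<?k} = {..<?k}" "{..<j} \<inter> {j..<?k} = {}" using j by auto
      have psum: "?p {..<j} x + ?p {j..<?k} x = x" if "x \<in> W" for x
        using orthobasis_expand[OF W(1) v that] sum.union_disjoint[of "{..<j}" "{j..<?k}" "\<lambda>i. ?c i x *\<^sub>R v i"] un
        by simp
      \<comment> \<open>The level \<open>s\<close> separates the first \<open>j\<close> coordinates
        from the others, so the inequalities that link the two groups hold automatically and the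
        constraints split into those of the two factors.\<close>
      have "C j = {a + b | a b. a \<in> ?A \<and> b \<in> ?B}"
      proof
        show "C j \<subseteq> {a + b | a b. a \<in> ?A \<and> b \<in> ?B}"
        proof
          fix x assume x: "x \<in> C j"
          then have "x \<in> W" unfolding C_def staircase_def by blast
          then have "x = ?p {..<j} x + ?p {j..<?k} x" using psum by simp
          then show "x \<in> {a + b | a b. a \<in> ?A \<and> b \<in> ?B}" using x by blast
        qed
        show "{a + b | a b. a \<in> ?A \<and> b \<in> ?B} \<subseteq> C j"
        proof
          fix z assume "z \<in> {a + b | a b. a \<in> ?A \<and> b \<in> ?B}"
          then obtain x y where xy: "x \<in> C j" "y \<in> C j" "z = ?p {..<j} x + ?p {j..<?k} y" by auto
          have cz: "?c i z = (if i < j then ?c i x else ?c i y)" if "i < ?k" for i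
            using pc[OF J(1) that, of x] pc[OF J(2) that, of y] that xy(3) by simp
          have "z \<in> W" unfolding xy(3) using v0(1) j W(1)
            by (intro subspace_add subspace_sum subspace_scale) auto
          moreover have "?c l z \<le> ?c i z" if il: "i \<le> l" "l < ?k" for i l
          proof (cases "i < j \<and> \<not> l < j")
            case True
            then have "?c l y \<le> s" "s \<le> ?c i x" using xy il unfolding C_def by auto
            then show ?thesis using cz True il by simp
          next
            case False
            then show ?thesis using cz il xy unfolding C_def staircase_def by auto
          qed
          ultimately show "z \<in> C j" using xy cz j unfolding C_def staircase_def by auto
        qed
      qed
      moreover have "f {a + b | a b. a \<in> ?A \<and> b \<in> ?B} = 0"
      proof -
        have UV: "subspace ?U" "subspace ?V" by simp_all
        have sub: "?U \<subseteq> W" by (rule span_minimal[OF _ W(1)]) (use v0(1) j in auto)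
        have sub': "?V \<subseteq> W" by (rule span_minimal[OF _ W(1)]) (use v0(1) j in auto)
        have d: "dim ?U = j" "dim ?V = ?k - j"
          using orthobasis_dim(1)[OF v J(1)] orthobasis_dim(1)[OF v J(2)] by auto
        have or: "x \<bullet> y = 0" if x: "x \<in> ?U" and y: "y \<in> ?V" for x y
        proof -
          have "orthogonal x b" if b: "b \<in> v ` {j..<?k}" for b
          proof -
            have "orthogonal b a" if "a \<in> v ` {..<j}" for a
              using v b that j unfolding orthobasis_def orthogonal_def by auto
            then show ?thesis using orthogonal_to_span[OF x] orthogonal_commute by blast
          qed
          then show ?thesis using orthogonal_to_span[OF y] unfolding orthogonal_def by blast
        qed
        have comp: "compact (?p J ` C j)" "convex (?p J ` C j)" for J
          using Cb[of j] j unfolding cbody_def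
          by (auto intro!: compact_continuous_image convex_linear_image linear_continuous_on linear_coord_part
              simp: linear_conv_bounded_linear[symmetric])
        have "?p J x \<in> span (v ` J)" for J x
          by (intro span_sum span_scale span_base) auto
        then have cAB: "cbody ?U ?A" "cbody ?V ?B" unfolding cbody_def using comp by blast+
        show ?thesis
          by (rule f(4)[unfolded prod_zero_def, rule_format, OF UV sub sub' _ _ _ _ cAB])
            (use d or j in auto)
      qed
      ultimately show ?thesis by simp
    qed
    have "(\<Sum>j\<in>{..?k}. f (C j)) = (\<Sum>j\<in>{0,?k}. f (C j))"
      by (rule sum.mono_neutral_right) (use mid in auto)
    moreover have "0 \<noteq> ?k" using W(2) by linarith
    ultimately show ?thesis by simp
  qed
  also have "C 0 = staircase W v s" unfolding C_def staircase_def using st by force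
  also have "f (C ?k) = f (staircase W v t)"
  proof -
    \<comment> \<open>Subtracting \<open>s\<close> from every coordinate turns the top piece into
      the staircase of size \<open>t\<close>.\<close>
    let ?z = "s *\<^sub>R (\<Sum>i<?k. v i)"
    have zW: "?z \<in> W" using v0(1) W(1) by (intro subspace_scale subspace_sum) auto
    have cz: "?c i ?z = s" if i: "i < ?k" for i
    proof -
      have "?c i (\<Sum>i<?k. v i) = (\<Sum>l<?k. if l = i then 1 else 0)"
        unfolding coord_sum using coord_basis[OF v i] by (intro sum.cong) auto
      then show ?thesis using i by simp
    qed
    have mem: "x \<in> C ?k \<longleftrightarrow> x - ?z \<in> staircase W v t" for x
    proof -
      define y where "y = x - ?z"
      have e: "?c i y = ?c i x - s" if "i < ?k" for i unfolding y_def using cz[OF that] by simp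
      have xy: "x \<in> W \<longleftrightarrow> y \<in> W" unfolding y_def
        using zW W(1) subspace_diff subspace_add by (metis diff_add_cancel)
      have "(\<forall>i<?k. 0 \<le> ?c i y \<and> ?c i y \<le> t) \<longleftrightarrow> (\<forall>i<?k. s \<le> ?c i x \<and> ?c i x \<le> s + t)"
      proof -
        have "0 \<le> ?c i y \<and> ?c i y \<le> t \<longleftrightarrow> s \<le> ?c i x \<and> ?c i x \<le> s + t" if "i < ?k" for i
          using e[OF that] by auto
        then show ?thesis by blast
      qed
      moreover have "(\<forall>i j. i \<le> j \<longrightarrow> j < ?k \<longrightarrow> ?c j y \<le> ?c i y)
          \<longleftrightarrow> (\<forall>i j. i \<le> j \<longrightarrow> j < ?k \<longrightarrow> ?c j x \<le> ?c i x)"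
      proof -
        have "?c j y \<le> ?c i y \<longleftrightarrow> ?c j x \<le> ?c i x" if "i \<le> j" "j < ?k" for i j
          using e[of i] e[of j] that by simp
        then show ?thesis by blast
      qed
      moreover have "x \<in> C ?k \<longleftrightarrow> x \<in> W \<and> (\<forall>i<?k. s \<le> ?c i x \<and> ?c i x \<le> s + t) \<and>
          (\<forall>i j. i \<le> j \<longrightarrow> j < ?k \<longrightarrow> ?c j x \<le> ?c i x)"
        unfolding C_def staircase_def using st by (auto intro: order_trans[OF st(1)])
      ultimately have "x \<in> C ?k \<longleftrightarrow> y \<in> staircase W v t" using xy unfolding staircase_def by blast
      then show ?thesis unfolding y_def .
    qed
    have "C ?k = (+) ?z ` staircase W v t"
    proof (intro equalityI subsetI)
      fix x assume "x \<in> C ?k"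
      then have "?z + (x - ?z) \<in> (+) ?z ` staircase W v t" using mem by blast
      then show "x \<in> (+) ?z ` staircase W v t" by simp
    next
      fix x assume "x \<in> (+) ?z ` staircase W v t"
      then obtain y where "y \<in> staircase W v t" "x = ?z + y" by blast
      then show "x \<in> C ?k" using mem[of x] by simp
    qed
    then show ?thesis using f(3)[unfolded tinv_def, rule_format, OF staircase_cbody[OF W(1) v] zW] by simp
  qed
  finally show ?thesis .
qed

lemma staircase_scale:
  assumes W: "subspace W" and m: "m > 0"
  shows "(*\<^sub>R) m ` staircase W v s = staircase W v (m * s)"
proof (intro equalityI subsetI)
  fix x assume "x \<in> (*\<^sub>R) m ` staircase W v s"
  then show "x \<in> staircase W v (m * s)"
    using m W unfolding staircase_def by (auto simp: subspace_scale mult_left_mono)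
next
  fix x assume x: "x \<in> staircase W v (m * s)"
  have "(1/m) *\<^sub>R x \<in> staircase W v s"
    using m W x unfolding staircase_def by (auto simp: subspace_scale field_simps)
  then have "m *\<^sub>R ((1/m) *\<^sub>R x) \<in> (*\<^sub>R) m ` staircase W v s" by blast
  then show "x \<in> (*\<^sub>R) m ` staircase W v s" using m by simp
qed

text \<open>Converts weights on the vertices of a path into coefficients of its steps; it serves to
  read a point of a staircase as a convex combination of the vertices.\<close>

lemma abel_summation:
  fixes q :: "nat \<Rightarrow> 'a::real_vector"
  shows "(\<Sum>j\<le>m. (e j - e (Suc j)) *\<^sub>R q j) =
    e 0 *\<^sub>R q 0 + (\<Sum>i<m. e (Suc i) *\<^sub>R (q (Suc i) - q i)) - e (Suc m) *\<^sub>R q m"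
  by (induction m) (auto simp: algebra_simps)

lemma orthoscheme_staircase:
  fixes q :: "nat \<Rightarrow> 'a::euclidean_space"
  assumes W: "subspace W" and v: "orthobasis W (\<lambda>i. q (Suc i) - q i)" and q: "q ` {..dim W} \<subseteq> W"
  shows "convex hull (q ` {..dim W}) = (+) (q 0) ` staircase W (\<lambda>i. q (Suc i) - q i) 1"
proof -
  let ?k = "dim W" and ?v = "\<lambda>i. q (Suc i) - q i"
  let ?P = "staircase W ?v 1"
  have q0: "q 0 \<in> W" using q by auto
  have tele: "(\<Sum>i<j. ?v i) = q j - q 0" for j by (induction j) auto
  have cq: "coord ?v i (q j - q 0) = (if i < j then 1 else 0)" if i: "i < ?k" and j: "j \<le> ?k" for i j
  proof -
    have "coord ?v i (q j - q 0) = (\<Sum>l<j. if l = i then 1 else 0)"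
      unfolding tele[symmetric] coord_sum using coord_basis[OF v i] j by (intro sum.cong) auto
    then show ?thesis by simp
  qed
  have sub: "q ` {..?k} \<subseteq> (+) (q 0) ` ?P"
  proof (rule image_subsetI)
    fix j assume j: "j \<in> {..?k}"
    then have "q j \<in> W" using q by blast
    then have "q j - q 0 \<in> ?P"
      unfolding staircase_def using cq j q0 W by (auto simp: subspace_diff)
    then have "q 0 + (q j - q 0) \<in> (+) (q 0) ` ?P" by blast
    then show "q j \<in> (+) (q 0) ` ?P" by simp
  qed
  have cP: "convex ?P" using staircase_cbody[OF W v] unfolding cbody_def by blast
  show ?thesis
  proof
    show "convex hull (q ` {..?k}) \<subseteq> (+) (q 0) ` ?P"
      using hull_minimal[of _ _ convex, OF sub] convex_translation[OF cP] by blast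
    show "(+) (q 0) ` ?P \<subseteq> convex hull (q ` {..?k})"
    proof (rule image_subsetI)
      fix x assume x: "x \<in> ?P"
      then have xW: "x \<in> W" unfolding staircase_def by blast
      \<comment> \<open>The coordinates shifted by one, preceded by \<open>1\<close> and followed by
        \<open>0\<close>: the successive differences are then nonnegative and telescope to
        \<open>1\<close>.\<close>
      define e where "e j = (if j = 0 then 1 else if j \<le> ?k then coord ?v (j - 1) x else 0)" for j
      have dec: "e (Suc j) \<le> e j" if "j \<le> ?k" for j
      proof (cases j)
        case 0 then show ?thesis using x unfolding e_def staircase_def by auto
      next
        case (Suc i)
        show ?thesis
        proof (cases "Suc j \<le> ?k")
          case True
          then have "coord ?v j x \<le> coord ?v i x" using x Suc unfolding staircase_def by auto
          then show ?thesis using True Suc by (simp add: e_def)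
        next
          case False
          then have "0 \<le> coord ?v i x" using x Suc that unfolding staircase_def by auto
          then show ?thesis using False Suc that by (simp add: e_def)
        qed
      qed
      have one: "(\<Sum>j\<le>?k. e j - e (Suc j)) = 1"
        using sum_telescope[of e ?k] by (simp add: e_def)
      have "(\<Sum>j\<le>?k. (e j - e (Suc j)) *\<^sub>R q j)
          = e 0 *\<^sub>R q 0 + (\<Sum>i<?k. e (Suc i) *\<^sub>R ?v i) - e (Suc ?k) *\<^sub>R q ?k" by (rule abel_summation)
      also have "\<dots> = q 0 + (\<Sum>i<?k. coord ?v i x *\<^sub>R ?v i)" by (simp add: e_def)
      also have "\<dots> = q 0 + x" using orthobasis_expand[OF W v xW] by simp
      finally have eq: "(\<Sum>j\<le>?k. (e j - e (Suc j)) *\<^sub>R q j) = q 0 + x" .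
      have "(\<Sum>j\<in>{..?k}. (e j - e (Suc j)) *\<^sub>R q j) \<in> convex hull (q ` {..?k})"
        by (rule convex_sum) (use one dec in \<open>auto intro: hull_inc\<close>)
      then show "q 0 + x \<in> convex hull (q ` {..?k})" unfolding eq .
    qed
  qed
qed

section \<open>Rescaling and homogeneity\<close>

lemma scale_cbody: "subspace W \<Longrightarrow> cbody W K \<Longrightarrow> cbody W ((*\<^sub>R) m ` K)"
  unfolding cbody_def by (auto intro!: compact_scaling convex_scaling subspace_scale)

lemma val_scaled:
  fixes f :: "'a::euclidean_space set \<Rightarrow> 'b::real_normed_vector"
  assumes W: "subspace W" and f: "val W f" and m: "m \<noteq> 0"
  shows "val W (\<lambda>K. f ((*\<^sub>R) m ` K))"
  unfolding val_def
proof (intro conjI allI impI)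
  show "f ((*\<^sub>R) m ` {}) = 0" using f unfolding val_def by simp
  fix K L :: "'a set" assume KL: "cbody W K" "cbody W L" "convex (K \<union> L)"
  have "inj ((*\<^sub>R) m :: 'a \<Rightarrow> 'a)" using m by (auto intro: injI)
  then have "(*\<^sub>R) m ` (K \<inter> L) = (*\<^sub>R) m ` K \<inter> (*\<^sub>R) m ` L" by (rule image_Int)
  moreover have "(*\<^sub>R) m ` (K \<union> L) = (*\<^sub>R) m ` K \<union> (*\<^sub>R) m ` L" by (rule image_Un)
  moreover have "convex ((*\<^sub>R) m ` (K \<union> L))" using KL(3) by (rule convex_scaling)
  ultimately show "f ((*\<^sub>R) m ` (K \<union> L)) + f ((*\<^sub>R) m ` (K \<inter> L)) = f ((*\<^sub>R) m ` K) + f ((*\<^sub>R) m ` L)"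
    using f scale_cbody[OF W KL(1)] scale_cbody[OF W KL(2)] unfolding val_def by metis
qed

lemma val_combine:
  fixes f g :: "'a::euclidean_space set \<Rightarrow> 'b::real_normed_vector"
  shows "val W f \<Longrightarrow> val W g \<Longrightarrow> val W (\<lambda>K. f K - c *\<^sub>R g K)"
  unfolding val_def by (auto simp: algebra_simps simp flip: scaleR_add_right)

lemma near_scale: "m > 0 \<Longrightarrow> near d K L \<Longrightarrow> near (m * d) ((*\<^sub>R) m ` K) ((*\<^sub>R) m ` L)"
  for K :: "'a::real_normed_vector set"
  unfolding near_def by (auto simp: dist_norm simp flip: scaleR_diff_right)

lemma hcont_scaled:
  fixes f :: "'a::euclidean_space set \<Rightarrow> 'b::real_normed_vector"
  assumes W: "subspace W" and f: "hcont W f" and m: "m > 0"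
  shows "hcont W (\<lambda>K. f ((*\<^sub>R) m ` K))"
  unfolding hcont_def
proof (intro allI impI)
  fix K :: "'a set" and e :: real assume K: "cbody W K" "K \<noteq> {}" and e: "e > 0"
  have "cbody W ((*\<^sub>R) m ` K)" "(*\<^sub>R) m ` K \<noteq> {}" using scale_cbody[OF W K(1)] K(2) by auto
  then obtain d where d: "d > 0" "\<And>L. cbody W L \<Longrightarrow> L \<noteq> {} \<Longrightarrow> near d ((*\<^sub>R) m ` K) L \<Longrightarrow>
      norm (f L - f ((*\<^sub>R) m ` K)) < e"
    using f e unfolding hcont_def by blast
  have "norm (f ((*\<^sub>R) m ` L) - f ((*\<^sub>R) m ` K)) < e"
    if L: "cbody W L" "L \<noteq> {}" "near (d / m) K L" for L
  proof (rule d(2))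
    show "cbody W ((*\<^sub>R) m ` L)" using scale_cbody[OF W L(1)] .
    show "near d ((*\<^sub>R) m ` K) ((*\<^sub>R) m ` L)" using near_scale[OF m L(3)] m by simp
  qed (use L in auto)
  then show "\<exists>d>0. \<forall>L. cbody W L \<longrightarrow> L \<noteq> {} \<longrightarrow> near d K L \<longrightarrow>
      norm (f ((*\<^sub>R) m ` L) - f ((*\<^sub>R) m ` K)) < e"
    using d(1) m by (intro exI[of _ "d / m"]) auto
qed

lemma near_mono: "near d K L \<Longrightarrow> d \<le> d' \<Longrightarrow> near d' K L"
  unfolding near_def by (meson order_trans)

lemma hcont_combine:
  fixes f g :: "'a::euclidean_space set \<Rightarrow> 'b::real_normed_vector"
  assumes f: "hcont W f" and g: "hcont W g"
  shows "hcont W (\<lambda>K. f K - c *\<^sub>R g K)"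
  unfolding hcont_def
proof (intro allI impI)
  fix K :: "'a set" and e :: real assume K: "cbody W K" "K \<noteq> {}" and e: "e > 0"
  obtain d where d: "d > 0" "\<And>L. cbody W L \<Longrightarrow> L \<noteq> {} \<Longrightarrow> near d K L \<Longrightarrow> norm (f L - f K) < e / 2"
    using f K half_gt_zero[OF e] unfolding hcont_def by blast
  have "e / (2 * (\<bar>c\<bar> + 1)) > 0" using e by simp
  then obtain d' where d': "d' > 0" "\<And>L. cbody W L \<Longrightarrow> L \<noteq> {} \<Longrightarrow> near d' K L \<Longrightarrow>
      norm (g L - g K) < e / (2 * (\<bar>c\<bar> + 1))"
    using g K unfolding hcont_def by blast
  have "norm (f L - c *\<^sub>R g L - (f K - c *\<^sub>R g K)) < e"
    if L: "cbody W L" "L \<noteq> {}" "near (min d d') K L" for L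
  proof -
    have 1: "norm (f L - f K) < e / 2" using d(2) L near_mono by (metis min.cobounded1)
    have "norm (g L - g K) < e / (2 * (\<bar>c\<bar> + 1))" using d'(2) L near_mono by (metis min.cobounded2)
    then have "(\<bar>c\<bar> + 1) * norm (g L - g K) < e / 2" by (simp add: field_simps)
    moreover have "\<bar>c\<bar> * norm (g L - g K) \<le> (\<bar>c\<bar> + 1) * norm (g L - g K)" by (simp add: mult_right_mono)
    ultimately have 2: "norm (c *\<^sub>R (g L - g K)) < e / 2" by simp
    have eq: "f L - c *\<^sub>R g L - (f K - c *\<^sub>R g K) = (f L - f K) - c *\<^sub>R (g L - g K)" by (simp add: algebra_simps)
    show ?thesis unfolding eq using 1 2 norm_triangle_ineq4[of "f L - f K" "c *\<^sub>R (g L - g K)"] by linarith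
  qed
  then show "\<exists>d>0. \<forall>L. cbody W L \<longrightarrow> L \<noteq> {} \<longrightarrow> near d K L \<longrightarrow> norm (f L - c *\<^sub>R g L - (f K - c *\<^sub>R g K)) < e"
    using d(1) d'(1) by (intro exI[of _ "min d d'"]) auto
qed

text \<open>The defect \<open>g\<close> is again a simple continuous valuation, so only orthoschemes
  have to be examined. Up to translation these are staircases of size \<open>1\<close>, and
  iterating \<open>staircase_add\<close> produces the factor \<open>m\<close>.\<close>

theorem degree_one:
  fixes f :: "'a::euclidean_space set \<Rightarrow> 'b::real_normed_vector"
  assumes W: "subspace W" "dim W > 0" and f: "val W f" "simple W f" "tinv W f" "hcont W f" "prod_zero W f"
    and m: "m > 0" and K: "cbody W K"
  shows "f ((*\<^sub>R) (real m) ` K) = real m *\<^sub>R f K"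
proof -
  define g where "g K = f ((*\<^sub>R) (real m) ` K) - real m *\<^sub>R f K" for K
  have gv: "val W g" unfolding g_def by (rule val_combine[OF val_scaled[OF W(1) f(1)] f(1)]) (use m in simp)
  have gc: "hcont W g" unfolding g_def by (rule hcont_combine[OF hcont_scaled[OF W(1) f(4)] f(4)]) (use m in simp)
  have gs: "simple W g" unfolding simple_def
  proof (intro allI impI)
    fix K assume K: "cbody W K" "thin W K"
    have "thin W ((*\<^sub>R) (real m) ` K)" using K(2) unfolding thin_def by fastforce
    then show "g K = 0" using f(2) K scale_cbody[OF W(1)] unfolding simple_def g_def by simp
  qed
  have "g (convex hull S) = 0" if S: "S \<subseteq> W" "\<not> affine_dependent S" "card S = dim W + 1" for S
  proof (rule orthoscheme_reduction[OF W gv gs _ S])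
    fix q :: "nat \<Rightarrow> 'a"
    assume q: "q ` {..dim W} \<subseteq> W" "inj_on q {..dim W}"
      "\<And>i j. i < j \<Longrightarrow> j < dim W \<Longrightarrow> (q (Suc i) - q i) \<bullet> (q (Suc j) - q j) = 0"
    let ?v = "\<lambda>i. q (Suc i) - q i"
    have v: "orthobasis W ?v" unfolding orthobasis_def
    proof (intro conjI allI impI)
      fix i assume i: "i < dim W"
      have "q (Suc i) \<in> W" "q i \<in> W" using q(1) i by auto
      then show "?v i \<in> W" using W subspace_diff by blast
      show "?v i \<noteq> 0" using q(2) i by (auto dest: inj_onD[of _ _ "Suc i" i])
      fix j assume "j < dim W" "i \<noteq> j"
      then show "?v i \<bullet> ?v j = 0" using q(3)[of i j] q(3)[of j i] i
        by (cases "i < j") (auto simp: inner_commute)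
    qed
    let ?P = "staircase W ?v"
    have add: "f (?P (real n)) = real n *\<^sub>R f (?P 1)" if "n > 0" for n :: nat
      using that
    proof (induction n)
      case 0 then show ?case by simp
    next
      case (Suc n)
      show ?case
      proof (cases "n = 0")
        case False
        have "f (?P (real n + 1)) = f (?P (real n)) + f (?P 1)"
          by (rule staircase_add[OF W f(1,2,3,5) v]) auto
        then show ?thesis using Suc False by (simp add: algebra_simps)
      qed simp
    qed
    have q0: "q 0 \<in> W" using q(1) by auto
    have cb: "cbody W (?P s)" for s by (rule staircase_cbody[OF W(1) v])
    have hull: "convex hull (q ` {..dim W}) = (+) (q 0) ` ?P 1"
      by (rule orthoscheme_staircase[OF W(1) v q(1)])
    have "(*\<^sub>R) (real m) ` ((+) (q 0) ` ?P 1) = (+) (real m *\<^sub>R q 0) ` ((*\<^sub>R) (real m) ` ?P 1)"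
      unfolding image_image by (simp add: scaleR_right_distrib)
    also have "(*\<^sub>R) (real m) ` ?P 1 = ?P (real m)" using staircase_scale[OF W(1), of "real m" ?v 1] m by simp
    finally have "f ((*\<^sub>R) (real m) ` ((+) (q 0) ` ?P 1)) = f (?P (real m))"
      using f(3) cb subspace_scale[OF W(1) q0] unfolding tinv_def by simp
    moreover have "f ((+) (q 0) ` ?P 1) = f (?P 1)" using f(3) cb q0 unfolding tinv_def by blast
    ultimately show "g (convex hull (q ` {..dim W})) = 0" unfolding g_def hull using add[OF m] by simp
  qed
  then have "g K = 0" using zero_of_simplices[OF W gv gs gc _ K] by blast
  then show ?thesis by (simp add: g_def)
qed

section \<open>Shadows of facets\<close>

text \<open>For a unit vector \<open>v\<close> these are the segments from the points of
  \<open>F\<close> in direction \<open>- v\<close> to the hyperplane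
  \<open>v \<bullet> y = - M\<close>; \<open>shadow_bound\<close> ensures that none of them is empty
  once \<open>M\<close> bounds the norms on \<open>F\<close>.\<close>

definition shadow :: "real \<Rightarrow> 'a::euclidean_space \<Rightarrow> 'a set \<Rightarrow> 'a set" where
  "shadow M v F = {x - t *\<^sub>R v | x t. x \<in> F \<and> 0 \<le> t \<and> t \<le> x \<bullet> v + M}"

text \<open>The case of \<open>prod_zero\<close> in which one factor is a segment. It is isolated
  because it is what comparing shadows at different levels requires, and because scalar valuations
  acquire it in another way, from homogeneity (\<open>homogeneous_cyl_zero\<close>).\<close>

definition cyl_zero :: "'a::euclidean_space set \<Rightarrow> ('a set \<Rightarrow> 'b::zero) \<Rightarrow> bool" where
  "cyl_zero W f \<longleftrightarrow> (\<forall>e A h. e \<in> W \<longrightarrow> norm e = 1 \<longrightarrow> cbody W A \<longrightarrow> (\<forall>x\<in>A. x \<bullet> e = 0) \<longrightarrow> h \<ge> 0 \<longrightarrow>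
     f {a + t *\<^sub>R e | a t. a \<in> A \<and> 0 \<le> t \<and> t \<le> h} = 0)"

lemma dim_hyperplane_in:
  fixes W :: "'a::euclidean_space set"
  assumes W: "subspace W" and e: "e \<in> W" "e \<noteq> 0"
  shows "subspace {x\<in>W. x \<bullet> e = 0}" "dim {x\<in>W. x \<bullet> e = 0} + 1 = dim W"
proof -
  have eq: "{x\<in>W. x \<bullet> e = 0} = {y\<in>W. \<forall>x\<in>span {e}. orthogonal x y}"
  proof (intro equalityI subsetI CollectI conjI ballI)
    fix y x assume y: "y \<in> {x\<in>W. x \<bullet> e = 0}" and x: "x \<in> span {e}"
    then obtain k where "x = k *\<^sub>R e" by (auto simp: span_singleton)
    then show "orthogonal x y" using y by (simp add: orthogonal_def inner_commute)
  next
    fix y assume y: "y \<in> {y\<in>W. \<forall>x\<in>span {e}. orthogonal x y}"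
    then have "orthogonal e y" using span_base[of e "{e}"] by blast
    then show "y \<in> W" "y \<bullet> e = 0" using y by (auto simp: orthogonal_def inner_commute)
  qed auto
  show "subspace {x\<in>W. x \<bullet> e = 0}"
    using W unfolding subspace_def by (auto simp: inner_add_left)
  have "dim {y\<in>W. \<forall>x\<in>span {e}. orthogonal x y} + dim (span {e}) = dim W"
    using dim_subspace_orthogonal_to_vectors[OF subspace_span W, of "{e}"] span_minimal[of "{e}" W] W e by blast
  moreover have "dim (span {e}) = 1"
    using e(2) independent_insert[of e "{}"] dim_eq_card_independent[of "{e}"] by (simp add: dim_span)
  ultimately show "dim {x\<in>W. x \<bullet> e = 0} + 1 = dim W" unfolding eq by simp
qed

lemma prod_zero_cyl_zero:
  assumes W: "subspace W" "dim W > 1" and f: "prod_zero W f"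
  shows "cyl_zero W f"
  unfolding cyl_zero_def
proof (intro allI impI)
  fix e :: 'a and A and h :: real
  assume e: "e \<in> W" "norm e = 1" and A: "cbody W A" "\<forall>x\<in>A. x \<bullet> e = 0" and h: "h \<ge> 0"
  have e0: "e \<noteq> 0" using e by auto
  let ?V = "span {e}"
  let ?B = "(\<lambda>t. t *\<^sub>R e) ` {0..h}"
  have eq: "{a + t *\<^sub>R e | a t. a \<in> A \<and> 0 \<le> t \<and> t \<le> h} = {a + b | a b. a \<in> A \<and> b \<in> ?B}"
  proof (intro equalityI subsetI)
    fix y assume "y \<in> {a + t *\<^sub>R e | a t. a \<in> A \<and> 0 \<le> t \<and> t \<le> h}"
    then obtain a t where "y = a + t *\<^sub>R e" "a \<in> A" "t \<in> {0..h}" by auto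
    then show "y \<in> {a + b | a b. a \<in> A \<and> b \<in> ?B}" by blast
  next
    fix y assume "y \<in> {a + b | a b. a \<in> A \<and> b \<in> ?B}"
    then obtain a t where "y = a + t *\<^sub>R e" "a \<in> A" "t \<in> {0..h}" by blast
    then show "y \<in> {a + t *\<^sub>R e | a t. a \<in> A \<and> 0 \<le> t \<and> t \<le> h}" by auto
  qed
  have "linear (\<lambda>t::real. t *\<^sub>R e)" by (rule linearI) (auto simp: algebra_simps)
  then have "convex ?B" by (rule convex_linear_image) simp
  moreover have "compact ?B" by (intro compact_continuous_image continuous_intros) simp
  moreover have "?B \<subseteq> ?V" by (intro image_subsetI span_scale span_base) simp
  ultimately have B: "cbody ?V ?B" unfolding cbody_def by blast
  have dV: "dim ?V = 1"
    using e0 independent_insert[of e "{}"] dim_eq_card_independent[of "{e}"] by (simp add: dim_span)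
  have V: "?V \<subseteq> W" using W e by (simp add: span_minimal)
  have "f {a + b | a b. a \<in> A \<and> b \<in> ?B} = 0"
    by (rule f[unfolded prod_zero_def, rule_format, OF dim_hyperplane_in(1)[OF W(1) e(1) e0] subspace_span _ V])
      (use dim_hyperplane_in(2)[OF W(1) e(1) e0] W(2) dV A B in \<open>auto simp: cbody_def span_singleton\<close>)
  then show "f {a + t *\<^sub>R e | a t. a \<in> A \<and> 0 \<le> t \<and> t \<le> h} = 0" unfolding eq .
qed

lemma shadowI: "x \<in> F \<Longrightarrow> 0 \<le> t \<Longrightarrow> t \<le> x \<bullet> v + M \<Longrightarrow> y = x - t *\<^sub>R v \<Longrightarrow> y \<in> shadow M v F"
  unfolding shadow_def by blast

lemma shadowE:
  assumes "y \<in> shadow M v F"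
  obtains x t where "y = x - t *\<^sub>R v" "x \<in> F" "0 \<le> t" "t \<le> x \<bullet> v + M"
  using assms unfolding shadow_def by blast

lemma shadow_subset:
  "subspace W \<Longrightarrow> v \<in> W \<Longrightarrow> F \<subseteq> W \<Longrightarrow> shadow M v F \<subseteq> W"
  unfolding shadow_def by (auto intro!: subspace_diff subspace_scale)

lemma shadow_bound:
  assumes "norm v = 1" "\<And>x. x \<in> F \<Longrightarrow> norm x \<le> M" "x \<in> F"
  shows "0 \<le> x \<bullet> v + M"
  using Cauchy_Schwarz_ineq2[of x v] assms(2)[OF assms(3)] assms(1) by auto

lemma cbody_shadow:
  assumes W: "subspace W" and v: "v \<in> W" "norm v = 1" and F: "cbody W F" and M: "\<And>x. x \<in> F \<Longrightarrow> norm x \<le> M"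
  shows "cbody W (shadow M v F)"
proof -
  \<comment> \<open>Rescaling the parameter of each segment to \<open>[0,1]\<close> presents the
    shadow as a continuous image of a compact product.\<close>
  have eq: "shadow M v F = (\<lambda>(x,s). x - (s * (x \<bullet> v + M)) *\<^sub>R v) ` (F \<times> {0..1})"
  proof (intro equalityI subsetI)
    fix y assume "y \<in> shadow M v F"
    then obtain x t where x: "y = x - t *\<^sub>R v" "x \<in> F" "0 \<le> t" "t \<le> x \<bullet> v + M"
      unfolding shadow_def by blast
    show "y \<in> (\<lambda>(x,s). x - (s * (x \<bullet> v + M)) *\<^sub>R v) ` (F \<times> {0..1})"
    proof (cases "x \<bullet> v + M = 0")
      case True
      then show ?thesis using x by (intro image_eqI[of _ _ "(x, 0)"]) auto
    next
      case False
      have "0 \<le> t / (x \<bullet> v + M)" "t / (x \<bullet> v + M) \<le> 1" "t / (x \<bullet> v + M) * (x \<bullet> v + M) = t"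
        using x False by (auto simp: divide_le_eq)
      then show ?thesis using x by (intro image_eqI[of _ _ "(x, t / (x \<bullet> v + M))"]) auto
    qed
  next
    fix y assume "y \<in> (\<lambda>(x,s). x - (s * (x \<bullet> v + M)) *\<^sub>R v) ` (F \<times> {0..1})"
    then obtain x s where x: "x \<in> F" "0 \<le> s" "s \<le> 1" "y = x - (s * (x \<bullet> v + M)) *\<^sub>R v" by auto
    have "0 \<le> x \<bullet> v + M" using shadow_bound[OF v(2) M x(1)] by blast
    then have "0 \<le> s * (x \<bullet> v + M)" "s * (x \<bullet> v + M) \<le> x \<bullet> v + M"
      using x by (auto simp: mult_left_le_one_le)
    then show "y \<in> shadow M v F" unfolding shadow_def using x by blast
  qed
  have "compact (shadow M v F)" unfolding eq case_prod_unfold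
    using F unfolding cbody_def
    by (intro compact_continuous_image continuous_intros compact_Times) auto
  moreover have "convex (shadow M v F)"
    unfolding convex_def
  proof (intro ballI allI impI)
    fix y z and a b :: real
    assume "y \<in> shadow M v F" "z \<in> shadow M v F" and ab: "0 \<le> a" "0 \<le> b" "a + b = 1"
    then obtain x t x' t' where x: "y = x - t *\<^sub>R v" "x \<in> F" "0 \<le> t" "t \<le> x \<bullet> v + M"
      and x': "z = x' - t' *\<^sub>R v" "x' \<in> F" "0 \<le> t'" "t' \<le> x' \<bullet> v + M"
      unfolding shadow_def by blast
    have "a *\<^sub>R x + b *\<^sub>R x' \<in> F" using F x x' ab unfolding cbody_def convex_def by blast
    moreover have "a * t + b * t' \<le> (a *\<^sub>R x + b *\<^sub>R x') \<bullet> v + M"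
    proof -
      have "a * t + b * t' \<le> a * (x \<bullet> v + M) + b * (x' \<bullet> v + M)"
        using x x' ab by (intro add_mono mult_left_mono) auto
      also have "\<dots> = (a *\<^sub>R x + b *\<^sub>R x') \<bullet> v + (a + b) * M" by (simp add: algebra_simps)
      finally show ?thesis using ab by simp
    qed
    moreover have "0 \<le> a * t + b * t'" using x x' ab by simp
    moreover have "a *\<^sub>R y + b *\<^sub>R z = (a *\<^sub>R x + b *\<^sub>R x') - (a * t + b * t') *\<^sub>R v"
      unfolding x(1) x'(1) by (simp add: algebra_simps)
    ultimately show "a *\<^sub>R y + b *\<^sub>R z \<in> shadow M v F" unfolding shadow_def by blast
  qed
  moreover have "shadow M v F \<subseteq> W" using shadow_subset[OF W v(1)] F unfolding cbody_def by blast
  ultimately show ?thesis unfolding cbody_def by blast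
qed

lemma shadow_Un: "shadow M v (F \<union> G) = shadow M v F \<union> shadow M v G"
  unfolding shadow_def by blast

text \<open>Both sets lie in one hyperplane transversal to \<open>v\<close>, so a point of a shadow
  determines the point that casts it.\<close>

lemma shadow_Int:
  assumes "n \<bullet> v \<noteq> 0" "\<And>x. x \<in> F \<union> G \<Longrightarrow> n \<bullet> x = b"
  shows "shadow M v (F \<inter> G) = shadow M v F \<inter> shadow M v G"
proof (intro equalityI subsetI)
  fix y assume "y \<in> shadow M v F \<inter> shadow M v G"
  then obtain x t x' t' where x: "y = x - t *\<^sub>R v" "x \<in> F" "0 \<le> t" "t \<le> x \<bullet> v + M"
      and x': "y = x' - t' *\<^sub>R v" "x' \<in> G" "0 \<le> t'" "t' \<le> x' \<bullet> v + M"
    unfolding shadow_def by blast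
  have "n \<bullet> x = b" "n \<bullet> x' = b" using assms(2) x x' by auto
  moreover have "n \<bullet> (x - t *\<^sub>R v) = n \<bullet> (x' - t' *\<^sub>R v)" using x x' by simp
  ultimately have "(t - t') * (n \<bullet> v) = 0" by (simp add: inner_diff_right left_diff_distrib)
  then have "t = t'" using assms(1) by simp
  then have "x = x'" using x x' by simp
  then show "y \<in> shadow M v (F \<inter> G)" unfolding shadow_def using x x' by blast
qed (auto simp: shadow_def)

lemma shadow_translate: "shadow M v ((+) z ` F) = (+) z ` shadow (M + z \<bullet> v) v F"
proof (intro equalityI subsetI)
  fix y assume "y \<in> shadow M v ((+) z ` F)"
  then obtain x t where x: "y = z + x - t *\<^sub>R v" "x \<in> F" "0 \<le> t" "t \<le> (z + x) \<bullet> v + M"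
    by (auto elim!: shadowE)
  have "x - t *\<^sub>R v \<in> shadow (M + z \<bullet> v) v F"
    by (rule shadowI[of x _ t]) (use x in \<open>auto simp: inner_add_left\<close>)
  moreover have "y = z + (x - t *\<^sub>R v)" unfolding x(1) by simp
  ultimately show "y \<in> (+) z ` shadow (M + z \<bullet> v) v F" by blast
next
  fix y assume "y \<in> (+) z ` shadow (M + z \<bullet> v) v F"
  then obtain x t where x: "y = z + (x - t *\<^sub>R v)" "x \<in> F" "0 \<le> t" "t \<le> x \<bullet> v + (M + z \<bullet> v)"
    by (auto elim!: shadowE)
  show "y \<in> shadow M v ((+) z ` F)"
    by (rule shadowI[of "z + x" _ t]) (use x in \<open>auto simp: inner_add_left\<close>)
qed

text \<open>All of \<open>F\<close> lies above the higher level, so every segment crosses the whole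
  slab between the two levels. The part in the slab is therefore a right cylinder over the
  projection of \<open>F\<close> along \<open>v\<close>, on which \<open>f\<close> vanishes.\<close>

lemma shadow_level:
  fixes f :: "'a::euclidean_space set \<Rightarrow> 'b::real_normed_vector"
  assumes W: "subspace W" and f: "val W f" "simple W f" "tinv W f" "cyl_zero W f"
    and v: "v \<in> W" "norm v = 1" and F: "cbody W F" and M: "\<And>x. x \<in> F \<Longrightarrow> norm x \<le> M'" "\<And>x. x \<in> F \<Longrightarrow> 0 \<le> x \<bullet> v + M" "M \<le> M'"
  shows "f (shadow M' v F) = f (shadow M v F)"
proof -
  have v0: "v \<noteq> 0" and vv: "v \<bullet> v = 1" using v by (auto simp: norm_eq_1)
  have S: "cbody W (shadow M' v F)" using cbody_shadow[OF W v F M(1)] .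
  have up: "shadow M' v F \<inter> {x. v \<bullet> x \<ge> - M} = shadow M v F"
  proof (intro equalityI subsetI)
    fix y assume y: "y \<in> shadow M' v F \<inter> {x. v \<bullet> x \<ge> - M}"
    then obtain x t where x: "y = x - t *\<^sub>R v" "x \<in> F" "0 \<le> t" unfolding shadow_def by blast
    have "t \<le> x \<bullet> v + M" using y x vv by (simp add: inner_diff_right inner_commute)
    then show "y \<in> shadow M v F" unfolding shadow_def using x by blast
  next
    fix y assume "y \<in> shadow M v F"
    then obtain x t where x: "y = x - t *\<^sub>R v" "x \<in> F" "0 \<le> t" "t \<le> x \<bullet> v + M" unfolding shadow_def by blast
    then have "v \<bullet> y \<ge> - M" using vv by (simp add: inner_diff_right inner_commute)
    moreover have "y \<in> shadow M' v F" by (rule shadowI[of x _ t]) (use x M(3) in auto)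
    ultimately show "y \<in> shadow M' v F \<inter> {x. v \<bullet> x \<ge> - M}" by blast
  qed
  let ?A = "(\<lambda>x. x - (x \<bullet> v) *\<^sub>R v) ` F"
  have lin: "linear (\<lambda>x. x - (x \<bullet> v) *\<^sub>R v)" by (rule linearI) (auto simp: algebra_simps inner_add_left)
  have A: "cbody W ?A" using F v(1) W unfolding cbody_def
    by (auto intro!: compact_continuous_image continuous_intros convex_linear_image lin subspace_diff subspace_scale)
  have Av: "\<forall>x\<in>?A. x \<bullet> v = 0" using vv by (auto simp: inner_diff_left)
  let ?C = "{a + t *\<^sub>R v | a t. a \<in> ?A \<and> 0 \<le> t \<and> t \<le> M' - M}"
  have "M' - M \<ge> 0" using M(3) by simp
  then have fC: "f ?C = 0" by (rule f(4)[unfolded cyl_zero_def, rule_format, OF v A, rotated]) (use Av in blast)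
  have lo: "shadow M' v F \<inter> {x. v \<bullet> x \<le> - M} = (+) (- M' *\<^sub>R v) ` ?C"
  proof (intro equalityI subsetI)
    fix y assume y: "y \<in> shadow M' v F \<inter> {x. v \<bullet> x \<le> - M}"
    then obtain x t where x: "y = x - t *\<^sub>R v" "x \<in> F" "0 \<le> t" "t \<le> x \<bullet> v + M'" unfolding shadow_def by blast
    have "t \<ge> x \<bullet> v + M" using y x vv by (simp add: inner_diff_right inner_commute)
    then have "0 \<le> x \<bullet> v + M' - t" "x \<bullet> v + M' - t \<le> M' - M" using x by auto
    then have "(x - (x \<bullet> v) *\<^sub>R v) + (x \<bullet> v + M' - t) *\<^sub>R v \<in> ?C" using x(2) by blast
    moreover have "y = - M' *\<^sub>R v + ((x - (x \<bullet> v) *\<^sub>R v) + (x \<bullet> v + M' - t) *\<^sub>R v)"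
      unfolding x(1) by (simp add: algebra_simps)
    ultimately show "y \<in> (+) (- M' *\<^sub>R v) ` ?C" by blast
  next
    fix y assume "y \<in> (+) (- M' *\<^sub>R v) ` ?C"
    then obtain x t where x: "x \<in> F" "0 \<le> t" "t \<le> M' - M" "y = - M' *\<^sub>R v + ((x - (x \<bullet> v) *\<^sub>R v) + t *\<^sub>R v)" by blast
    have y: "y = x - (x \<bullet> v + M' - t) *\<^sub>R v" unfolding x(4) by (simp add: algebra_simps)
    have "0 \<le> x \<bullet> v + M' - t" using M(2)[OF x(1)] x by simp
    then have "y \<in> shadow M' v F" by (intro shadowI[OF x(1) _ _ y]) (use x in auto)
    moreover have "v \<bullet> y \<le> - M" unfolding y using x vv by (simp add: inner_diff_right inner_commute)
    ultimately show "y \<in> shadow M' v F \<inter> {x. v \<bullet> x \<le> - M}" by blast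
  qed
  have cC: "cbody W ?C"
  proof -
    have "cbody W (shadow M' v F \<inter> {x. v \<bullet> x \<le> - M})"
      using S by (intro cbody_Int_closed closed_halfspace_le convex_halfspace_le)
    then have "cbody W ((+) (M' *\<^sub>R v) ` ((+) (- M' *\<^sub>R v) ` ?C))"
      unfolding lo using cbody_translate[OF W] subspace_scale[OF W v(1)] by blast
    moreover have "(+) (M' *\<^sub>R v) ` ((+) (- M' *\<^sub>R v) ` ?C) = ?C" by (simp add: image_image)
    ultimately show ?thesis by simp
  qed
  have "f (shadow M' v F) = f (shadow M' v F \<inter> {x. v \<bullet> x \<le> - M}) + f (shadow M' v F \<inter> {x. v \<bullet> x \<ge> - M})"
    by (rule val_cut[OF f(1,2) S v(1) v0])
  also have "f (shadow M' v F \<inter> {x. v \<bullet> x \<le> - M}) = 0"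
    unfolding lo fC[symmetric] by (rule f(3)[unfolded tinv_def, rule_format, OF cC subspace_scale[OF W v(1)]])
  finally show ?thesis unfolding up by simp
qed

lemma shadow_linear:
  assumes "linear g" "\<And>x y. g x \<bullet> g y = x \<bullet> y"
  shows "shadow M (g v) (g ` F) = g ` shadow M v F"
proof -
  have g: "g (x - t *\<^sub>R v) = g x - t *\<^sub>R g v" for x t using assms(1) by (simp add: linear_diff linear_scale)
  show ?thesis
  proof (intro equalityI subsetI)
    fix y assume "y \<in> shadow M (g v) (g ` F)"
    then obtain x t where x: "y = g x - t *\<^sub>R g v" "x \<in> F" "0 \<le> t" "t \<le> g x \<bullet> g v + M"
      by (auto elim!: shadowE)
    have "x - t *\<^sub>R v \<in> shadow M v F" by (rule shadowI[of x _ t]) (use x assms(2) in auto)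
    then show "y \<in> g ` shadow M v F" unfolding x(1) g[symmetric] by blast
  next
    fix y assume "y \<in> g ` shadow M v F"
    then obtain x t where x: "y = g (x - t *\<^sub>R v)" "x \<in> F" "0 \<le> t" "t \<le> x \<bullet> v + M"
      by (auto elim!: shadowE)
    show "y \<in> shadow M (g v) (g ` F)"
      by (rule shadowI[of "g x" _ t]) (use x assms(2) g in auto)
  qed
qed

lemma shadow_scale:
  assumes c: "c > 0"
  shows "shadow (c * M) v ((*\<^sub>R) c ` F) = (*\<^sub>R) c ` shadow M v F"
proof (intro equalityI subsetI)
  fix y assume "y \<in> shadow (c * M) v ((*\<^sub>R) c ` F)"
  then obtain x t where x: "y = c *\<^sub>R x - t *\<^sub>R v" "x \<in> F" "0 \<le> t" "t \<le> (c *\<^sub>R x) \<bullet> v + c * M"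
    by (auto elim!: shadowE)
  have "x - (t / c) *\<^sub>R v \<in> shadow M v F"
    by (rule shadowI[of x _ "t / c"]) (use x c in \<open>auto simp: field_simps\<close>)
  moreover have "y = c *\<^sub>R (x - (t / c) *\<^sub>R v)" unfolding x(1) using c by (simp add: scaleR_right_diff_distrib)
  ultimately show "y \<in> (*\<^sub>R) c ` shadow M v F" by blast
next
  fix y assume "y \<in> (*\<^sub>R) c ` shadow M v F"
  then obtain x t where x: "y = c *\<^sub>R (x - t *\<^sub>R v)" "x \<in> F" "0 \<le> t" "t \<le> x \<bullet> v + M"
    by (auto elim!: shadowE)
  have "c * t \<le> c * (x \<bullet> v + M)" using x c by simp
  then show "y \<in> shadow (c * M) v ((*\<^sub>R) c ` F)"
    by (intro shadowI[of "c *\<^sub>R x" _ "c * t"]) (use x c in \<open>auto simp: algebra_simps\<close>)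
qed

lemma shadow_thin:
  assumes W: "subspace W" "n \<in> W" and v: "v \<in> W" "n \<bullet> v \<noteq> 0"
    and F: "\<And>x. x \<in> F \<Longrightarrow> n \<bullet> x = b" and a: "a \<in> W" "a \<noteq> 0" "n \<bullet> a = 0" "\<And>x. x \<in> F \<Longrightarrow> a \<bullet> x = d"
  shows "thin W (shadow M v F)"
proof -
  \<comment> \<open>The combination of the two normals of the flat containing \<open>F\<close> that
    is orthogonal to \<open>v\<close>, hence constant along the segments of the shadow. It is
    nonzero because \<open>n \<bullet> a = 0\<close>.\<close>
  let ?a = "a - ((a \<bullet> v) / (n \<bullet> v)) *\<^sub>R n"
  have "?a \<in> W" using W a by (intro subspace_diff subspace_scale)
  moreover have "?a \<noteq> 0"
  proof
    assume "?a = 0"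
    then have "a \<bullet> a = ((a \<bullet> v) / (n \<bullet> v)) * (n \<bullet> a)" by (metis eq_iff_diff_eq_0 inner_scaleR_left)
    then show False using a by simp
  qed
  moreover have "?a \<bullet> v = 0" using v by (simp add: inner_diff_left)
  then have "?a \<bullet> y = d - ((a \<bullet> v) / (n \<bullet> v)) * b" if "y \<in> shadow M v F" for y
    using that F a unfolding shadow_def by (auto simp: inner_diff_right) (simp add: inner_diff_left)
  ultimately show ?thesis unfolding thin_def by blast
qed

text \<open>The constant collects \<open>d\<close> from the base points, \<open>(1 + M) * d\<close>
  from the lengths of the two segments, and \<open>2 * M * d\<close> from turning a segment of
  length at most \<open>2 * M\<close>.\<close>

lemma near_shadow_half:
  assumes u: "norm u = 1" "norm u' = 1" "norm (u - u') \<le> d" and d: "d \<ge> 0" and M: "M \<ge> 0"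
    and F: "\<And>x. x \<in> F \<Longrightarrow> norm x \<le> M" "\<And>x. x \<in> F' \<Longrightarrow> norm x \<le> M"
    and n: "\<And>x. x \<in> F \<Longrightarrow> \<exists>y\<in>F'. dist x y \<le> d" and y: "y \<in> shadow M u F"
  shows "\<exists>z\<in>shadow M u' F'. dist y z \<le> (2 + 3 * M) * d"
proof -
  obtain x t where x: "y = x - t *\<^sub>R u" "x \<in> F" "0 \<le> t" "t \<le> x \<bullet> u + M"
    using y unfolding shadow_def by blast
  obtain x' where x': "x' \<in> F'" "dist x x' \<le> d" using n[OF x(2)] by blast
  \<comment> \<open>The parameter is cut off where the segment below \<open>x'\<close> ends.\<close>
  define t' where "t' = min t (x' \<bullet> u' + M)"
  have t'0: "0 \<le> t'" using shadow_bound[OF u(2) F(2) x'(1)] x by (simp add: t'_def)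
  have xu: "x \<bullet> u \<le> M" "x' \<bullet> u' \<le> M"
    using norm_cauchy_schwarz[of x u] norm_cauchy_schwarz[of x' u'] F(1)[OF x(2)] F(2)[OF x'(1)] u by auto
  have t'M: "t' \<le> 2 * M" using xu by (simp add: t'_def)
  have "x \<bullet> u - x' \<bullet> u' = (x - x') \<bullet> u + x' \<bullet> (u - u')" by (simp add: inner_diff_left inner_diff_right)
  also have "\<dots> \<le> norm (x - x') * norm u + norm x' * norm (u - u')"
    by (intro add_mono norm_cauchy_schwarz)
  also have "\<dots> \<le> d + M * d"
    using u x'(2) F(2)[OF x'(1)] d M by (intro add_mono mult_mono) (auto simp: dist_norm)
  finally have diff: "x \<bullet> u - x' \<bullet> u' \<le> d + M * d" .
  have tt: "\<bar>t - t'\<bar> \<le> d + M * d"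
  proof (cases "t \<le> x' \<bullet> u' + M")
    case True
    then show ?thesis using d M by (simp add: t'_def)
  next
    case False
    then show ?thesis using diff x by (simp add: t'_def)
  qed
  have "x' - t' *\<^sub>R u' \<in> shadow M u' F'"
    unfolding shadow_def using x'(1) t'0 by (auto simp: t'_def intro!: exI[of _ x'] exI[of _ t'])
  moreover have "dist y (x' - t' *\<^sub>R u') \<le> (2 + 3 * M) * d"
  proof -
    have e: "y - (x' - t' *\<^sub>R u') = (x - x') - ((t - t') *\<^sub>R u + t' *\<^sub>R (u - u'))"
      using x by (simp add: algebra_simps)
    have "norm (y - (x' - t' *\<^sub>R u')) \<le> norm (x - x') + norm ((t - t') *\<^sub>R u + t' *\<^sub>R (u - u'))"
      unfolding e by (rule norm_triangle_ineq4)
    also have "\<dots> \<le> norm (x - x') + (norm ((t - t') *\<^sub>R u) + norm (t' *\<^sub>R (u - u')))"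
      by (intro add_left_mono norm_triangle_ineq)
    also have "\<dots> \<le> d + ((d + M * d) + 2 * M * d)"
    proof (intro add_mono)
      show "norm (x - x') \<le> d" using x'(2) by (simp add: dist_norm)
      show "norm ((t - t') *\<^sub>R u) \<le> d + M * d" using tt u by simp
      have "\<bar>t'\<bar> * norm (u - u') \<le> (2 * M) * d"
        using t'0 t'M u(3) d M by (intro mult_mono) auto
      then show "norm (t' *\<^sub>R (u - u')) \<le> 2 * M * d" by simp
    qed
    finally show ?thesis by (simp add: dist_norm algebra_simps)
  qed
  ultimately show ?thesis by blast
qed

lemma near_shadow:
  assumes u: "norm u = 1" "norm u' = 1" "norm (u - u') \<le> d" and d: "d \<ge> 0" and M: "M \<ge> 0"
    and F: "\<And>x. x \<in> F \<Longrightarrow> norm x \<le> M" "\<And>x. x \<in> F' \<Longrightarrow> norm x \<le> M" and n: "near d F F'"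
  shows "near ((2 + 3 * M) * d) (shadow M u F) (shadow M u' F')"
  unfolding near_def
proof (intro conjI ballI)
  fix y assume "y \<in> shadow M u F"
  then show "\<exists>z\<in>shadow M u' F'. dist y z \<le> (2 + 3 * M) * d"
    using n by (intro near_shadow_half[OF u d M F]) (auto simp: near_def)
next
  fix z assume z: "z \<in> shadow M u' F'"
  have u3: "norm (u' - u) \<le> d" using u(3) by (simp add: norm_minus_commute)
  have "\<exists>y\<in>shadow M u F. dist z y \<le> (2 + 3 * M) * d"
    using n by (intro near_shadow_half[OF u(2,1) u3 d M F(2,1) _ z]) (auto simp: near_def dist_commute)
  then show "\<exists>y\<in>shadow M u F. dist y z \<le> (2 + 3 * M) * d" by (simp add: dist_commute)
qed

text \<open>As the \<open>u s\<close> are inner normals, \<open>u s \<bullet> v < 0\<close> singles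
  out the facets on the side of \<open>v\<close>, and \<open>u s \<bullet> v > 0\<close> those
  turned away. The shadow of the simplex is the union of the shadows of the former, and also the
  simplex together with the shadows of the latter; comparing the two dissections gives the signs.
  Facets parallel to \<open>v\<close> get the sign \<open>0\<close>.\<close>

lemma facet_sum:
  fixes f :: "'a::euclidean_space set \<Rightarrow> 'b::real_normed_vector"
  assumes W: "subspace W" "dim W > 0" and f: "val W f" "simple W f"
    and S: "S \<subseteq> W" "\<not> affine_dependent S" "card S = dim W + 1"
    and u: "\<And>s. s \<in> S \<Longrightarrow> u s \<in> W" "\<And>s. s \<in> S \<Longrightarrow> norm (u s) = 1"
    "\<And>s. s \<in> S \<Longrightarrow> h s > (0::real)" "\<And>s t. s \<in> S \<Longrightarrow> t \<in> S \<Longrightarrow> t \<noteq> s \<Longrightarrow> u s \<bullet> t = b s"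
    "\<And>s. s \<in> S \<Longrightarrow> u s \<bullet> s = b s + h s"
    "convex hull S = {x\<in>W. \<forall>s\<in>S. b s \<le> u s \<bullet> x}"
    "\<And>s. s \<in> S \<Longrightarrow> convex hull (S - {s}) = {x\<in>convex hull S. u s \<bullet> x = b s}"
    and v: "v \<in> W" "norm v = 1" and M: "\<And>x. x \<in> convex hull S \<Longrightarrow> norm x \<le> M"
  shows "f (convex hull S) = (\<Sum>s\<in>S. (- sgn (u s \<bullet> v)) *\<^sub>R f (shadow M v (convex hull (S - {s}))))"
proof -
  let ?T = "convex hull S" and ?F = "\<lambda>s. convex hull (S - {s})"
  let ?B = "shadow M v ?T" and ?R = "\<lambda>s. shadow M v (convex hull (S - {s}))"
  have fin: "finite S" using S(2) aff_independent_finite by blast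
  obtain c where c: "c \<in> W" "c \<noteq> 0" using W(2) by (metis dim_eq_0 less_irrefl subsetI singleton_iff)
  define U where "U = {s\<in>S. u s \<bullet> v < 0}"
  define L where "L = {s\<in>S. u s \<bullet> v > 0}"
  have UL: "finite U" "finite L" "U \<subseteq> S" "L \<subseteq> S" using fin by (auto simp: U_def L_def)
  have T: "cbody W ?T" by (rule cbody_hull[OF fin S(1) W(1)])
  have Fc: "cbody W (?F s)" for s by (rule cbody_hull[OF _ _ W(1)]) (use fin S in auto)
  have FT: "?F s \<subseteq> ?T" for s by (rule hull_mono) auto
  have Bc: "cbody W ?B" and Rc: "cbody W (?R s)" for s
    using cbody_shadow[OF W(1) v T M] cbody_shadow[OF W(1) v Fc[of s], of M] M FT[of s] by blast+
  have inT: "b s \<le> u s \<bullet> x" if "s \<in> S" "x \<in> ?T" for s x using u(6) that by blast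
  have inF: "x \<in> ?T" "u s \<bullet> x = b s" if "s \<in> S" "x \<in> ?F s" for s x using u(7)[OF that(1)] that(2) by blast+
  \<comment> \<open>Points in both shadows are cast by the common ridge of the two facets. The
    combination \<open>?a\<close> of their normals that is orthogonal to \<open>v\<close> is
    constant on the shadow of that ridge.\<close>
  have thinR: "thin W (?R i \<inter> ?R j)" if ij: "i \<in> S" "j \<in> S" "i \<noteq> j" "(u i \<bullet> v) * (u j \<bullet> v) > 0" for i j
  proof -
    let ?a = "(u j \<bullet> v) *\<^sub>R u i - (u i \<bullet> v) *\<^sub>R u j"
    have aW: "?a \<in> W" using u(1) ij W by (intro subspace_diff subspace_scale) auto
    have "?a \<bullet> (i - j) = (u j \<bullet> v) * h i + (u i \<bullet> v) * h j"
      using u(4,5) ij by (simp add: inner_diff_left inner_diff_right algebra_simps)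
    moreover have "(u j \<bullet> v) * h i + (u i \<bullet> v) * h j \<noteq> 0"
    proof (cases "u i \<bullet> v > 0")
      case True
      then have "u j \<bullet> v > 0" using ij(4) by (simp add: zero_less_mult_iff)
      then have "(u j \<bullet> v) * h i > 0" "(u i \<bullet> v) * h j > 0" using True u(3) ij by auto
      then show ?thesis by linarith
    next
      case False
      then have "u i \<bullet> v < 0" "u j \<bullet> v < 0" using ij(4) by (auto simp: zero_less_mult_iff)
      then have "(u j \<bullet> v) * h i < 0" "(u i \<bullet> v) * h j < 0" using u(3) ij by (auto simp: mult_neg_pos)
      then show ?thesis by linarith
    qed
    ultimately have a0: "?a \<noteq> 0" by auto
    have "?a \<bullet> y = (u j \<bullet> v) * b i - (u i \<bullet> v) * b j" if y: "y \<in> ?R i \<inter> ?R j" for y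
    proof -
      obtain x t x' t' where x: "y = x - t *\<^sub>R v" "x \<in> ?F i" and x': "y = x' - t' *\<^sub>R v" "x' \<in> ?F j"
        using y unfolding shadow_def by blast
      have xx: "x = x' + (t - t') *\<^sub>R v" using x x' by (simp add: algebra_simps)
      have e: "u i \<bullet> x = b i" "u j \<bullet> x' = b j" "u i \<bullet> x' \<ge> b i" "u j \<bullet> x \<ge> b j"
        using inF[OF ij(1) x(2)] inF[OF ij(2) x'(2)] inT ij by auto
      have "u i \<bullet> x = u i \<bullet> x' + (t - t') * (u i \<bullet> v)" "u j \<bullet> x = u j \<bullet> x' + (t - t') * (u j \<bullet> v)"
        unfolding xx by (auto simp: inner_add_right)
      then have "(t - t') * (u i \<bullet> v) \<le> 0" "(t - t') * (u j \<bullet> v) \<ge> 0" using e by linarith+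
      then have "((t - t') * (u i \<bullet> v)) * ((t - t') * (u j \<bullet> v)) \<le> 0" by (rule mult_nonpos_nonneg)
      then have "(t - t')\<^sup>2 * ((u i \<bullet> v) * (u j \<bullet> v)) \<le> 0" by (simp add: power2_eq_square algebra_simps)
      then have "(t - t')\<^sup>2 \<le> 0" using ij(4) by (meson mult_le_0_iff not_le zero_le_power2 order_antisym_conv)
      then have "t = t'" by simp
      then have "x = x'" using xx by simp
      then have ex: "u i \<bullet> x = b i" "u j \<bullet> x = b j" using e by auto
      have "?a \<bullet> v = 0" by (simp add: inner_diff_left)
      then have "?a \<bullet> y = ?a \<bullet> x" unfolding x(1) by (simp add: inner_diff_right)
      then show ?thesis using ex by (simp only: inner_diff_left inner_scaleR_left)
    qed
    then show ?thesis unfolding thin_def using aW a0 by blast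
  qed
  have fU: "f ?B = (\<Sum>s\<in>U. f (?R s))"
  proof (rule dissection_sum[where W = W and I = U and f = f and P = ?B and c = c and K = ?R])
    show "?B = (\<Union>s\<in>U. ?R s)"
    proof (intro equalityI subsetI)
      fix y assume "y \<in> (\<Union>s\<in>U. ?R s)"
      then show "y \<in> ?B" using FT unfolding shadow_def by blast
    next
      fix y assume "y \<in> ?B"
      then obtain x t where x: "y = x - t *\<^sub>R v" "x \<in> ?T" "0 \<le> t" "t \<le> x \<bullet> v + M" unfolding shadow_def by blast
      have xW: "x \<in> W" using x(2) T unfolding cbody_def by blast
      \<comment> \<open>Without such facets the ray from \<open>x\<close> in direction
        \<open>v\<close> would stay in the bounded simplex.\<close>
      have Une: "U \<noteq> {}"
      proof
        assume "U = {}"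
        then have nn: "u s \<bullet> v \<ge> 0" if "s \<in> S" for s using that by (auto simp: U_def not_less)
        have "x + r *\<^sub>R v \<in> ?T" if r: "r \<ge> 0" for r
        proof -
          have "b s \<le> u s \<bullet> (x + r *\<^sub>R v)" if s: "s \<in> S" for s
            using inT[OF s x(2)] nn[OF s] r by (simp add: inner_add_right add_increasing2)
          then show ?thesis using u(6) xW v(1) W by (auto simp: subspace_add subspace_scale)
        qed
        then have "norm (x + (norm x + \<bar>M\<bar> + 1) *\<^sub>R v) \<le> M" by (intro M) auto
        moreover have "norm ((norm x + \<bar>M\<bar> + 1) *\<^sub>R v) = norm x + \<bar>M\<bar> + 1" using v by simp
        moreover have "norm ((norm x + \<bar>M\<bar> + 1) *\<^sub>R v) \<le> norm (x + (norm x + \<bar>M\<bar> + 1) *\<^sub>R v) + norm x"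
          using norm_triangle_ineq4[of "x + (norm x + \<bar>M\<bar> + 1) *\<^sub>R v" x] by simp
        ultimately show False by linarith
      qed
      \<comment> \<open>Going from \<open>y\<close> in direction \<open>v\<close>, the hyperplane of
        the facet opposite \<open>s\<close> is reached at parameter \<open>r s\<close>; the smallest
        of these is where the simplex is left.\<close>
      define r where "r s = (u s \<bullet> y - b s) / (- (u s \<bullet> v))" for s
      define q where "q = Min (r ` U)"
      have "q \<in> r ` U" unfolding q_def using UL Une by (intro Min_in) auto
      then obtain s where s: "s \<in> U" "q = r s" by blast
      have qr: "q \<le> r s" if "s \<in> U" for s using that UL unfolding q_def by simp
      have rU: "k \<le> r s \<longleftrightarrow> b s \<le> u s \<bullet> (y + k *\<^sub>R v)" if "s \<in> U" for s k
        using that by (simp add: r_def U_def inner_add_right field_simps)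
      have tr: "t \<le> r s" if "s \<in> U" for s using rU[OF that] inT[of s x] that x UL by auto
      have qt: "t \<le> q" using tr s by simp
      let ?z = "y + q *\<^sub>R v"
      have zx: "?z = x + (q - t) *\<^sub>R v" using x by (simp add: algebra_simps)
      have "b k \<le> u k \<bullet> ?z" if k: "k \<in> S" for k
      proof (cases "k \<in> U")
        case True then show ?thesis using rU[OF True] qr[OF True] by blast
      next
        case False
        then have "u k \<bullet> v \<ge> 0" using k by (auto simp: U_def)
        then show ?thesis unfolding zx using inT[OF k x(2)] qt by (simp add: inner_add_right add_increasing2)
      qed
      moreover have "?z \<in> W" unfolding zx using xW v W by (intro subspace_add subspace_scale)
      ultimately have zT: "?z \<in> ?T" using u(6) by blast
      have "u s \<bullet> ?z = b s" using s by (simp add: r_def U_def inner_add_right field_simps)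
      then have zF: "?z \<in> ?F s" using u(7)[of s] zT s UL by auto
      have "q \<le> ?z \<bullet> v + M"
      proof -
        have "y \<bullet> v = x \<bullet> v - t" using x v by (simp add: inner_diff_left norm_eq_1)
        then show ?thesis using x(4) v by (simp add: inner_add_left norm_eq_1)
      qed
      then have "y \<in> ?R s" by (intro shadowI[OF zF, of q]) (use qt x(3) in auto)
      then show "y \<in> (\<Union>s\<in>U. ?R s)" using s by blast
    qed
    show "thin W (?R i \<inter> ?R j)" if "i \<in> U" "j \<in> U" "i \<noteq> j" for i j
      by (rule thinR) (use that in \<open>auto simp: U_def mult_neg_neg\<close>)
    show "cbody W ?B" by (rule Bc)
    show "cbody W (?R i)" for i by (rule Rc)
  qed (use W c f UL in auto)
  have fL: "f ?B = f ?T + (\<Sum>s\<in>L. f (?R s))"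
  proof -
    \<comment> \<open>\<open>None\<close> stands for the simplex, \<open>Some s\<close> for the
      shadow of the facet opposite \<open>s\<close>.\<close>
    define K where "K i = (case i of None \<Rightarrow> ?T | Some s \<Rightarrow> ?R s)" for i
    have "f ?B = (\<Sum>i\<in>insert None (Some ` L). f (K i))"
    proof (rule dissection_sum[where W = W and I = "insert None (Some ` L)" and f = f and P = ?B and c = c and K = K])
      show "?B = (\<Union>i\<in>insert None (Some ` L). K i)"
      proof (intro equalityI subsetI)
        fix y assume "y \<in> (\<Union>i\<in>insert None (Some ` L). K i)"
        then consider "y \<in> ?T" | s where "s \<in> L" "y \<in> ?R s" by (auto simp: K_def)
        then show "y \<in> ?B"
        proof cases
          case 1
          then have "y = y - 0 *\<^sub>R v \<and> 0 \<le> y \<bullet> v + M" using shadow_bound[OF v(2) M 1] by simp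
          then show ?thesis unfolding shadow_def using 1 by blast
        next
          case 2
          then show ?thesis using FT unfolding shadow_def by blast
        qed
      next
        fix y assume "y \<in> ?B"
        then obtain x t where x: "y = x - t *\<^sub>R v" "x \<in> ?T" "0 \<le> t" "t \<le> x \<bullet> v + M" unfolding shadow_def by blast
        have xW: "x \<in> W" using x(2) T unfolding cbody_def by blast
        have yW: "y \<in> W" unfolding x(1) using xW v W by (intro subspace_diff subspace_scale)
        show "y \<in> (\<Union>i\<in>insert None (Some ` L). K i)"
        proof (cases "y \<in> ?T")
          case True then show ?thesis by (auto simp: K_def)
        next
          case False
          have nL: "b k \<le> u k \<bullet> (y + q *\<^sub>R v)" if k: "k \<in> S" "k \<notin> L" and q: "q \<le> t" for k q
          proof -
            have "u k \<bullet> v \<le> 0" using k by (auto simp: L_def)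
            then have "(q - t) * (u k \<bullet> v) \<ge> 0" using q by (simp add: mult_nonpos_nonpos)
            moreover have "y + q *\<^sub>R v = x + (q - t) *\<^sub>R v" using x by (simp add: algebra_simps)
            ultimately show ?thesis using inT[OF k(1) x(2)] by (simp add: inner_add_right)
          qed
          obtain k0 where k0: "k0 \<in> S" "u k0 \<bullet> y < b k0" using False u(6) yW by (auto simp: not_le)
          have k0L: "k0 \<in> L" using nL[of k0 0] k0 x(3) by (auto simp: not_le[symmetric])
          \<comment> \<open>Now the ray from \<open>y\<close> in direction \<open>v\<close> starts
            outside the simplex and enters it when it passes the last of the hyperplanes for
            \<open>L\<close>, hence the maximum.\<close>
          define r where "r s = (b s - u s \<bullet> y) / (u s \<bullet> v)" for s
          define q where "q = Max (r ` L)"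
          have "q \<in> r ` L" unfolding q_def using UL k0L by (intro Max_in) auto
          then obtain s where s: "s \<in> L" "q = r s" by blast
          have qr: "r s \<le> q" if "s \<in> L" for s using that UL unfolding q_def by simp
          have rL: "r s \<le> k \<longleftrightarrow> b s \<le> u s \<bullet> (y + k *\<^sub>R v)" if "s \<in> L" for s k
            using that by (simp add: r_def L_def inner_add_right field_simps)
          have "r k0 > 0" using k0 k0L by (simp add: r_def L_def)
          then have q0: "q > 0" using qr[OF k0L] by simp
          have qt: "q \<le> t" using rL[OF s(1), of t] inT[of s x] s x UL by auto
          let ?z = "y + q *\<^sub>R v"
          have "b k \<le> u k \<bullet> ?z" if k: "k \<in> S" for k
            using nL[OF k _ qt] rL[of k q] qr[of k] by blast
          moreover have "?z \<in> W" using yW v W by (intro subspace_add subspace_scale)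
          ultimately have zT: "?z \<in> ?T" using u(6) by blast
          have "u s \<bullet> ?z = b s" using s by (simp add: r_def L_def inner_add_right field_simps)
          then have zF: "?z \<in> ?F s" using u(7)[of s] zT s UL by auto
          have "q \<le> ?z \<bullet> v + M"
          proof -
            have "y \<bullet> v = x \<bullet> v - t" using x v by (simp add: inner_diff_left norm_eq_1)
            then show ?thesis using x(4) v by (simp add: inner_add_left norm_eq_1)
          qed
          then have "y \<in> ?R s" by (intro shadowI[OF zF, of q]) (use q0 in auto)
          then show ?thesis using s by (force simp: K_def)
        qed
      qed
      have TR: "thin W (?T \<inter> ?R j)" if j: "j \<in> L" for j
      proof -
        have jS: "j \<in> S" using j UL by blast
        have "u j \<bullet> y = b j" if y: "y \<in> ?T \<inter> ?R j" for y
        proof -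
          obtain x t where x: "y = x - t *\<^sub>R v" "x \<in> ?F j" "0 \<le> t" using y unfolding shadow_def by blast
          have "b j \<le> u j \<bullet> y" using inT[OF jS] y by blast
          moreover have "u j \<bullet> y = b j - t * (u j \<bullet> v)" using x inF[OF jS x(2)] by (simp add: inner_diff_right)
          moreover have "t * (u j \<bullet> v) \<ge> 0" using x(3) j by (simp add: L_def)
          ultimately show ?thesis by linarith
        qed
        moreover have "u j \<noteq> 0" using u(2)[OF jS] by auto
        ultimately show ?thesis unfolding thin_def using u(1)[OF jS] by blast
      qed
      show "thin W (K i \<inter> K j)" if ij: "i \<in> insert None (Some ` L)" "j \<in> insert None (Some ` L)" "i \<noteq> j" for i j
      proof -
        have RR: "thin W (?R i \<inter> ?R j)" if "i \<in> L" "j \<in> L" "i \<noteq> j" for i j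
          by (rule thinR) (use that in \<open>auto simp: L_def\<close>)
        have TR': "thin W (?R j \<inter> ?T)" if "j \<in> L" for j using TR[OF that] by (simp only: Int_commute)
        show ?thesis using ij TR TR' RR unfolding K_def by (cases i; cases j) auto
      qed
      show "cbody W ?B" by (rule Bc)
      show "cbody W (K i)" for i using T Rc by (cases i) (auto simp: K_def)
    qed (use W c f UL in auto)
    also have "\<dots> = f ?T + (\<Sum>s\<in>L. f (?R s))"
      using UL by (subst sum.insert) (auto simp: sum.reindex K_def)
    finally show ?thesis .
  qed
  have sg: "(\<Sum>s\<in>S. (- sgn (u s \<bullet> v)) *\<^sub>R f (?R s)) = (\<Sum>s\<in>U. f (?R s)) - (\<Sum>s\<in>L. f (?R s))"
  proof -
    have "(\<Sum>s\<in>S. (- sgn (u s \<bullet> v)) *\<^sub>R f (?R s)) = (\<Sum>s\<in>U \<union> L. (- sgn (u s \<bullet> v)) *\<^sub>R f (?R s))"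
      by (rule sum.mono_neutral_right) (use fin in \<open>auto simp: U_def L_def sgn_if split: if_splits\<close>)
    also have "\<dots> = (\<Sum>s\<in>U. (- sgn (u s \<bullet> v)) *\<^sub>R f (?R s)) + (\<Sum>s\<in>L. (- sgn (u s \<bullet> v)) *\<^sub>R f (?R s))"
      by (rule sum.union_disjoint) (use UL in \<open>auto simp: U_def L_def\<close>)
    also have "(\<Sum>s\<in>U. (- sgn (u s \<bullet> v)) *\<^sub>R f (?R s)) = (\<Sum>s\<in>U. f (?R s))"
      by (rule sum.cong) (auto simp: U_def)
    also have "(\<Sum>s\<in>L. (- sgn (u s \<bullet> v)) *\<^sub>R f (?R s)) = (\<Sum>s\<in>L. - f (?R s))"
      by (rule sum.cong) (auto simp: L_def)
    finally show ?thesis by (simp add: sum_negf)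
  qed
  show ?thesis unfolding sg eq_diff_eq using fU fL by simp
qed

section \<open>Averaging over directions\<close>

text \<open>The unit ball is invariant under the reflection. The measure of the preimage of
  \<open>A\<close> times that of the ball is a double integral; translations and exchanges of the
  order of integration move the reflection from the indicator of \<open>A\<close> to that of the
  ball, where it disappears.\<close>

lemma lborel_mirror: "distr lborel borel (mirror a) = (lborel :: 'a::euclidean_space measure)"
proof (rule measure_eqI)
  show "sets (distr lborel borel (mirror a)) = sets (lborel :: 'a measure)" by simp
  fix A :: "'a set" assume "A \<in> sets (distr lborel borel (mirror a))"
  then have A[measurable]: "A \<in> sets borel" by simp
  let ?T = "mirror a"
  have "continuous_on UNIV ?T" using linear_mirror linear_continuous_on linear_conv_bounded_linear by blast
  then have T[measurable]: "?T \<in> borel \<rightarrow>\<^sub>M borel" by (rule borel_measurable_continuous_onI)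
  let ?B = "ball (0::'a) 1"
  have B[measurable]: "?B \<in> sets borel" by simp
  have TB: "indicator ?B (?T x) = (indicator ?B x :: ennreal)" for x by (simp add: indicator_def)
  have tr: "(\<integral>\<^sup>+y. f (y + c) \<partial>lborel) = (\<integral>\<^sup>+y. f y \<partial>lborel)"
    if [measurable]: "f \<in> borel_measurable borel" for f :: "'a \<Rightarrow> ennreal" and c
  proof -
    have "(\<integral>\<^sup>+y. f y \<partial>lborel) = (\<integral>\<^sup>+y. f y \<partial>distr lborel borel ((+) c))" by (simp add: lborel_distr_plus)
    also have "\<dots> = (\<integral>\<^sup>+y. f (c + y) \<partial>lborel)" by (subst nn_integral_distr) auto
    finally show ?thesis by (simp add: add.commute)
  qed
  have um: "distr lborel borel uminus = (lborel :: 'a measure)"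
    by (subst lborel_affine[of "-1" 0]) (auto simp: density_1 one_ennreal_def[symmetric])
  have ref: "(\<integral>\<^sup>+y. f (c - y) \<partial>lborel) = (\<integral>\<^sup>+y. f y \<partial>lborel)"
    if [measurable]: "f \<in> borel_measurable borel" for f :: "'a \<Rightarrow> ennreal" and c
  proof -
    have "(\<integral>\<^sup>+y. f (y + c) \<partial>lborel) = (\<integral>\<^sup>+y. f (y + c) \<partial>distr lborel borel uminus)"
      unfolding um ..
    also have "\<dots> = (\<integral>\<^sup>+y. f (- y + c) \<partial>lborel)" by (subst nn_integral_distr) auto
    finally show ?thesis using tr[of f c] that by (simp add: algebra_simps)
  qed
  let ?i = "\<lambda>S x. indicator S x :: ennreal"
  have "(\<integral>\<^sup>+x. ?i A (?T x) \<partial>lborel) * emeasure lborel ?B = (\<integral>\<^sup>+x. (\<integral>\<^sup>+y. ?i A (?T x) * ?i ?B y \<partial>lborel) \<partial>lborel)"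
    by (simp add: nn_integral_cmult nn_integral_multc)
  also have "\<dots> = (\<integral>\<^sup>+x. (\<integral>\<^sup>+y. ?i A (?T x) * ?i ?B (y + ?T x) \<partial>lborel) \<partial>lborel)"
  proof (rule nn_integral_cong)
    fix x
    show "(\<integral>\<^sup>+y. ?i A (?T x) * ?i ?B y \<partial>lborel) = (\<integral>\<^sup>+y. ?i A (?T x) * ?i ?B (y + ?T x) \<partial>lborel)"
      using tr[of "\<lambda>y. ?i A (?T x) * ?i ?B y" "?T x"] by simp
  qed
  also have "\<dots> = (\<integral>\<^sup>+y. (\<integral>\<^sup>+x. ?i A (?T x) * ?i ?B (y + ?T x) \<partial>lborel) \<partial>lborel)"
    by (rule lborel_pair.Fubini'[symmetric]) measurable
  also have "\<dots> = (\<integral>\<^sup>+y. (\<integral>\<^sup>+x. ?i A (?T x - y) * ?i ?B (?T x) \<partial>lborel) \<partial>lborel)"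
  proof (rule nn_integral_cong)
    fix y
    \<comment> \<open>Translation of \<open>x\<close> by \<open>- ?T y\<close>, which becomes
      \<open>- y\<close> after the reflection because the latter is an involution.\<close>
    have "?T (x + - ?T y) = ?T x - y" for x by (simp add: mirror_diff)
    then show "(\<integral>\<^sup>+x. ?i A (?T x) * ?i ?B (y + ?T x) \<partial>lborel) = (\<integral>\<^sup>+x. ?i A (?T x - y) * ?i ?B (?T x) \<partial>lborel)"
      using tr[of "\<lambda>x. ?i A (?T x) * ?i ?B (y + ?T x)" "- ?T y"] by simp
  qed
  also have "\<dots> = (\<integral>\<^sup>+x. (\<integral>\<^sup>+y. ?i A (?T x - y) * ?i ?B (?T x) \<partial>lborel) \<partial>lborel)"
    by (rule lborel_pair.Fubini') measurable
  also have "\<dots> = (\<integral>\<^sup>+x. emeasure lborel A * ?i ?B x \<partial>lborel)"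
  proof (rule nn_integral_cong)
    fix x
    have "(\<integral>\<^sup>+y. ?i A (?T x - y) \<partial>lborel) = emeasure lborel A" using ref[of "?i A" "?T x"] by simp
    then show "(\<integral>\<^sup>+y. ?i A (?T x - y) * ?i ?B (?T x) \<partial>lborel) = emeasure lborel A * ?i ?B x"
      unfolding TB by (simp add: nn_integral_multc)
  qed
  also have "\<dots> = emeasure lborel A * emeasure lborel ?B" by (simp add: nn_integral_cmult)
  finally have eq: "(\<integral>\<^sup>+x. ?i A (?T x) \<partial>lborel) * emeasure lborel ?B = emeasure lborel A * emeasure lborel ?B" .
  have pos: "measure lborel ?B > 0" by (rule content_ball_pos) simp
  have "emeasure lborel ?B = ennreal (measure lborel ?B)"
    using emeasure_lborel_ball_finite[of "0::'a" 1] by (intro emeasure_eq_ennreal_measure) auto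
  then have "(\<integral>\<^sup>+x. ?i A (?T x) \<partial>lborel) = emeasure lborel A"
    using eq pos by (simp add: mult_right_ennreal_cancel)
  moreover have "(\<integral>\<^sup>+x. ?i A (?T x) \<partial>lborel) = emeasure (distr lborel borel ?T) A"
    using nn_integral_distr[of ?T lborel borel "?i A"] by simp
  ultimately show "emeasure (distr lborel borel ?T) A = emeasure lborel A" by simp
qed

lemma integral_mirror:
  fixes f :: "'a::euclidean_space \<Rightarrow> 'b::{banach, second_countable_topology}"
  assumes [measurable]: "f \<in> borel_measurable borel"
  shows "integral\<^sup>L lborel (\<lambda>x. f (mirror a x)) = integral\<^sup>L lborel f"
proof -
  have "continuous_on UNIV (mirror a)" using linear_mirror linear_continuous_on linear_conv_bounded_linear by blast
  then have T[measurable]: "mirror a \<in> borel \<rightarrow>\<^sub>M borel" by (rule borel_measurable_continuous_onI)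
  have "integral\<^sup>L lborel f = integral\<^sup>L (distr lborel borel (mirror a)) f" by (simp add: lborel_mirror)
  also have "\<dots> = integral\<^sup>L lborel (\<lambda>x. f (mirror a x))" by (subst integral_distr) auto
  finally show ?thesis by simp
qed

section \<open>Orthogonal projection and a measure on directions\<close>

definition proj :: "'a::euclidean_space set \<Rightarrow> 'a \<Rightarrow> 'a" where
  "proj W x = (SOME y. y \<in> W \<and> (\<forall>w\<in>W. (x - y) \<bullet> w = 0))"

lemma proj_props:
  assumes W: "subspace W"
  shows "proj W x \<in> W" "\<And>w. w \<in> W \<Longrightarrow> (x - proj W x) \<bullet> w = 0"
proof -
  obtain y z where yz: "y \<in> span W" "\<And>w. w \<in> span W \<Longrightarrow> orthogonal z w" "x = y + z"
    by (rule orthogonal_subspace_decomp_exists[of W x]) (rule that)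
  have "\<exists>y. y \<in> W \<and> (\<forall>w\<in>W. (x - y) \<bullet> w = 0)"
    using yz W by (intro exI[of _ y]) (auto simp: orthogonal_def span_eq_iff[THEN iffD2])
  from someI_ex[OF this] show "proj W x \<in> W" "\<And>w. w \<in> W \<Longrightarrow> (x - proj W x) \<bullet> w = 0"
    unfolding proj_def by blast+
qed

lemma proj_unique:
  assumes W: "subspace W" and y: "y \<in> W" "\<And>w. w \<in> W \<Longrightarrow> (x - y) \<bullet> w = 0"
  shows "proj W x = y"
proof -
  have d: "proj W x - y \<in> W" using proj_props(1)[OF W] y W subspace_diff by blast
  have "(x - y) \<bullet> (proj W x - y) = 0" "(x - proj W x) \<bullet> (proj W x - y) = 0"
    using y(2) proj_props(2)[OF W] d by blast+
  then have "(proj W x - y) \<bullet> (proj W x - y) = 0" by (simp add: inner_diff_left)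
  then show ?thesis by simp
qed

lemma proj_id: "subspace W \<Longrightarrow> x \<in> W \<Longrightarrow> proj W x = x"
  by (rule proj_unique) auto

lemma linear_proj:
  assumes W: "subspace W"
  shows "linear (proj W)"
proof (rule linearI)
  note p = proj_props[OF W]
  show "proj W (x + y) = proj W x + proj W y" for x y
  proof (rule proj_unique[OF W])
    show "proj W x + proj W y \<in> W" using p(1) W by (simp add: subspace_add)
    fix w assume w: "w \<in> W"
    have "x + y - (proj W x + proj W y) = (x - proj W x) + (y - proj W y)" by simp
    then show "(x + y - (proj W x + proj W y)) \<bullet> w = 0"
      using p(2)[OF w, of x] p(2)[OF w, of y] by (simp only: inner_add_left)
  qed
  show "proj W (c *\<^sub>R x) = c *\<^sub>R proj W x" for c x
  proof (rule proj_unique[OF W])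
    show "c *\<^sub>R proj W x \<in> W" using p W by (simp add: subspace_scale)
    fix w assume "w \<in> W"
    then have "c * ((x - proj W x) \<bullet> w) = 0" using p by simp
    then show "(c *\<^sub>R x - c *\<^sub>R proj W x) \<bullet> w = 0" by (simp add: inner_diff_left right_diff_distrib)
  qed
qed

lemma continuous_proj: "subspace W \<Longrightarrow> continuous_on S (proj W)"
  using linear_proj linear_continuous_on linear_conv_bounded_linear by blast

lemma proj_mirror:
  assumes W: "subspace W" and a: "a \<in> W"
  shows "proj W (mirror a x) = mirror a (proj W x)"
proof (rule proj_unique[OF W])
  show "mirror a (proj W x) \<in> W" using mirror_in[OF W a] proj_props(1)[OF W] by blast
  fix w assume w: "w \<in> W"
  have "(mirror a x - mirror a (proj W x)) \<bullet> w = mirror a (x - proj W x) \<bullet> mirror a (mirror a w)"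
    by (simp add: mirror_diff)
  also have "\<dots> = (x - proj W x) \<bullet> mirror a w" by (rule mirror_inner)
  also have "\<dots> = 0" using proj_props(2)[OF W] mirror_in[OF W a w] by blast
  finally show "(mirror a x - mirror a (proj W x)) \<bullet> w = 0" .
qed

lemma norm_proj_le: "subspace W \<Longrightarrow> norm (proj W x) \<le> norm x"
proof -
  assume W: "subspace W"
  have o: "(x - proj W x) \<bullet> proj W x = 0" using proj_props[OF W] by blast
  have "(norm x)\<^sup>2 = (norm (x - proj W x))\<^sup>2 + (norm (proj W x))\<^sup>2"
    using o by (simp add: power2_norm_eq_inner inner_diff_left inner_diff_right inner_commute)
  then have "(norm (proj W x))\<^sup>2 \<le> (norm x)\<^sup>2" by simp
  then show ?thesis by (rule power2_le_imp_le) simp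
qed

text \<open>Lebesgue measure on \<open>annulus W\<close>, pushed forward by \<open>dirn W\<close>, replaces the rotation
  invariant measure on the unit sphere of \<open>W\<close>.\<close>

definition annulus :: "'a::euclidean_space set \<Rightarrow> 'a set" where
  "annulus W = {v. 1 \<le> norm (proj W v) \<and> norm v \<le> 2}"

definition dirn :: "'a::euclidean_space set \<Rightarrow> 'a \<Rightarrow> 'a" where
  "dirn W v = proj W v /\<^sub>R norm (proj W v)"

lemma compact_annulus: "subspace W \<Longrightarrow> compact (annulus W)"
proof -
  assume W: "subspace W"
  have "closed {v. 1 \<le> norm (proj W v)}"
    by (intro closed_Collect_le continuous_intros continuous_proj[OF W])
  then have "compact (cball 0 2 \<inter> {v. 1 \<le> norm (proj W v)})" by (intro compact_Int_closed compact_cball)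
  moreover have "annulus W = cball 0 2 \<inter> {v. 1 \<le> norm (proj W v)}" by (auto simp: annulus_def)
  ultimately show ?thesis by simp
qed

lemma dirn_sphere: "subspace W \<Longrightarrow> v \<in> annulus W \<Longrightarrow> dirn W v \<in> W \<and> norm (dirn W v) = 1"
  unfolding dirn_def annulus_def using proj_props(1)[of W v]
  by (auto intro!: subspace_scale left_inverse)

lemma continuous_dirn: "subspace W \<Longrightarrow> continuous_on (annulus W) (dirn W)"
  unfolding dirn_def by (intro continuous_intros continuous_proj) (auto simp: annulus_def)

lemma dirn_measurable: "subspace W \<Longrightarrow> dirn W \<in> borel_measurable borel"
proof -
  assume W: "subspace W"
  have [measurable]: "proj W \<in> borel_measurable borel"
    by (rule borel_measurable_continuous_onI) (rule continuous_proj[OF W])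
  show ?thesis unfolding dirn_def by measurable
qed

lemma measure_annulus:
  assumes W: "subspace W" "dim W > 0"
  shows "measure lborel (annulus W) > 0"
proof -
  obtain c where c: "c \<in> W" "c \<noteq> 0" using W(2) by (metis dim_eq_0 less_irrefl subsetI singleton_iff)
  \<comment> \<open>The norm \<open>3/2\<close> lies halfway between the radii \<open>1\<close> and
    \<open>2\<close> and leaves room for a ball of radius \<open>1/4\<close>.\<close>
  let ?e = "(3 / (2 * norm c)) *\<^sub>R c"
  have e: "?e \<in> W" "norm ?e = 3/2" using c W by (auto simp: subspace_scale)
  have sub: "ball ?e (1/4) \<subseteq> annulus W"
  proof
    fix v assume "v \<in> ball ?e (1/4)"
    then have d: "norm (v - ?e) < 1/4" by (simp add: dist_norm norm_minus_commute)
    have "proj W v - ?e = proj W (v - ?e)"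
      using linear_diff[OF linear_proj[OF W(1)]] proj_id[OF W(1) e(1)] by simp
    then have "norm (proj W v - ?e) < 1/4" using norm_proj_le[OF W(1), of "v - ?e"] d by simp
    then have "norm (proj W v) \<ge> 1" using norm_triangle_ineq2[of ?e "proj W v"] e(2) by (simp add: norm_minus_commute)
    moreover have "norm v \<le> 2" using norm_triangle_sub[of v ?e] d e(2) by simp
    ultimately show "v \<in> annulus W" by (simp add: annulus_def)
  qed
  have fin: "emeasure lborel (annulus W) < \<infinity>"
    using emeasure_bounded_finite[OF compact_imp_bounded[OF compact_annulus[OF W(1)]]] by simp
  have "0 < measure lborel (ball ?e (1/4))" by (rule content_ball_pos) simp
  also have "\<dots> \<le> measure lborel (annulus W)"
    by (rule measure_mono_fmeasurable[OF sub])
      (use fin compact_annulus[OF W(1)] in \<open>auto simp: fmeasurable_def borel_compact\<close>)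
  finally show ?thesis .
qed

text \<open>The contribution of a facet with normal \<open>n\<close> in \<open>facet_sum\<close>,
  integrated over directions and with the sign reversed. Keeping the factor
  \<open>sgn (n \<bullet> dirn W v)\<close> makes the average odd in \<open>n\<close>.\<close>

definition avgM :: "'a::euclidean_space set \<Rightarrow> ('a set \<Rightarrow> 'b::euclidean_space) \<Rightarrow> real \<Rightarrow> 'a \<Rightarrow> 'a set \<Rightarrow> 'b" where
  "avgM W f M n F = integral\<^sup>L lborel (\<lambda>v. indicator (annulus W) v *\<^sub>R
      (sgn (n \<bullet> dirn W v) *\<^sub>R f (shadow M (dirn W v) F)))"

text \<open>For valuations that vanish on cylinders the level \<open>M\<close> of the hyperplane does not matter
  (\<open>avgM_level\<close>); \<open>bnd\<close> picks one.\<close>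

definition bnd :: "'a::euclidean_space set \<Rightarrow> real" where
  "bnd F = (SOME M. 0 \<le> M \<and> (\<forall>x\<in>F. norm x \<le> M))"

definition avg :: "'a::euclidean_space set \<Rightarrow> ('a set \<Rightarrow> 'b::euclidean_space) \<Rightarrow> 'a \<Rightarrow> 'a set \<Rightarrow> 'b" where
  "avg W f n F = avgM W f (bnd F) n F"

lemma bnd_props:
  assumes "cbody W F"
  shows "0 \<le> bnd F" "\<And>x. x \<in> F \<Longrightarrow> norm x \<le> bnd F"
proof -
  have "bounded F" using assms compact_imp_bounded unfolding cbody_def by blast
  then obtain B where "\<And>x. x \<in> F \<Longrightarrow> norm x \<le> B" unfolding bounded_iff by blast
  then have "\<exists>M. 0 \<le> M \<and> (\<forall>x\<in>F. norm x \<le> M)" by (intro exI[of _ "\<bar>B\<bar>"]) force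
  from someI_ex[OF this] show "0 \<le> bnd F" "\<And>x. x \<in> F \<Longrightarrow> norm x \<le> bnd F"
    unfolding bnd_def by blast+
qed

lemma shadow_empty [simp]: "shadow M v {} = {}"
  by (simp add: shadow_def)

lemma shadow_nonempty:
  assumes "norm v = 1" "\<And>x. x \<in> F \<Longrightarrow> norm x \<le> M" "F \<noteq> {}"
  shows "shadow M v F \<noteq> {}"
proof -
  obtain x where x: "x \<in> F" using assms by blast
  have "x - 0 *\<^sub>R v \<in> shadow M v F" by (rule shadowI[OF x, of 0]) (use shadow_bound[OF assms(1,2) x] in auto)
  then show ?thesis by blast
qed

text \<open>\<open>hcont\<close> is continuity at a single body, whereas an integral over directions
  needs one \<open>d\<close> for all of them. The unit sphere of \<open>W\<close> is compact, so
  finitely many directions \<open>w\<close> suffice as centres of comparison.\<close>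

lemma shadow_uniform:
  fixes f :: "'a::euclidean_space set \<Rightarrow> 'b::real_normed_vector"
  assumes W: "subspace W" and f: "hcont W f" and F: "cbody W F" "F \<noteq> {}" and M: "M \<ge> 0" "\<And>x. x \<in> F \<Longrightarrow> norm x \<le> M"
    and e: "e > 0"
  shows "\<exists>d>0. \<forall>u u' F'. u \<in> W \<longrightarrow> norm u = 1 \<longrightarrow> u' \<in> W \<longrightarrow> norm u' = 1 \<longrightarrow> norm (u - u') \<le> d \<longrightarrow>
    cbody W F' \<longrightarrow> F' \<noteq> {} \<longrightarrow> (\<forall>x\<in>F'. norm x \<le> M) \<longrightarrow> near d F F' \<longrightarrow>
    norm (f (shadow M u' F') - f (shadow M u F)) < e"
proof -
  let ?S = "{u\<in>W. norm u = 1}"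
  have "compact (W \<inter> sphere 0 1)" by (intro closed_Int_compact closed_subspace W compact_sphere)
  moreover have "?S = W \<inter> sphere 0 1" by auto
  ultimately have cS: "compact ?S" by simp
  have "\<exists>r>0. \<forall>L. cbody W L \<longrightarrow> L \<noteq> {} \<longrightarrow> near r (shadow M u F) L \<longrightarrow> norm (f L - f (shadow M u F)) < e / 2"
    if u: "u \<in> ?S" for u
  proof -
    have "cbody W (shadow M u F)" "shadow M u F \<noteq> {}"
      using cbody_shadow[OF W _ _ F(1) M(2), of u] shadow_nonempty[OF _ M(2) F(2), of u] u by auto
    then show ?thesis using f half_gt_zero[OF e] unfolding hcont_def by blast
  qed
  then have "\<forall>u\<in>?S. \<exists>r. r > 0 \<and> (\<forall>L. cbody W L \<longrightarrow> L \<noteq> {} \<longrightarrow> near r (shadow M u F) L \<longrightarrow>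
      norm (f L - f (shadow M u F)) < e / 2)" by blast
  then obtain r where r: "\<forall>u\<in>?S. r u > 0 \<and> (\<forall>L. cbody W L \<longrightarrow> L \<noteq> {} \<longrightarrow> near (r u) (shadow M u F) L \<longrightarrow>
      norm (f L - f (shadow M u F)) < e / 2)"
    by (rule bchoice[THEN exE])
  \<comment> \<open>\<open>near_shadow\<close> magnifies distances by \<open>2 + 3 * M\<close>, and
    the factor \<open>2\<close> leaves room for \<open>u'\<close>, which is within
    \<open>\<rho> w\<close> of \<open>u\<close>, itself within \<open>\<rho> w\<close> of the centre
    \<open>w\<close>.\<close>
  define \<rho> where "\<rho> u = r u / (2 * (2 + 3 * M))" for u
  have \<rho>: "\<rho> u > 0" "(2 + 3 * M) * (2 * \<rho> u) = r u" if "u \<in> ?S" for u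
  proof -
    have "r u > 0" "2 + 3 * M > 0" using r that M by auto
    then show "\<rho> u > 0" by (simp add: \<rho>_def)
    have "k * (2 * (x / (2 * k))) = x" if "k > 0" for k x :: real using that by simp
    from this[OF \<open>2 + 3 * M > 0\<close>] show "(2 + 3 * M) * (2 * \<rho> u) = r u" unfolding \<rho>_def .
  qed
  obtain D where D: "D \<subseteq> ?S" "finite D" "?S \<subseteq> (\<Union>u\<in>D. ball u (\<rho> u))"
  proof (rule compactE_image[OF cS, of ?S "\<lambda>u. ball u (\<rho> u)"])
    show "?S \<subseteq> (\<Union>u\<in>?S. ball u (\<rho> u))" using \<rho>(1) by fastforce
  qed auto
  define d where "d = Min (insert 1 (\<rho> ` D))"
  have d: "d > 0" unfolding d_def using D \<rho>(1) by (subst Min_gr_iff) auto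
  have d\<rho>: "d \<le> \<rho> u" if "u \<in> D" for u unfolding d_def using D that by (intro Min_le) auto
  have "norm (f (shadow M u' F') - f (shadow M u F)) < e"
    if h: "u \<in> W" "norm u = 1" "u' \<in> W" "norm u' = 1" "norm (u - u') \<le> d"
      "cbody W F'" "F' \<noteq> {}" "\<And>x. x \<in> F' \<Longrightarrow> norm x \<le> M" "near d F F'" for u u' F'
  proof -
    obtain w where w: "w \<in> D" "u \<in> ball w (\<rho> w)" using D(3) h by blast
    have wS: "w \<in> ?S" using w D by blast
    have wu: "norm (w - u) \<le> \<rho> w" using w(2) by (simp add: dist_norm)
    have wu': "norm (w - u') \<le> 2 * \<rho> w"
      using norm_triangle_ineq[of "w - u" "u - u'"] wu h(5) d\<rho>[OF w(1)] by simp
    have wu2: "norm (w - u) \<le> 2 * \<rho> w" using wu \<rho>(1)[OF wS] by simp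
    have n0: "near (2 * \<rho> w) F F" unfolding near_def using \<rho>(1)[OF wS] by (metis dist_self less_imp_le mult_pos_pos zero_less_numeral)
    have n1: "near (2 * \<rho> w) F F'" using near_mono[OF h(9)] d\<rho>[OF w(1)] \<rho>(1)[OF wS] by simp
    have p: "0 \<le> 2 * \<rho> w" using \<rho>(1)[OF wS] by simp
    have w1: "norm w = 1" using wS by blast
    have "near (r w) (shadow M w F) (shadow M u F)"
      using near_shadow[OF w1 h(2) wu2 p M M(2) n0] \<rho>(2)[OF wS] by simp
    moreover have "cbody W (shadow M u F)" "shadow M u F \<noteq> {}"
      using cbody_shadow[OF W h(1,2) F(1) M(2)] shadow_nonempty[OF h(2) M(2) F(2)] by auto
    ultimately have 1: "norm (f (shadow M u F) - f (shadow M w F)) < e / 2" using r wS by blast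
    have "near (r w) (shadow M w F) (shadow M u' F')"
      using near_shadow[OF w1 h(4) wu' p M h(8) n1] \<rho>(2)[OF wS] by simp
    moreover have "cbody W (shadow M u' F')" "shadow M u' F' \<noteq> {}"
      using cbody_shadow[OF W h(3,4,6,8)] shadow_nonempty[OF h(4,8,7)] by auto
    ultimately have 2: "norm (f (shadow M u' F') - f (shadow M w F)) < e / 2" using r wS by blast
    show ?thesis using norm_triangle_ineq4[of "f (shadow M u' F') - f (shadow M w F)" "f (shadow M u F) - f (shadow M w F)"] 1 2
      by simp
  qed
  then show ?thesis using d by blast
qed

text \<open>The value on the shadow depends continuously on the direction over the compact annulus;
  the sign is discontinuous but measurable and bounded by \<open>1\<close>.\<close>

lemma avg_integrable:
  fixes f :: "'a::euclidean_space set \<Rightarrow> 'b::euclidean_space"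
  assumes W: "subspace W" and f: "hcont W f" "f {} = 0" and F: "cbody W F" and M: "M \<ge> 0" "\<And>x. x \<in> F \<Longrightarrow> norm x \<le> M"
  shows "integrable lborel (\<lambda>v. indicator (annulus W) v *\<^sub>R (sgn (n \<bullet> dirn W v) *\<^sub>R f (shadow M (dirn W v) F)))"
proof -
  have cont: "continuous_on (annulus W) (\<lambda>v. f (shadow M (dirn W v) F))"
  proof (cases "F = {}")
    case True then show ?thesis by simp
  next
    case False
    have "continuous_on {u\<in>W. norm u = 1} (\<lambda>u. f (shadow M u F))"
      unfolding continuous_on_iff
    proof (intro ballI allI impI)
      fix u and e :: real assume u: "u \<in> {u\<in>W. norm u = 1}" and e: "e > 0"
      obtain d where d: "d > 0" "\<forall>u u' F'. u \<in> W \<longrightarrow> norm u = 1 \<longrightarrow> u' \<in> W \<longrightarrow> norm u' = 1 \<longrightarrow> norm (u - u') \<le> d \<longrightarrow>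
        cbody W F' \<longrightarrow> F' \<noteq> {} \<longrightarrow> (\<forall>x\<in>F'. norm x \<le> M) \<longrightarrow> near d F F' \<longrightarrow>
        norm (f (shadow M u' F') - f (shadow M u F)) < e"
        using shadow_uniform[OF W f(1) F False M e] by blast
      have "near d F F" unfolding near_def using d(1) by (metis dist_self less_imp_le)
      then have "dist (f (shadow M u' F)) (f (shadow M u F)) < e" if "u' \<in> {u\<in>W. norm u = 1}" "dist u' u < d" for u'
        using d(2) u that F False M(2) by (simp add: dist_norm norm_minus_commute)
      then show "\<exists>d>0. \<forall>u'\<in>{u\<in>W. norm u = 1}. dist u' u < d \<longrightarrow> dist (f (shadow M u' F)) (f (shadow M u F)) < e"
        using d(1) by blast
    qed
    then show ?thesis
      by (rule continuous_on_compose2[OF _ continuous_dirn[OF W]]) (use dirn_sphere[OF W] in blast)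
  qed
  let ?g = "\<lambda>v. indicator (annulus W) v *\<^sub>R f (shadow M (dirn W v) F)"
  have ig: "integrable lborel ?g" by (rule borel_integrable_compact[OF compact_annulus[OF W] cont])
  have [measurable]: "dirn W \<in> borel_measurable borel" by (rule dirn_measurable[OF W])
  have [measurable]: "?g \<in> borel_measurable lborel" by (rule borel_measurable_integrable[OF ig])
  have "integrable lborel (\<lambda>v. sgn (n \<bullet> dirn W v) *\<^sub>R ?g v)"
  proof (rule Bochner_Integration.integrable_bound[OF ig])
    show "(\<lambda>v. sgn (n \<bullet> dirn W v) *\<^sub>R ?g v) \<in> borel_measurable lborel" by measurable
    show "AE v in lborel. norm (sgn (n \<bullet> dirn W v) *\<^sub>R ?g v) \<le> norm (?g v)"
      by (rule AE_I2) (simp add: sgn_if)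
  qed
  then show ?thesis by (simp add: mult.commute)
qed

lemma sphere_avg_cong:
  assumes "\<And>v. v \<in> annulus W \<Longrightarrow> g v = h v"
  shows "(\<integral>v. indicator (annulus W) v *\<^sub>R g v \<partial>lborel) = (\<integral>v. indicator (annulus W) v *\<^sub>R h v \<partial>lborel)"
  by (rule Bochner_Integration.integral_cong) (use assms in \<open>auto simp: indicator_def\<close>)

text \<open>Values in any Euclidean space are allowed, so that the averages serve vector valuations
  and scalar valuations alike.\<close>

locale cyl_val =
  fixes W :: "'a::euclidean_space set" and f :: "'a set \<Rightarrow> 'b::euclidean_space"
  assumes W: "subspace W" "dim W > 0"
    and f: "val W f" "simple W f" "tinv W f" "hcont W f" "cyl_zero W f"
begin

lemma f_empty: "f {} = 0" using f(1) unfolding val_def by blast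

lemma avgM_level:
  assumes F: "cbody W F" and M: "\<And>x. x \<in> F \<Longrightarrow> norm x \<le> M" "\<And>x. x \<in> F \<Longrightarrow> norm x \<le> M'"
  shows "avgM W f M n F = avgM W f M' n F"
  unfolding avgM_def
proof (rule sphere_avg_cong)
  fix v assume "v \<in> annulus W"
  then have v: "dirn W v \<in> W" "norm (dirn W v) = 1" using dirn_sphere[OF W(1)] by auto
  have "f (shadow (max M M') (dirn W v) F) = f (shadow K (dirn W v) F)" if K: "K = M \<or> K = M'" for K
  proof (rule shadow_level[OF W(1) f(1,2,3,5) v F])
    show "norm x \<le> max M M'" if "x \<in> F" for x using M(1)[OF that] by simp
    show "0 \<le> x \<bullet> dirn W v + K" if "x \<in> F" for x
      using shadow_bound[OF v(2) M(1) that] shadow_bound[OF v(2) M(2) that] K by blast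
  qed (use K in auto)
  then show "sgn (n \<bullet> dirn W v) *\<^sub>R f (shadow M (dirn W v) F) = sgn (n \<bullet> dirn W v) *\<^sub>R f (shadow M' (dirn W v) F)"
    by metis
qed

lemma avg_eq:
  assumes F: "cbody W F" and M: "\<And>x. x \<in> F \<Longrightarrow> norm x \<le> M"
  shows "avg W f n F = avgM W f M n F"
  unfolding avg_def by (rule avgM_level[OF F bnd_props(2)[OF F] M])

lemma avg_empty: "avg W f n {} = 0"
  unfolding avg_def avgM_def by (simp add: f_empty)

text \<open>For bodies in the hyperplane orthogonal to \<open>n\<close>, shadows respect
  intersections in every direction transversal to it; in the remaining directions the sign
  annihilates the integrand.\<close>

lemma avg_val:
  assumes n: "n \<in> W" "n \<noteq> 0"
  shows "val {x\<in>W. x \<bullet> n = 0} (avg W f n)"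
  unfolding val_def
proof (intro conjI allI impI)
  let ?H = "{x\<in>W. x \<bullet> n = 0}"
  show "avg W f n {} = 0" by (rule avg_empty)
  fix K L assume KL: "cbody ?H K" "cbody ?H L" "convex (K \<union> L)"
  have c: "cbody W K" "cbody W L" using KL unfolding cbody_def by auto
  have cU: "cbody W (K \<union> L)" using c KL(3) unfolding cbody_def by auto
  have cI: "cbody W (K \<inter> L)" using cbody_Int[OF c] .
  define M where "M = bnd (K \<union> L)"
  have M: "M \<ge> 0" "\<And>x. x \<in> K \<union> L \<Longrightarrow> norm x \<le> M" using bnd_props[OF cU] by (auto simp: M_def)
  have i: "integrable lborel (\<lambda>v. indicator (annulus W) v *\<^sub>R (sgn (n \<bullet> dirn W v) *\<^sub>R f (shadow M (dirn W v) F)))"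
    if "cbody W F" "F \<subseteq> K \<union> L" for F
    by (rule avg_integrable[OF W(1) f(4) f_empty that(1) M(1)]) (use that M in blast)
  have a: "avg W f n F = avgM W f M n F" if "cbody W F" "F \<subseteq> K \<union> L" for F
    by (rule avg_eq[OF that(1)]) (use that M in blast)
  have "avgM W f M n (K \<union> L) + avgM W f M n (K \<inter> L) = avgM W f M n K + avgM W f M n L"
    unfolding avgM_def
  proof (subst (1 2) Bochner_Integration.integral_add[symmetric])
    show "(\<integral>v. indicator (annulus W) v *\<^sub>R (sgn (n \<bullet> dirn W v) *\<^sub>R f (shadow M (dirn W v) (K \<union> L)))
        + indicator (annulus W) v *\<^sub>R (sgn (n \<bullet> dirn W v) *\<^sub>R f (shadow M (dirn W v) (K \<inter> L))) \<partial>lborel) =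
      (\<integral>v. indicator (annulus W) v *\<^sub>R (sgn (n \<bullet> dirn W v) *\<^sub>R f (shadow M (dirn W v) K))
        + indicator (annulus W) v *\<^sub>R (sgn (n \<bullet> dirn W v) *\<^sub>R f (shadow M (dirn W v) L)) \<partial>lborel)"
      unfolding scaleR_add_right[symmetric]
    proof (rule sphere_avg_cong)
      fix v assume "v \<in> annulus W"
      then have v: "dirn W v \<in> W" "norm (dirn W v) = 1" using dirn_sphere[OF W(1)] by auto
      show "sgn (n \<bullet> dirn W v) *\<^sub>R (f (shadow M (dirn W v) (K \<union> L)) + f (shadow M (dirn W v) (K \<inter> L))) =
        sgn (n \<bullet> dirn W v) *\<^sub>R (f (shadow M (dirn W v) K) + f (shadow M (dirn W v) L))"
      proof (cases "n \<bullet> dirn W v = 0")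
        case False
        let ?s = "shadow M (dirn W v)"
        have "?s (K \<inter> L) = ?s K \<inter> ?s L"
          by (rule shadow_Int[OF False, of _ _ 0]) (use KL in \<open>auto simp: cbody_def inner_commute\<close>)
        moreover have "cbody W (?s F)" if "cbody W F" "F \<subseteq> K \<union> L" for F
          by (rule cbody_shadow[OF W(1) v that(1)]) (use that M in blast)
        then have "cbody W (?s K)" "cbody W (?s L)" "convex (?s (K \<union> L))"
          using c cU unfolding cbody_def by blast+
        ultimately have "f (?s (K \<union> L)) + f (?s (K \<inter> L)) = f (?s K) + f (?s L)"
          using f(1) unfolding val_def shadow_Un by metis
        then show ?thesis by simp
      qed simp
    qed
  qed (use i c cU cI in auto)
  then show "avg W f n (K \<union> L) + avg W f n (K \<inter> L) = avg W f n K + avg W f n L"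
    using a[OF cU] a[OF cI] a[OF c(1)] a[OF c(2)] by (simp add: le_infI1)
qed

text \<open>Translation by \<open>z\<close> changes the level of the far hyperplane from
  \<open>M\<close> to \<open>M + z \<bullet> v\<close>, which depends on the direction;
  \<open>shadow_level\<close> compares both with the common level \<open>M + norm z\<close>.\<close>

lemma avg_tinv:
  assumes F: "cbody W F" and z: "z \<in> W"
  shows "avg W f n ((+) z ` F) = avg W f n F"
proof -
  let ?G = "(+) z ` F"
  have G: "cbody W ?G" by (rule cbody_translate[OF W(1) z F])
  define M where "M = max (bnd F) (bnd ?G) + norm z"
  have M1: "norm x \<le> M" if "x \<in> F" for x using bnd_props(2)[OF F that] by (simp add: M_def max_def add_increasing2)
  have M2: "norm x \<le> M" if "x \<in> ?G" for x using bnd_props(2)[OF G that] by (simp add: M_def max_def add_increasing2)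
  have "avgM W f M n ?G = avgM W f M n F"
    unfolding avgM_def
  proof (rule sphere_avg_cong)
    fix v assume "v \<in> annulus W"
    then have v: "dirn W v \<in> W" "norm (dirn W v) = 1" using dirn_sphere[OF W(1)] by auto
    let ?v = "dirn W v"
    have zv: "z \<bullet> ?v \<le> norm z" using norm_cauchy_schwarz[of z ?v] v by simp
    have low: "0 \<le> x \<bullet> ?v + (M + z \<bullet> ?v)" if "x \<in> F" for x
    proof -
      have "0 \<le> (z + x) \<bullet> ?v + M" by (rule shadow_bound[OF v(2) M2]) (use that in auto)
      then show ?thesis by (simp add: inner_add_left)
    qed
    have b: "norm x \<le> M + norm z" if "x \<in> F" for x using M1[OF that] by (simp add: add_increasing2)
    have s1: "f (shadow (M + norm z) ?v F) = f (shadow (M + z \<bullet> ?v) ?v F)"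
      by (rule shadow_level[OF W(1) f(1,2,3,5) v F b low]) (use zv in auto)
    have s2: "f (shadow (M + norm z) ?v F) = f (shadow M ?v F)"
      by (rule shadow_level[OF W(1) f(1,2,3,5) v F b]) (use shadow_bound[OF v(2) M1] in auto)
    have sh: "shadow M ?v ?G = (+) z ` shadow (M + z \<bullet> ?v) ?v F" by (rule shadow_translate)
    have "cbody W (shadow M ?v ?G)" by (rule cbody_shadow[OF W(1) v G M2])
    then have "cbody W ((+) (- z) ` shadow M ?v ?G)"
      using cbody_translate[OF W(1)] subspace_neg[OF W(1) z] by blast
    then have "cbody W (shadow (M + z \<bullet> ?v) ?v F)" unfolding sh by (simp add: image_image)
    then have "f (shadow M ?v ?G) = f (shadow (M + z \<bullet> ?v) ?v F)"
      unfolding sh using f(3) z unfolding tinv_def by blast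
    then show "sgn (n \<bullet> ?v) *\<^sub>R f (shadow M ?v ?G) = sgn (n \<bullet> ?v) *\<^sub>R f (shadow M ?v F)"
      using s1 s2 by simp
  qed
  then show ?thesis using avg_eq[OF G M2] avg_eq[OF F M1] by simp
qed

lemma avg_hcont:
  assumes n: "n \<in> W"
  shows "hcont {x\<in>W. x \<bullet> n = 0} (avg W f n)"
  unfolding hcont_def
proof (intro allI impI)
  let ?H = "{x\<in>W. x \<bullet> n = 0}"
  fix K and e :: real assume K: "cbody ?H K" "K \<noteq> {}" and e: "e > 0"
  have c: "cbody W K" using K unfolding cbody_def by auto
  \<comment> \<open>The extra \<open>1\<close> lets \<open>M\<close> bound also the bodies within
    distance \<open>1\<close> of \<open>K\<close>.\<close>
  define M where "M = bnd K + 1"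
  have M: "M \<ge> 0" "\<And>x. x \<in> K \<Longrightarrow> norm x \<le> M" "\<And>x. x \<in> K \<Longrightarrow> norm x + 1 \<le> M"
    using bnd_props[OF c] by (auto simp: M_def add_increasing2)
  define m where "m = measure lborel (annulus W)"
  have m: "m > 0" unfolding m_def by (rule measure_annulus[OF W])
  have e': "e / (2 * m) > 0" using e m by simp
  obtain d where d: "d > 0" "\<forall>u u' F'. u \<in> W \<longrightarrow> norm u = 1 \<longrightarrow> u' \<in> W \<longrightarrow> norm u' = 1 \<longrightarrow> norm (u - u') \<le> d \<longrightarrow>
    cbody W F' \<longrightarrow> F' \<noteq> {} \<longrightarrow> (\<forall>x\<in>F'. norm x \<le> M) \<longrightarrow> near d K F' \<longrightarrow>
    norm (f (shadow M u' F') - f (shadow M u K)) < e / (2 * m)"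
    using shadow_uniform[OF W(1) f(4) c K(2) M(1,2) e'] by blast
  have "norm (avg W f n L - avg W f n K) < e"
    if L: "cbody ?H L" "L \<noteq> {}" "near (min d 1) K L" for L
  proof -
    have cL: "cbody W L" using L unfolding cbody_def by auto
    have LM: "norm x \<le> M" if x: "x \<in> L" for x
    proof -
      obtain y where y: "y \<in> K" "dist y x \<le> min d 1" using L(3) x unfolding near_def by blast
      have "norm x \<le> norm y + norm (x - y)" by (rule norm_triangle_sub)
      then show ?thesis using M(3)[OF y(1)] y(2) by (simp add: dist_norm norm_minus_commute)
    qed
    have nL: "near d K L" using near_mono[OF L(3)] by simp
    let ?i = "\<lambda>F v. indicator (annulus W) v *\<^sub>R (sgn (n \<bullet> dirn W v) *\<^sub>R f (shadow M (dirn W v) F))"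
    have iL: "integrable lborel (?i L)" by (rule avg_integrable[OF W(1) f(4) f_empty cL M(1) LM])
    have iK: "integrable lborel (?i K)" by (rule avg_integrable[OF W(1) f(4) f_empty c M(1,2)])
    have fin: "emeasure lborel (annulus W) < \<infinity>"
      using emeasure_bounded_finite[OF compact_imp_bounded[OF compact_annulus[OF W(1)]]] by simp
    have iA: "integrable lborel (\<lambda>v. indicator (annulus W) v * (e / (2 * m)))"
      using fin compact_annulus[OF W(1)] by (auto intro!: integrable_real_indicator simp: borel_compact)
    have "avg W f n L - avg W f n K = (\<integral>v. ?i L v - ?i K v \<partial>lborel)"
      using avg_eq[OF cL LM] avg_eq[OF c M(2)] Bochner_Integration.integral_diff[OF iL iK] by (simp add: avgM_def)
    also have "norm \<dots> \<le> (\<integral>v. norm (?i L v - ?i K v) \<partial>lborel)" by (rule integral_norm_bound)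
    also have "\<dots> \<le> (\<integral>v. indicator (annulus W) v * (e / (2 * m)) \<partial>lborel)"
    proof (rule integral_mono)
      show "integrable lborel (\<lambda>v. norm (?i L v - ?i K v))" using iL iK by auto
      show "integrable lborel (\<lambda>v. indicator (annulus W) v * (e / (2 * m)))" by (rule iA)
      fix v :: 'a
      show "norm (?i L v - ?i K v) \<le> indicator (annulus W) v * (e / (2 * m))"
      proof (cases "v \<in> annulus W")
        case True
        then have v: "dirn W v \<in> W" "norm (dirn W v) = 1" using dirn_sphere[OF W(1)] by auto
        have "norm (f (shadow M (dirn W v) L) - f (shadow M (dirn W v) K)) < e / (2 * m)"
          using d v cL L(2) LM nL by simp
        then show ?thesis using True e' by (auto simp: scaleR_diff_right[symmetric] sgn_if)
      qed simp
    qed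
    also have "\<dots> = m * (e / (2 * m))" by (simp add: m_def)
    also have "\<dots> < e" using m e by simp
    finally show ?thesis .
  qed
  then show "\<exists>d>0. \<forall>L. cbody ?H L \<longrightarrow> L \<noteq> {} \<longrightarrow> near d K L \<longrightarrow> norm (avg W f n L - avg W f n K) < e"
    using d(1) by (intro exI[of _ "min d 1"]) auto
qed

lemma avg_simple:
  assumes n: "n \<in> W" "n \<noteq> 0"
  shows "simple {x\<in>W. x \<bullet> n = 0} (avg W f n)"
  unfolding simple_def
proof (intro allI impI)
  let ?H = "{x\<in>W. x \<bullet> n = 0}"
  fix K assume K: "cbody ?H K" "thin ?H K"
  have c: "cbody W K" using K unfolding cbody_def by auto
  obtain a b where ab: "a \<in> ?H" "a \<noteq> 0" "\<And>x. x \<in> K \<Longrightarrow> a \<bullet> x = b" using K(2) unfolding thin_def by blast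
  have "avg W f n K = (\<integral>v. indicator (annulus W) v *\<^sub>R (0::'b) \<partial>lborel)"
    unfolding avg_def avgM_def
  proof (rule sphere_avg_cong)
    fix v assume "v \<in> annulus W"
    then have v: "dirn W v \<in> W" "norm (dirn W v) = 1" using dirn_sphere[OF W(1)] by auto
    show "sgn (n \<bullet> dirn W v) *\<^sub>R f (shadow (bnd K) (dirn W v) K) = 0"
    proof (cases "n \<bullet> dirn W v = 0")
      case False
      have "thin W (shadow (bnd K) (dirn W v) K)"
        by (rule shadow_thin[where b = 0, OF W(1) n(1) v(1) False _ _ ab(2) _ ab(3)])
          (use K(1) ab(1) in \<open>auto simp: cbody_def inner_commute\<close>)
      moreover have "cbody W (shadow (bnd K) (dirn W v) K)"
        by (rule cbody_shadow[OF W(1) v c bnd_props(2)[OF c]])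
      ultimately show ?thesis using f(2) unfolding simple_def by simp
    qed simp
  qed
  then show "avg W f n K = 0" by simp
qed

lemma avg_odd: "avg W f (- n) F = - avg W f n F"
  unfolding avg_def avgM_def by (simp add: sgn_minus)

lemma avg_normal_scale: "c > 0 \<Longrightarrow> avg W f (c *\<^sub>R n) F = avg W f n F"
  unfolding avg_def avgM_def by (simp add: sgn_mult)

lemma avg_homogeneous:
  assumes c: "c > 0" and h: "\<And>K. cbody W K \<Longrightarrow> f ((*\<^sub>R) c ` K) = c *\<^sub>R f K" and F: "cbody W F"
  shows "avg W f n ((*\<^sub>R) c ` F) = c *\<^sub>R avg W f n F"
proof -
  define M where "M = bnd F"
  have M: "\<And>x. x \<in> F \<Longrightarrow> norm x \<le> M" using bnd_props[OF F] by (auto simp: M_def)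
  have cM: "norm x \<le> c * M" if "x \<in> (*\<^sub>R) c ` F" for x using that M c by auto
  have "avg W f n ((*\<^sub>R) c ` F) = avgM W f (c * M) n ((*\<^sub>R) c ` F)"
    by (rule avg_eq[OF scale_cbody[OF W(1) F] cM])
  also have "\<dots> = (\<integral>v. indicator (annulus W) v *\<^sub>R (c *\<^sub>R (sgn (n \<bullet> dirn W v) *\<^sub>R f (shadow M (dirn W v) F))) \<partial>lborel)"
    unfolding avgM_def
  proof (rule sphere_avg_cong)
    fix v assume "v \<in> annulus W"
    then have v: "dirn W v \<in> W" "norm (dirn W v) = 1" using dirn_sphere[OF W(1)] by auto
    have "f (shadow (c * M) (dirn W v) ((*\<^sub>R) c ` F)) = c *\<^sub>R f (shadow M (dirn W v) F)"
      unfolding shadow_scale[OF c] using h cbody_shadow[OF W(1) v F M] by blast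
    then show "sgn (n \<bullet> dirn W v) *\<^sub>R f (shadow (c * M) (dirn W v) ((*\<^sub>R) c ` F)) =
        c *\<^sub>R (sgn (n \<bullet> dirn W v) *\<^sub>R f (shadow M (dirn W v) F))" by simp
  qed
  also have "\<dots> = c *\<^sub>R avgM W f M n F"
    unfolding avgM_def integral_scaleR_right[symmetric] by (simp add: mult_ac)
  finally show ?thesis by (simp add: avg_def M_def)
qed

lemma dirn_mirror: "a \<in> W \<Longrightarrow> dirn W (mirror a v) = mirror a (dirn W v)"
  unfolding dirn_def by (simp add: proj_mirror[OF W(1)] mirror_scale)

lemma annulus_mirror: "a \<in> W \<Longrightarrow> mirror a v \<in> annulus W \<longleftrightarrow> v \<in> annulus W"
  unfolding annulus_def by (simp add: proj_mirror[OF W(1)])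

text \<open>The annulus and Lebesgue measure are invariant under reflections with normals in
  \<open>W\<close>, and shadows commute with them. The linear map \<open>\<rho>\<close> is left free
  so as to cover equivariant vector valuations and, with the identity, invariant scalar
  ones.\<close>

lemma avg_equivariant:
  assumes a: "a \<in> W" "b \<in> W" and \<rho>: "linear \<rho>"
    and eq: "\<And>K. cbody W K \<Longrightarrow> f (mirror a ` mirror b ` K) = \<rho> (f K)" and F: "cbody W F"
  shows "avg W f (mirror a (mirror b n)) (mirror a ` mirror b ` F) = \<rho> (avg W f n F)"
proof -
  let ?g = "\<lambda>x. mirror a (mirror b x)"
  let ?G = "mirror a ` mirror b ` F"
  have G: "cbody W ?G" using cbody_mirror[OF W(1)] a F by blast
  define M where "M = bnd F"
  have M: "M \<ge> 0" "\<And>x. x \<in> F \<Longrightarrow> norm x \<le> M" using bnd_props[OF F] by (auto simp: M_def)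
  have MG: "norm x \<le> M" if "x \<in> ?G" for x using that M by auto
  have lg: "linear ?g" using linear_compose[OF linear_mirror linear_mirror, of a b] by (simp add: o_def)
  have ig: "?g x \<bullet> ?g y = x \<bullet> y" for x y by (simp add: mirror_inner)
  have Gg: "?G = ?g ` F" by (simp add: image_image)
  let ?h = "\<lambda>v. indicator (annulus W) v *\<^sub>R (sgn (?g n \<bullet> dirn W v) *\<^sub>R f (shadow M (dirn W v) ?G))"
  have ih: "integrable lborel ?h" by (rule avg_integrable[OF W(1) f(4) f_empty G M(1) MG])
  have hm: "?h \<in> borel_measurable borel" using borel_measurable_integrable[OF ih] by simp
  have hm': "(\<lambda>v. ?h (mirror a v)) \<in> borel_measurable borel"
  proof -
    have "continuous_on UNIV (mirror a)" using linear_mirror linear_continuous_on linear_conv_bounded_linear by blast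
    then have "mirror a \<in> borel \<rightarrow>\<^sub>M borel" by (rule borel_measurable_continuous_onI)
    then show ?thesis using hm by (rule measurable_compose)
  qed
  have "avg W f (?g n) ?G = integral\<^sup>L lborel ?h"
    using avg_eq[OF G MG] by (simp add: avgM_def)
  also have "\<dots> = integral\<^sup>L lborel (\<lambda>v. ?h (mirror a v))" by (rule integral_mirror[OF hm, symmetric])
  also have "\<dots> = integral\<^sup>L lborel (\<lambda>v. ?h (mirror a (mirror b v)))" by (rule integral_mirror[OF hm', symmetric])
  also have "\<dots> = (\<integral>v. indicator (annulus W) v *\<^sub>R (sgn (?g n \<bullet> dirn W (?g v)) *\<^sub>R f (shadow M (dirn W (?g v)) ?G)) \<partial>lborel)"
    by (rule Bochner_Integration.integral_cong) (use a in \<open>auto simp: annulus_mirror indicator_def\<close>)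
  also have "\<dots> = (\<integral>v. indicator (annulus W) v *\<^sub>R \<rho> (sgn (n \<bullet> dirn W v) *\<^sub>R f (shadow M (dirn W v) F)) \<partial>lborel)"
  proof (rule sphere_avg_cong)
    fix v assume "v \<in> annulus W"
    then have v: "dirn W v \<in> W" "norm (dirn W v) = 1" using dirn_sphere[OF W(1)] by auto
    have d: "dirn W (?g v) = ?g (dirn W v)" using dirn_mirror a by simp
    have "shadow M (?g (dirn W v)) ?G = mirror a ` mirror b ` shadow M (dirn W v) F"
      unfolding Gg using shadow_linear[OF lg ig] by (simp add: image_image)
    then have "f (shadow M (?g (dirn W v)) ?G) = \<rho> (f (shadow M (dirn W v) F))"
      using eq cbody_shadow[OF W(1) v F M(2)] by simp
    then show "sgn (?g n \<bullet> dirn W (?g v)) *\<^sub>R f (shadow M (dirn W (?g v)) ?G) =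
        \<rho> (sgn (n \<bullet> dirn W v) *\<^sub>R f (shadow M (dirn W v) F))"
      unfolding d ig using linear_scale[OF \<rho>] by simp
  qed
  also have "\<dots> = \<rho> (avgM W f M n F)"
  proof -
    have "bounded_linear \<rho>" using \<rho> linear_conv_bounded_linear by blast
    then have "(\<integral>v. \<rho> (indicator (annulus W) v *\<^sub>R (sgn (n \<bullet> dirn W v) *\<^sub>R f (shadow M (dirn W v) F))) \<partial>lborel)
        = \<rho> (avgM W f M n F)"
      unfolding avgM_def by (rule integral_bounded_linear) (rule avg_integrable[OF W(1) f(4) f_empty F M])
    then show ?thesis using linear_scale[OF \<rho>] by simp
  qed
  finally show ?thesis by (simp add: avg_def M_def)
qed

lemma avg_facets:
  assumes S: "S \<subseteq> W" "\<not> affine_dependent S" "card S = dim W + 1"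
    and u: "\<And>s. s \<in> S \<Longrightarrow> u s \<in> W" "\<And>s. s \<in> S \<Longrightarrow> norm (u s) = 1"
    "\<And>s. s \<in> S \<Longrightarrow> h s > (0::real)" "\<And>s t. s \<in> S \<Longrightarrow> t \<in> S \<Longrightarrow> t \<noteq> s \<Longrightarrow> u s \<bullet> t = b s"
    "\<And>s. s \<in> S \<Longrightarrow> u s \<bullet> s = b s + h s"
    "convex hull S = {x\<in>W. \<forall>s\<in>S. b s \<le> u s \<bullet> x}"
    "\<And>s. s \<in> S \<Longrightarrow> convex hull (S - {s}) = {x\<in>convex hull S. u s \<bullet> x = b s}"
  shows "measure lborel (annulus W) *\<^sub>R f (convex hull S) = (\<Sum>s\<in>S. - avg W f (u s) (convex hull (S - {s})))"
proof -
  have fin: "finite S" using S(2) aff_independent_finite by blast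
  have T: "cbody W (convex hull S)" by (rule cbody_hull[OF fin S(1) W(1)])
  have Fc: "cbody W (convex hull (S - {s}))" for s by (rule cbody_hull[OF _ _ W(1)]) (use fin S in auto)
  define M where "M = bnd (convex hull S)"
  have M: "M \<ge> 0" "\<And>x. x \<in> convex hull S \<Longrightarrow> norm x \<le> M" using bnd_props[OF T] by (auto simp: M_def)
  have MF: "norm x \<le> M" if "x \<in> convex hull (S - {s})" for x s
    using M(2) that hull_mono[of "S - {s}" S convex] by blast
  let ?i = "\<lambda>s v. indicator (annulus W) v *\<^sub>R (sgn (u s \<bullet> dirn W v) *\<^sub>R f (shadow M (dirn W v) (convex hull (S - {s}))))"
  have i: "integrable lborel (?i s)" for s by (rule avg_integrable[OF W(1) f(4) f_empty Fc M(1) MF])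
  have "emeasure lborel (annulus W) < \<infinity>"
    using emeasure_bounded_finite[OF compact_imp_bounded[OF compact_annulus[OF W(1)]]] by simp
  then have "integrable lborel (indicator (annulus W) :: 'a \<Rightarrow> real)"
    using compact_annulus[OF W(1)] by (auto intro!: integrable_real_indicator simp: borel_compact)
  then have "measure lborel (annulus W) *\<^sub>R f (convex hull S) = (\<integral>v. indicator (annulus W) v *\<^sub>R f (convex hull S) \<partial>lborel)"
    by (subst integral_scaleR_left) auto
  also have "\<dots> = (\<integral>v. indicator (annulus W) v *\<^sub>R (\<Sum>s\<in>S. - (sgn (u s \<bullet> dirn W v) *\<^sub>R f (shadow M (dirn W v) (convex hull (S - {s}))))) \<partial>lborel)"
  proof (rule sphere_avg_cong)
    fix v assume "v \<in> annulus W"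
    then have v: "dirn W v \<in> W" "norm (dirn W v) = 1" using dirn_sphere[OF W(1)] by auto
    show "f (convex hull S) = (\<Sum>s\<in>S. - (sgn (u s \<bullet> dirn W v) *\<^sub>R f (shadow M (dirn W v) (convex hull (S - {s})))))"
      using facet_sum[OF W f(1,2) S u v M(2)] by simp
  qed
  also have "\<dots> = (\<integral>v. (\<Sum>s\<in>S. - ?i s v) \<partial>lborel)"
    by (simp add: scaleR_sum_right sum_negf)
  also have "\<dots> = (\<Sum>s\<in>S. \<integral>v. - ?i s v \<partial>lborel)"
    using i by (intro Bochner_Integration.integral_sum Bochner_Integration.integrable_minus)
  also have "\<dots> = (\<Sum>s\<in>S. - avg W f (u s) (convex hull (S - {s})))"
    using avg_eq[OF Fc MF] by (simp add: avgM_def)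
  finally show ?thesis .
qed

end

section \<open>Rotation invariant scalar valuations\<close>

definition msum :: "'a::euclidean_space set \<Rightarrow> 'a set \<Rightarrow> 'a set" where
  "msum A B = {a + b | a b. a \<in> A \<and> b \<in> B}"

lemma dim_pos_nonzero:
  assumes "dim (S :: 'a::euclidean_space set) > 0"
  obtains a where "a \<in> S" "a \<noteq> 0"
proof -
  have "\<not> S \<subseteq> {0}" using assms dim_eq_0[of S] by linarith
  then show ?thesis using that by blast
qed

lemma msumI: "a \<in> A \<Longrightarrow> b \<in> B \<Longrightarrow> y = a + b \<Longrightarrow> y \<in> msum A B"
  unfolding msum_def by blast

lemma msumE:
  assumes "y \<in> msum A B"
  obtains a b where "y = a + b" "a \<in> A" "b \<in> B"
  using assms unfolding msum_def by blast

lemma msum_commute: "msum A B = msum B A"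
proof -
  have "msum A B \<subseteq> msum B A" for A B :: "'a set"
    by (auto elim!: msumE intro: msumI simp: add.commute)
  then show ?thesis by blast
qed

lemma msum_empty [simp]: "msum {} B = {}" "msum A {} = {}"
  unfolding msum_def by auto

lemma msum_Un: "msum (A \<union> A') B = msum A B \<union> msum A' B"
  unfolding msum_def by blast

text \<open>The decomposition along two orthogonal subspaces is unique, so a common point of the two
  sums has the same summand in \<open>A\<close> and in \<open>A'\<close>.\<close>

lemma msum_Int:
  assumes U: "subspace U" "subspace V" "\<And>x y. x \<in> U \<Longrightarrow> y \<in> V \<Longrightarrow> x \<bullet> y = 0"
    and A: "A \<subseteq> U" "A' \<subseteq> U" "B \<subseteq> V"
  shows "msum (A \<inter> A') B = msum A B \<inter> msum A' B"
proof (intro equalityI subsetI)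
  fix z assume "z \<in> msum A B \<inter> msum A' B"
  then have zz: "z \<in> msum A B" "z \<in> msum A' B" by auto
  obtain a b where z1: "z = a + b" "a \<in> A" "b \<in> B" using zz(1) by (rule msumE)
  obtain a' b' where z2: "z = a' + b'" "a' \<in> A'" "b' \<in> B" using zz(2) by (rule msumE)
  note z = z1 z2
  have e: "a - a' = b' - b" using z(1,4) by (simp add: algebra_simps)
  have "a - a' \<in> U" by (rule subspace_diff[OF U(1)]) (use z A in auto)
  moreover have "b' - b \<in> V" by (rule subspace_diff[OF U(2)]) (use z A in auto)
  ultimately have "(a - a') \<bullet> (a - a') = 0" using U(3)[of "a - a'" "b' - b"] e by simp
  then have "a = a'" by simp
  then show "z \<in> msum (A \<inter> A') B" unfolding msum_def using z by blast
qed (auto simp: msum_def)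

lemma msum_cbody:
  assumes W: "subspace W" "U \<subseteq> W" "V \<subseteq> W" and A: "cbody U A" "cbody V B"
  shows "cbody W (msum A B)"
proof -
  have "compact (msum A B)" unfolding msum_def
    using A compact_sums[of A B] unfolding cbody_def by auto
  moreover have "convex (msum A B)"
  proof -
    have "msum A B = (\<Union>x\<in>A. \<Union>y\<in>B. {x + y})" unfolding msum_def by blast
    then show ?thesis using A convex_sums[of A B] unfolding cbody_def by simp
  qed
  moreover have "msum A B \<subseteq> W" unfolding msum_def using A W subspace_add unfolding cbody_def by blast
  ultimately show ?thesis unfolding cbody_def by blast
qed

lemma msum_translate: "msum ((+) x ` A) B = (+) x ` msum A B"
proof (intro equalityI subsetI)
  fix y assume "y \<in> msum ((+) x ` A) B"
  then obtain a b where "y = x + (a + b)" "a \<in> A" "b \<in> B" unfolding msum_def by (auto simp: add.assoc)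
  then show "y \<in> (+) x ` msum A B" unfolding msum_def by blast
next
  fix y assume "y \<in> (+) x ` msum A B"
  then obtain a b where "y = (x + a) + b" "a \<in> A" "b \<in> B" unfolding msum_def by (auto simp: add.assoc)
  then show "y \<in> msum ((+) x ` A) B" unfolding msum_def by blast
qed

lemma msum_mirror: "mirror c ` msum A B = msum (mirror c ` A) (mirror c ` B)"
proof (intro equalityI subsetI)
  fix y assume "y \<in> mirror c ` msum A B"
  then obtain a b where "y = mirror c a + mirror c b" "a \<in> A" "b \<in> B"
    unfolding msum_def by (auto simp: mirror_add)
  then show "y \<in> msum (mirror c ` A) (mirror c ` B)" unfolding msum_def by blast
next
  fix y assume "y \<in> msum (mirror c ` A) (mirror c ` B)"
  then obtain a b where "y = mirror c (a + b)" "a \<in> A" "b \<in> B"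
    unfolding msum_def by (auto simp: mirror_add)
  then show "y \<in> mirror c ` msum A B" unfolding msum_def by blast
qed

lemma near_msum:
  assumes "near d A A'"
  shows "near d (msum A B) (msum A' B)"
proof -
  have "\<exists>y\<in>msum A' B. dist x y \<le> d" if x: "x \<in> msum A B" for x
  proof -
    obtain a b where "x = a + b" "a \<in> A" "b \<in> B" using x by (rule msumE)
    moreover obtain a' where "a' \<in> A'" "dist a a' \<le> d" using assms \<open>a \<in> A\<close> unfolding near_def by blast
    ultimately show ?thesis unfolding msum_def by (intro bexI[of _ "a' + b"]) (auto simp: dist_norm)
  qed
  moreover have "\<exists>x\<in>msum A B. dist x y \<le> d" if y: "y \<in> msum A' B" for y
  proof -
    obtain a b where "y = a + b" "a \<in> A'" "b \<in> B" using y by (rule msumE)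
    moreover obtain a' where "a' \<in> A" "dist a' a \<le> d" using assms \<open>a \<in> A'\<close> unfolding near_def by blast
    ultimately show ?thesis unfolding msum_def by (intro bexI[of _ "a' + b"]) (auto simp: dist_norm)
  qed
  ultimately show ?thesis unfolding near_def by blast
qed

lemma mirror_fix_set: "(\<And>x. x \<in> B \<Longrightarrow> x \<bullet> c = 0) \<Longrightarrow> mirror c ` B = B"
  by (force simp: mirror_fix image_iff)

lemma val_msum:
  fixes f :: "'a::euclidean_space set \<Rightarrow> 'b::real_normed_vector"
  assumes W: "subspace W" and U: "subspace U" "subspace V" "U \<subseteq> W" "V \<subseteq> W" "\<And>x y. x \<in> U \<Longrightarrow> y \<in> V \<Longrightarrow> x \<bullet> y = 0"
    and B: "cbody V B" and f: "val W f"
  shows "val U (\<lambda>A. f (msum A B))"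
  unfolding val_def
proof (intro conjI allI impI)
  show "f (msum {} B) = 0" using f unfolding val_def by simp
  fix K L assume KL: "cbody U K" "cbody U L" "convex (K \<union> L)"
  have cU: "cbody U (K \<union> L)" using KL unfolding cbody_def by auto
  have "msum (K \<inter> L) B = msum K B \<inter> msum L B"
    by (rule msum_Int[OF U(1,2,5)]) (use KL B in \<open>auto simp: cbody_def\<close>)
  moreover have "convex (msum K B \<union> msum L B)"
    using msum_cbody[OF W U(3,4) cU B] unfolding msum_Un cbody_def by blast
  ultimately show "f (msum (K \<union> L) B) + f (msum (K \<inter> L) B) = f (msum K B) + f (msum L B)"
    using f msum_cbody[OF W U(3,4) KL(1) B] msum_cbody[OF W U(3,4) KL(2) B]
    unfolding val_def msum_Un by metis
qed

lemma tinv_msum: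
  assumes W: "subspace W" and U: "U \<subseteq> W" "V \<subseteq> W" and B: "cbody V B" and f: "tinv W f"
  shows "tinv U (\<lambda>A. f (msum A B))"
  unfolding tinv_def msum_translate
  using f msum_cbody[OF W U _ B] U(1) unfolding tinv_def by blast

lemma hcont_msum:
  fixes f :: "'a::euclidean_space set \<Rightarrow> 'b::real_normed_vector"
  assumes W: "subspace W" and U: "U \<subseteq> W" "V \<subseteq> W" and B: "cbody V B" "B \<noteq> {}" and f: "hcont W f"
  shows "hcont U (\<lambda>A. f (msum A B))"
  unfolding hcont_def
proof (intro allI impI)
  fix K and e :: real assume K: "cbody U K" "K \<noteq> {}" and e: "e > 0"
  have ne: "msum L B \<noteq> {}" if "L \<noteq> {}" for L using that B(2) unfolding msum_def by blast
  obtain d where d: "d > 0" "\<And>L. cbody W L \<Longrightarrow> L \<noteq> {} \<Longrightarrow> near d (msum K B) L \<Longrightarrow> norm (f L - f (msum K B)) < e"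
    using f msum_cbody[OF W U K(1) B(1)] ne[OF K(2)] e unfolding hcont_def by blast
  have "norm (f (msum L B) - f (msum K B)) < e" if "cbody U L" "L \<noteq> {}" "near d K L" for L
    by (rule d(2)[OF msum_cbody[OF W U that(1) B(1)] ne[OF that(2)] near_msum[OF that(3)]])
  then show "\<exists>d>0. \<forall>L. cbody U L \<longrightarrow> L \<noteq> {} \<longrightarrow> near d K L \<longrightarrow> norm (f (msum L B) - f (msum K B)) < e"
    using d(1) by blast
qed

lemma val_compose:
  fixes f :: "'a::euclidean_space set \<Rightarrow> 'b::real_normed_vector" and g :: "'b \<Rightarrow> 'c::real_normed_vector"
  assumes "linear g" "val W f"
  shows "val W (\<lambda>K. g (f K))"
  using assms unfolding val_def by (metis linear_0 linear_add)

lemma hcont_compose: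
  fixes f :: "'a::euclidean_space set \<Rightarrow> 'b::real_normed_vector" and g :: "'b \<Rightarrow> 'c::real_normed_vector"
  assumes g: "bounded_linear g" and f: "hcont W f"
  shows "hcont W (\<lambda>K. g (f K))"
  unfolding hcont_def
proof (intro allI impI)
  fix K and e :: real assume K: "cbody W K" "K \<noteq> {}" and e: "e > 0"
  obtain B where B: "B > 0" "\<And>x. norm (g x) \<le> norm x * B" using bounded_linear.pos_bounded[OF g] by blast
  have "e / B > 0" using e B by simp
  then obtain d where d: "d > 0" "\<And>L. cbody W L \<Longrightarrow> L \<noteq> {} \<Longrightarrow> near d K L \<Longrightarrow> norm (f L - f K) < e / B"
    using f K unfolding hcont_def by blast
  have "norm (g (f L) - g (f K)) < e" if "cbody W L" "L \<noteq> {}" "near d K L" for L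
  proof -
    have "norm (g (f L) - g (f K)) = norm (g (f L - f K))" using g by (simp add: bounded_linear.linear linear_diff)
    also have "\<dots> \<le> norm (f L - f K) * B" by (rule B(2))
    also have "\<dots> < e" using d(2)[OF that] B by (simp add: pos_less_divide_eq)
    finally show ?thesis .
  qed
  then show "\<exists>d>0. \<forall>L. cbody W L \<longrightarrow> L \<noteq> {} \<longrightarrow> near d K L \<longrightarrow> norm (g (f L) - g (f K)) < e"
    using d(1) by blast
qed

lemma tinv_compose: "tinv W f \<Longrightarrow> tinv W (\<lambda>K. g (f K))"
  unfolding tinv_def by simp

lemma simple_compose:
  fixes g :: "'b::real_vector \<Rightarrow> 'c::real_vector"
  shows "linear g \<Longrightarrow> simple W f \<Longrightarrow> simple W (\<lambda>K. g (f K))"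
  unfolding simple_def by (simp add: linear_0)

lemma bounded_linear_proj: "subspace W \<Longrightarrow> bounded_linear (proj W)"
  using linear_proj linear_conv_bounded_linear by blast

text \<open>In multiples of \<open>u\<close> the body is an interval from \<open>a\<close> to
  \<open>b\<close>, and reversing it is the translation by \<open>- (a + b)\<close>. For a
  one-dimensional factor this replaces the rotations that a line does not have.\<close>

lemma line_body_symmetric:
  fixes u :: "'a::euclidean_space"
  assumes A: "cbody (span {u}) A" "A \<noteq> {}" and u: "u \<noteq> 0"
  shows "\<exists>z\<in>span {u}. mirror u ` A = (+) z ` A"
proof -
  define T where "T = (\<lambda>x. (x \<bullet> u) / (u \<bullet> u)) ` A"
  have rep: "x = ((x \<bullet> u) / (u \<bullet> u)) *\<^sub>R u" if x: "x \<in> A" for x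
  proof -
    obtain k where "x = k *\<^sub>R u" using x A(1) unfolding cbody_def by (auto simp: span_singleton)
    then show ?thesis using u by simp
  qed
  have "compact T" unfolding T_def using A(1) u unfolding cbody_def
    by (intro compact_continuous_image continuous_intros) auto
  moreover have "connected T" unfolding T_def
    using A(1) u convex_connected unfolding cbody_def
    by (intro connected_continuous_image continuous_intros) auto
  ultimately obtain a b where T: "T = {a..b}" using connected_compact_interval_1 by blast
  have AT: "A = (\<lambda>t. t *\<^sub>R u) ` T"
    unfolding T_def image_image using rep by (auto simp: image_iff)
  have mu: "mirror u (t *\<^sub>R u) = (- t) *\<^sub>R u" for t using mirror_self[OF u] by (simp add: mirror_scale)
  have "mirror u ` A = (+) ((- (a + b)) *\<^sub>R u) ` A"
  proof -
    have "mirror u ` A = (\<lambda>t. (- t) *\<^sub>R u) ` T" unfolding AT image_image mu ..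
    also have "\<dots> = (\<lambda>t. t *\<^sub>R u) ` (uminus ` T)" by (simp add: image_image)
    also have "uminus ` T = (+) (- (a + b)) ` T" unfolding T
      by (simp add: image_uminus_atLeastAtMost)
    also have "(\<lambda>t. t *\<^sub>R u) ` ((+) (- (a + b)) ` T) = (+) ((- (a + b)) *\<^sub>R u) ` A"
      unfolding AT image_image by (simp only: scaleR_left_distrib)
    finally show ?thesis .
  qed
  moreover have "(- (a + b)) *\<^sub>R u \<in> span {u}" by (intro span_scale span_base) simp
  ultimately show ?thesis by blast
qed

text \<open>Products of two reflections generate the rotations of \<open>W\<close>, so this amounts
  to equivariance under all of them; on a line it is no condition.\<close>

definition equivariant :: "'a::euclidean_space set \<Rightarrow> ('a set \<Rightarrow> 'a) \<Rightarrow> bool" where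
  "equivariant W f \<longleftrightarrow> (\<forall>a\<in>W. \<forall>b\<in>W. a \<noteq> 0 \<longrightarrow> b \<noteq> 0 \<longrightarrow> (\<forall>K. cbody W K \<longrightarrow>
     f (mirror a ` mirror b ` K) = mirror a (mirror b (f K))))"

definition rot_invariant :: "'a::euclidean_space set \<Rightarrow> ('a set \<Rightarrow> 'b) \<Rightarrow> bool" where
  "rot_invariant W f \<longleftrightarrow> (\<forall>a\<in>W. \<forall>b\<in>W. a \<noteq> 0 \<longrightarrow> b \<noteq> 0 \<longrightarrow> (\<forall>K. cbody W K \<longrightarrow>
     f (mirror a ` mirror b ` K) = f K))"

lemma hyperplane_translate:
  assumes W: "subspace W" and F: "cbody W F" "\<And>x. x \<in> F \<Longrightarrow> n \<bullet> x = b"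
  shows "\<exists>z\<in>W. cbody {x\<in>W. x \<bullet> n = 0} ((+) z ` F)"
proof (cases "F = {}")
  case True
  then show ?thesis using subspace_0[OF W] by (intro bexI[of _ 0]) (auto simp: cbody_def)
next
  case False
  then obtain x0 where x0: "x0 \<in> F" by blast
  have z: "- x0 \<in> W" using x0 F(1) W subspace_neg unfolding cbody_def by blast
  have "cbody W ((+) (- x0) ` F)" by (rule cbody_translate[OF W z F(1)])
  moreover have "x \<bullet> n = 0" if x: "x \<in> (+) (- x0) ` F" for x
  proof -
    obtain y where y: "y \<in> F" "x = - x0 + y" using x by blast
    then have "n \<bullet> x = 0" using F(2)[OF y(1)] F(2)[OF x0] by (simp add: inner_diff_right)
    then show ?thesis by (simp add: inner_commute)
  qed
  ultimately have "cbody {x\<in>W. x \<bullet> n = 0} ((+) (- x0) ` F)" unfolding cbody_def by blast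
  then show ?thesis using z by blast
qed

text \<open>Pairing the sum over facets in \<open>avg_facets\<close> with the value on the simplex
  gives a positive multiple of the squared norm of that value. It is therefore enough that the
  averages are orthogonal to a set \<open>Z\<close> containing the values of \<open>f\<close>,
  without locating the averages themselves.\<close>

lemma (in cyl_val) zero_of_avg:
  assumes avg0: "\<And>n F w. n \<in> W \<Longrightarrow> n \<noteq> 0 \<Longrightarrow> cbody {x\<in>W. x \<bullet> n = 0} F \<Longrightarrow> w \<in> Z \<Longrightarrow> avg W f n F \<bullet> w = 0"
    and Z: "\<And>K. cbody W K \<Longrightarrow> f K \<in> Z" and K: "cbody W K"
  shows "f K = 0"
proof (rule zero_of_simplices[OF W f(1,2,4) _ K])
  fix S assume S: "S \<subseteq> W" "\<not> affine_dependent S" "card S = dim W + 1"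
  have fin: "finite S" using S(2) aff_independent_finite by blast
  obtain u b h where u: "\<And>s. s \<in> S \<Longrightarrow> u s \<in> W" "\<And>s. s \<in> S \<Longrightarrow> norm (u s) = 1"
    "\<And>s. s \<in> S \<Longrightarrow> h s > (0::real)" "\<And>s t. s \<in> S \<Longrightarrow> t \<in> S \<Longrightarrow> t \<noteq> s \<Longrightarrow> u s \<bullet> t = b s"
    "\<And>s. s \<in> S \<Longrightarrow> u s \<bullet> s = b s + h s"
    "convex hull S = {x\<in>W. \<forall>s\<in>S. b s \<le> u s \<bullet> x}"
    "\<And>s. s \<in> S \<Longrightarrow> convex hull (S - {s}) = {x\<in>convex hull S. u s \<bullet> x = b s}"
    by (rule simplex_halfspaces[OF W S]) (rule that)
  have T: "cbody W (convex hull S)" by (rule cbody_hull[OF fin S(1) W(1)])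
  have "avg W f (u s) (convex hull (S - {s})) \<bullet> w = 0" if s: "s \<in> S" and w: "w \<in> Z" for s w
  proof -
    have F: "cbody W (convex hull (S - {s}))" by (rule cbody_hull[OF _ _ W(1)]) (use fin S in auto)
    obtain z where z: "z \<in> W" "cbody {x\<in>W. x \<bullet> u s = 0} ((+) z ` (convex hull (S - {s})))"
      using hyperplane_translate[OF W(1) F, of "u s" "b s"] u(7)[OF s] by blast
    have "u s \<noteq> 0" using u(2)[OF s] by auto
    then show ?thesis using avg0[OF u(1)[OF s] _ z(2) w] avg_tinv[OF F z(1)] by simp
  qed
  then have "(\<Sum>s\<in>S. - avg W f (u s) (convex hull (S - {s}))) \<bullet> f (convex hull S) = 0"
    using Z[OF T] by (simp add: inner_sum_left)
  moreover have "measure lborel (annulus W) *\<^sub>R f (convex hull S) = (\<Sum>s\<in>S. - avg W f (u s) (convex hull (S - {s})))"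
    by (rule avg_facets[OF S u])
  ultimately have "(measure lborel (annulus W) *\<^sub>R f (convex hull S)) \<bullet> f (convex hull S) = 0" by simp
  then show "f (convex hull S) = 0" using measure_annulus[OF W] by simp
qed

lemma mirror_pair_normal:
  "n \<noteq> 0 \<Longrightarrow> v \<bullet> n = 0 \<Longrightarrow> mirror n (mirror v n) = - n"
  by (simp add: mirror_fix inner_commute mirror_self)

text \<open>A product of two reflections, one in the normal \<open>n\<close> and one within its hyperplane, reverses
  \<open>n\<close>; so \<open>avg W f n\<close> is odd under the reflections of that hyperplane.\<close>

theorem rot_invariant_zero:
  fixes f :: "'a::euclidean_space set \<Rightarrow> real"
  assumes W: "subspace W" "dim W > 1" and f: "val W f" "simple W f" "tinv W f" "hcont W f" "cyl_zero W f"
    and inv: "rot_invariant W f" and K: "cbody W K"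
  shows "f K = 0"
proof -
  interpret cv: cyl_val W f by unfold_locales (use W f in auto)
  have "avg W f n F = 0" if n: "n \<in> W" "n \<noteq> 0" and F: "cbody {x\<in>W. x \<bullet> n = 0} F" for n F
  proof -
    let ?H = "{x\<in>W. x \<bullet> n = 0}"
    note H = dim_hyperplane_in[OF W(1) n]
    have cW: "cbody W K" if "cbody ?H K" for K using that unfolding cbody_def by blast
    have "avg W f n (mirror v ` K) = - avg W f n K" if v: "v \<in> ?H" "v \<noteq> 0" and K: "cbody ?H K" for v K
    proof -
      have vW: "v \<in> W" "v \<bullet> n = 0" using v by auto
      have "avg W f (mirror n (mirror v n)) (mirror n ` mirror v ` K) = avg W f n K"
        by (rule cv.avg_equivariant[OF n(1) vW(1) linear_id[unfolded id_def] _ cW[OF K]])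
          (use inv n vW v in \<open>auto simp: rot_invariant_def\<close>)
      \<comment> \<open>The body lies in the hyperplane, so the reflection in that hyperplane does
        not move it.\<close>
      moreover have "mirror n ` mirror v ` K = mirror v ` K"
      proof (rule mirror_fix_set)
        fix x assume "x \<in> mirror v ` K"
        then obtain y where y: "y \<in> K" "x = mirror v y" by blast
        have "x \<bullet> n = mirror v y \<bullet> mirror v n" using y vW by (simp add: mirror_fix inner_commute)
        also have "\<dots> = 0" using y(1) K unfolding mirror_inner cbody_def by blast
        finally show "x \<bullet> n = 0" .
      qed
      ultimately show ?thesis using mirror_pair_normal[OF n(2) vW(2)] cv.avg_odd[of n] by simp
    qed
    moreover have "tinv ?H (avg W f n)" unfolding tinv_def using cv.avg_tinv cW by blast
    moreover have "dim ?H > 0" using H(2) W(2) by simp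
    ultimately show ?thesis
      using odd_valuation_zero[OF H(1) _ cv.avg_val[OF n] _ cv.avg_hcont[OF n(1)] _ F] by blast
  qed
  then show ?thesis using cv.zero_of_avg[of UNIV K] K by simp
qed

lemma cylinder_add:
  fixes g :: "'a::euclidean_space set \<Rightarrow> real"
  assumes H: "subspace H" and g: "val H g" "simple H g" "tinv H g"
    and e: "e \<in> H" "norm e = 1" and A: "cbody H A" "\<And>x. x \<in> A \<Longrightarrow> x \<bullet> e = 0" and h: "0 \<le> h" "0 \<le> h'"
  defines "C \<equiv> \<lambda>A h. {a + t *\<^sub>R e | a t. a \<in> A \<and> 0 \<le> t \<and> t \<le> h}"
  shows "g (C A (h + h')) = g (C A h) + g (C A h')" "cbody H (C A h)"
proof -
  have ee: "e \<bullet> e = 1" "e \<noteq> 0" using e by (auto simp: norm_eq_1)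
  have cb: "cbody H (C A h)" if "0 \<le> h" for h
  proof -
    have B: "cbody H ((\<lambda>t. t *\<^sub>R e) ` {0..h})" unfolding cbody_def
    proof (intro conjI)
      show "compact ((\<lambda>t. t *\<^sub>R e) ` {0..h})" by (intro compact_continuous_image continuous_intros) simp
      have "linear (\<lambda>t::real. t *\<^sub>R e)" by (rule linearI) (auto simp: algebra_simps)
      then show "convex ((\<lambda>t. t *\<^sub>R e) ` {0..h})" by (rule convex_linear_image) simp
      show "(\<lambda>t. t *\<^sub>R e) ` {0..h} \<subseteq> H" using e H by (auto simp: subspace_scale)
    qed
    have "C A h = msum A ((\<lambda>t. t *\<^sub>R e) ` {0..h})"
    proof (intro equalityI subsetI)
      fix y assume "y \<in> C A h"
      then obtain a t where "y = a + t *\<^sub>R e" "a \<in> A" "t \<in> {0..h}" unfolding C_def by auto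
      then show "y \<in> msum A ((\<lambda>t. t *\<^sub>R e) ` {0..h})" unfolding msum_def by blast
    next
      fix y assume "y \<in> msum A ((\<lambda>t. t *\<^sub>R e) ` {0..h})"
      then obtain a t where "y = a + t *\<^sub>R e" "a \<in> A" "t \<in> {0..h}" unfolding msum_def by blast
      then show "y \<in> C A h" unfolding C_def by auto
    qed
    then show ?thesis using msum_cbody[OF H order_refl order_refl A(1) B] by simp
  qed
  show "cbody H (C A h)" by (rule cb[OF h(1)])
  have lev: "e \<bullet> (a + t *\<^sub>R e) = t" if "a \<in> A" for a t
    using A(2)[OF that] ee by (simp add: inner_add_right inner_commute)
  have 1: "C A (h + h') \<inter> {x. e \<bullet> x \<le> h} = C A h"
  proof (intro equalityI subsetI)
    fix y assume y: "y \<in> C A (h + h') \<inter> {x. e \<bullet> x \<le> h}"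
    then obtain a t where a: "y = a + t *\<^sub>R e" "a \<in> A" "0 \<le> t" unfolding C_def by blast
    then show "y \<in> C A h" using y lev[OF a(2), of t] unfolding C_def by auto
  next
    fix y assume y: "y \<in> C A h"
    then obtain a t where a: "y = a + t *\<^sub>R e" "a \<in> A" "0 \<le> t" "t \<le> h" unfolding C_def by blast
    moreover have "t \<le> h + h'" using a h by simp
    ultimately have "y \<in> C A (h + h')" unfolding C_def by blast
    then show "y \<in> C A (h + h') \<inter> {x. e \<bullet> x \<le> h}" using lev[OF a(2), of t] a(1,4) by simp
  qed
  have 2: "C A (h + h') \<inter> {x. e \<bullet> x \<ge> h} = (+) (h *\<^sub>R e) ` C A h'"
  proof (intro equalityI subsetI)
    fix y assume y: "y \<in> C A (h + h') \<inter> {x. e \<bullet> x \<ge> h}"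
    then obtain a t where a: "y = a + t *\<^sub>R e" "a \<in> A" "t \<le> h + h'" unfolding C_def by blast
    have "h \<le> t" using y lev[OF a(2), of t] a(1) by simp
    then have "a + (t - h) *\<^sub>R e \<in> C A h'" unfolding C_def using a by (intro CollectI exI[of _ a] exI[of _ "t - h"]) auto
    moreover have "y = h *\<^sub>R e + (a + (t - h) *\<^sub>R e)" unfolding a(1) by (simp add: algebra_simps)
    ultimately show "y \<in> (+) (h *\<^sub>R e) ` C A h'" by blast
  next
    fix y assume "y \<in> (+) (h *\<^sub>R e) ` C A h'"
    then obtain a t where a: "y = h *\<^sub>R e + (a + t *\<^sub>R e)" "a \<in> A" "0 \<le> t" "t \<le> h'" unfolding C_def by blast
    have y: "y = a + (h + t) *\<^sub>R e" unfolding a(1) by (simp add: algebra_simps)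
    have "0 \<le> h + t" "h + t \<le> h + h'" using a h by auto
    then have "y \<in> C A (h + h')" unfolding C_def using y a(2) by blast
    then show "y \<in> C A (h + h') \<inter> {x. e \<bullet> x \<ge> h}" using lev[OF a(2), of "h + t"] y a(3) by auto
  qed
  have "g (C A (h + h')) = g (C A (h + h') \<inter> {x. e \<bullet> x \<le> h}) + g (C A (h + h') \<inter> {x. e \<bullet> x \<ge> h})"
    by (rule val_cut[OF g(1,2) cb e(1) ee(2)]) (use h in simp)
  then show "g (C A (h + h')) = g (C A h) + g (C A h')"
    unfolding 1 2 using g(3)[unfolded tinv_def, rule_format, OF cb[OF h(2)] subspace_scale[OF H e(1)]] by simp
qed

text \<open>The value on a cylinder is additive in the height, hence by homogeneity it does not change when the
  base is scaled by \<open>1 / m\<close>; letting the base shrink to a point, it is the value on a segment.\<close>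

lemma homogeneous_cyl_zero:
  fixes g :: "'a::euclidean_space set \<Rightarrow> real"
  assumes H: "subspace H" "dim H > 1" and g: "val H g" "simple H g" "tinv H g" "hcont H g"
    and hom: "\<And>m K. m > 0 \<Longrightarrow> cbody H K \<Longrightarrow> g ((*\<^sub>R) (real m) ` K) = real m * g K"
  shows "cyl_zero H g"
  unfolding cyl_zero_def
proof (intro allI impI)
  fix e A and h :: real
  assume e: "e \<in> H" "norm e = 1" and A: "cbody H A" "\<forall>x\<in>A. x \<bullet> e = 0" and h: "0 \<le> h"
  define C where "C A h = {a + t *\<^sub>R e | a t. a \<in> A \<and> 0 \<le> t \<and> t \<le> h}" for A :: "'a set" and h
  have ee: "e \<noteq> 0" using e by auto
  have A0: "x \<bullet> e = 0" if "x \<in> A" for x using A(2) that by blast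
  have mult: "g (C B (real m * h)) = real m * g (C B h)" if B: "cbody H B" "\<And>x. x \<in> B \<Longrightarrow> x \<bullet> e = 0" and m: "m > 0" for m B
    using m
  proof (induction m)
    case (Suc m)
    show ?case
    proof (cases "m = 0")
      case False
      have "g (C B (real m * h + h)) = g (C B (real m * h)) + g (C B h)"
        unfolding C_def by (rule cylinder_add(1)[OF H(1) g(1,2,3) e B]) (use h in auto)
      then show ?thesis using Suc False by (simp add: algebra_simps)
    qed simp
  qed simp
  have shrink: "g (C ((*\<^sub>R) (1 / real m) ` A) h) = g (C A h)" if m: "m > 0" for m
  proof -
    let ?A = "(*\<^sub>R) (1 / real m) ` A"
    have cA: "cbody H ?A" by (rule scale_cbody[OF H(1) A(1)])
    have oA: "x \<bullet> e = 0" if "x \<in> ?A" for x using that A0 by auto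
    have "(*\<^sub>R) (real m) ` C ?A h = C A (real m * h)"
    proof (intro equalityI subsetI)
      fix y assume "y \<in> (*\<^sub>R) (real m) ` C ?A h"
      then obtain a t where a: "y = real m *\<^sub>R ((1 / real m) *\<^sub>R a + t *\<^sub>R e)" "a \<in> A" "0 \<le> t" "t \<le> h"
        unfolding C_def by blast
      have "y = a + (real m * t) *\<^sub>R e" unfolding a(1) using m by (simp add: scaleR_right_distrib)
      moreover have "0 \<le> real m * t" "real m * t \<le> real m * h" using a by (auto simp: mult_left_mono)
      ultimately show "y \<in> C A (real m * h)" unfolding C_def using a(2) by blast
    next
      fix y assume "y \<in> C A (real m * h)"
      then obtain a t where a: "y = a + t *\<^sub>R e" "a \<in> A" "0 \<le> t" "t \<le> real m * h" unfolding C_def by blast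
      have "y = real m *\<^sub>R ((1 / real m) *\<^sub>R a + (t / real m) *\<^sub>R e)" unfolding a(1) using m by (simp add: scaleR_right_distrib)
      moreover have "0 \<le> t / real m" "t / real m \<le> h" using a m by (auto simp: field_simps)
      ultimately show "y \<in> (*\<^sub>R) (real m) ` C ?A h" unfolding C_def using a(2) by blast
    qed
    then have "real m * g (C ?A h) = g (C A (real m * h))"
      using hom[OF m, of "C ?A h"] cylinder_add(2)[OF H(1) g(1,2,3) e cA oA h h] unfolding C_def by simp
    then show ?thesis using mult[OF A(1) A0 m] m by simp
  qed
  let ?Z = "C {0} h"
  have Z: "cbody H ?Z" unfolding C_def
    by (rule cylinder_add(2)[OF H(1) g(1,2,3) e _ _ h h]) (use subspace_0[OF H(1)] in \<open>auto simp: cbody_def\<close>)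
  \<comment> \<open>The dimension exceeds \<open>1\<close>, so \<open>H\<close> contains a nonzero
    vector orthogonal to \<open>e\<close>, and it is a normal for the segment.\<close>
  have "thin H ?Z"
  proof -
    note hp = dim_hyperplane_in[OF H(1) e(1) ee]
    have "dim {x\<in>H. x \<bullet> e = 0} > 0" using hp(2) H(2) by simp
    then obtain a where "a \<in> {x\<in>H. x \<bullet> e = 0}" "a \<noteq> 0" by (rule dim_pos_nonzero)
    then have "a \<in> H \<and> a \<noteq> 0 \<and> (\<forall>x\<in>?Z. a \<bullet> x = 0)" unfolding C_def by auto
    then show ?thesis unfolding thin_def by blast
  qed
  then have Z0: "g ?Z = 0" using g(2) Z unfolding simple_def by blast
  show "g {a + t *\<^sub>R e | a t. a \<in> A \<and> 0 \<le> t \<and> t \<le> h} = 0"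
  proof (cases "A = {}")
    case True
    then show ?thesis using g(1) unfolding val_def by simp
  next
    case False
    have "\<bar>g (C A h)\<bar> < \<epsilon>" if \<epsilon>: "\<epsilon> > 0" for \<epsilon>
    proof -
      have "?Z \<noteq> {}" unfolding C_def using h by blast
      then obtain d where d: "d > 0" "\<And>L. cbody H L \<Longrightarrow> L \<noteq> {} \<Longrightarrow> near d ?Z L \<Longrightarrow> norm (g L - g ?Z) < \<epsilon>"
        using g(4) Z \<epsilon> unfolding hcont_def by blast
      define M where "M = bnd A"
      have M: "M \<ge> 0" "\<And>x. x \<in> A \<Longrightarrow> norm x \<le> M" using bnd_props[OF A(1)] by (auto simp: M_def)
      \<comment> \<open>Large enough for the base scaled by \<open>1 / m\<close> to lie within
        \<open>d\<close> of the origin.\<close>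
      obtain m :: nat where m: "real m > M / d" using reals_Archimedean2 by blast
      then have m0: "m > 0" using M d by (metis divide_nonneg_pos gr0I not_le of_nat_0)
      let ?A = "(*\<^sub>R) (1 / real m) ` A"
      have cA: "cbody H ?A" by (rule scale_cbody[OF H(1) A(1)])
      have oA: "x \<bullet> e = 0" if "x \<in> ?A" for x using that A0 by auto
      have small: "norm x \<le> d" if x: "x \<in> ?A" for x
      proof -
        obtain a where a: "a \<in> A" "x = (1 / real m) *\<^sub>R a" using x by blast
        have "norm x = norm a / real m" using a m0 by simp
        also have "\<dots> \<le> M / real m" using M(2)[OF a(1)] by (simp add: divide_right_mono)
        also have "\<dots> \<le> d" using m m0 d by (simp add: field_simps)
        finally show ?thesis .
      qed
      have "near d ?Z (C ?A h)" unfolding near_def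
      proof (intro conjI ballI)
        fix x assume "x \<in> ?Z"
        then obtain t where t: "x = t *\<^sub>R e" "0 \<le> t" "t \<le> h" unfolding C_def by auto
        obtain a where a: "a \<in> ?A" using False by blast
        then have "a + t *\<^sub>R e \<in> C ?A h" unfolding C_def using t by blast
        then show "\<exists>y\<in>C ?A h. dist x y \<le> d" using small[OF a] t by (intro bexI) (auto simp: dist_norm)
      next
        fix y assume "y \<in> C ?A h"
        then obtain a t where a: "y = a + t *\<^sub>R e" "a \<in> ?A" "0 \<le> t" "t \<le> h" unfolding C_def by blast
        then have "0 + t *\<^sub>R e \<in> ?Z" unfolding C_def by blast
        then show "\<exists>x\<in>?Z. dist x y \<le> d" using small[OF a(2)] a(1) by (intro bexI) (auto simp: dist_norm)
      qed
      moreover have "cbody H (C ?A h)" using cylinder_add(2)[OF H(1) g(1,2,3) e cA oA h h] unfolding C_def .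
      moreover have "C ?A h \<noteq> {}" using False h unfolding C_def by blast
      ultimately have "norm (g (C ?A h) - g ?Z) < \<epsilon>" using d(2) by blast
      then show ?thesis using shrink[OF m0] Z0 by simp
    qed
    then have "\<bar>g (C A h)\<bar> \<le> 0" by (meson less_irrefl not_le)
    then show ?thesis unfolding C_def by simp
  qed
qed

section \<open>Equivariant vector valuations\<close>

lemma mirror_adjoint: "mirror a x \<bullet> y = x \<bullet> mirror a y"
  using mirror_inner[of a x "mirror a y"] by simp

lemma span_single_eq:
  fixes u :: "'a::euclidean_space"
  assumes U: "subspace U" "dim U = 1" and u: "u \<in> U" "u \<noteq> 0"
  shows "U = span {u}"
proof -
  have "span {u} \<subseteq> U" using U u by (simp add: span_minimal)
  moreover have "dim (span {u}) = 1" using u(2) by (simp add: dim_span)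
  ultimately show ?thesis using subspace_dim_equal[of "span {u}" U] U by simp
qed

text \<open>A predicate rather than a locale, since the induction on the dimension quantifies over
  subspaces and over the valuations derived from \<open>f\<close> on them.\<close>

definition eq_val :: "'a::euclidean_space set \<Rightarrow> ('a set \<Rightarrow> 'a) \<Rightarrow> bool" where
  "eq_val W f \<longleftrightarrow> subspace W \<and> val W f \<and> tinv W f \<and> hcont W f \<and> equivariant W f \<and>
     (\<forall>K. cbody W K \<longrightarrow> f K \<in> W)"

text \<open>If \<open>dim U > 1\<close>, freezing \<open>B\<close> gives an equivariant valuation on
  \<open>U\<close>, because reflections with normals in \<open>U\<close> fix \<open>B\<close>, and
  the induction hypothesis applies. If \<open>U\<close> is a line there are no rotations to exploit;
  then \<open>A\<close> is frozen instead, and the component along \<open>u\<close> is odd under the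
  reflections of \<open>V\<close>, so \<open>odd_valuation_zero\<close> applies.\<close>

lemma proj_product_zero:
  fixes f :: "'a::euclidean_space set \<Rightarrow> 'a"
  assumes f: "eq_val W f"
    and IH: "\<And>U g K. eq_val U g \<Longrightarrow> dim U < dim W \<Longrightarrow> dim U > 1 \<Longrightarrow> cbody U K \<Longrightarrow> g K = (0::'a)"
    and U: "subspace U" "subspace V" "U \<subseteq> W" "V \<subseteq> W" "dim U > 0" "dim V > 0" "dim U + dim V = dim W"
      "\<And>x y. x \<in> U \<Longrightarrow> y \<in> V \<Longrightarrow> x \<bullet> y = 0"
    and A: "cbody U A" and B: "cbody V B"
  shows "proj U (f (msum A B)) = 0"
proof (cases "A = {} \<or> B = {}")
  case True
  then have "f (msum A B) = 0" using f unfolding eq_val_def val_def by auto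
  then show ?thesis using linear_0[OF linear_proj[OF U(1)]] by simp
next
  case False
  have W: "subspace W" "val W f" "tinv W f" "hcont W f" and eqv: "equivariant W f" using f unfolding eq_val_def by auto
  have VU: "y \<bullet> x = 0" if "x \<in> U" "y \<in> V" for x y using U(8)[OF that] by (simp add: inner_commute)
  show ?thesis
  proof (cases "dim U > 1")
    case True
    have "eq_val U (\<lambda>A. proj U (f (msum A B)))"
      unfolding eq_val_def
    proof (intro conjI allI impI)
      show "subspace U" by (rule U(1))
      show "val U (\<lambda>A. proj U (f (msum A B)))"
        by (rule val_compose[OF linear_proj[OF U(1)] val_msum[OF W(1) U(1-4) U(8) B W(2)]])
      show "tinv U (\<lambda>A. proj U (f (msum A B)))"
        by (rule tinv_compose[OF tinv_msum[OF W(1) U(3,4) B W(3)]])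
      show "hcont U (\<lambda>A. proj U (f (msum A B)))"
        by (rule hcont_compose[OF bounded_linear_proj[OF U(1)] hcont_msum[OF W(1) U(3,4) B _ W(4)]])
          (use False in auto)
      show "proj U (f (msum A B)) \<in> U" for A by (rule proj_props(1)[OF U(1)])
      show "equivariant U (\<lambda>A. proj U (f (msum A B)))"
        unfolding equivariant_def
      proof (intro ballI impI allI)
        fix a b K assume ab: "a \<in> U" "b \<in> U" "a \<noteq> 0" "b \<noteq> 0" and K: "cbody U K"
        have fixB: "mirror c ` B = B" if "c \<in> U" for c
          by (rule mirror_fix_set) (use VU[OF that] B in \<open>auto simp: cbody_def\<close>)
        have "msum (mirror a ` mirror b ` K) B = mirror a ` mirror b ` msum K B"
          unfolding msum_mirror fixB[OF ab(2)] fixB[OF ab(1)] ..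
        moreover have "cbody W (msum K B)" by (rule msum_cbody[OF W(1) U(3,4) K B])
        ultimately have "f (msum (mirror a ` mirror b ` K) B) = mirror a (mirror b (f (msum K B)))"
          using eqv[unfolded equivariant_def, rule_format, OF subsetD[OF U(3) ab(1)] subsetD[OF U(3) ab(2)] ab(3,4)] by simp
        then show "proj U (f (msum (mirror a ` mirror b ` K) B)) = mirror a (mirror b (proj U (f (msum K B))))"
          using proj_mirror[OF U(1) ab(1)] proj_mirror[OF U(1) ab(2)] by simp
      qed
    qed
    then show ?thesis by (rule IH[OF _ _ True A]) (use U in simp)
  next
    case dim1: False
    obtain u where u: "u \<in> U" "u \<noteq> 0" using U(5) by (rule dim_pos_nonzero)
    have Us: "U = span {u}" using span_single_eq[OF U(1) _ u] dim1 U(5) by simp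
    have vm: "val V (\<lambda>B. f (msum A B))"
      using val_msum[OF W(1) U(2,1,4,3) VU A W(2)] by (simp add: msum_commute[of _ A])
    have tm: "tinv V (\<lambda>B. f (msum A B))"
      using tinv_msum[OF W(1) U(4,3) A W(3)] by (simp add: msum_commute[of _ A])
    have hm: "hcont V (\<lambda>B. f (msum A B))"
      using hcont_msum[OF W(1) U(4,3) A _ W(4)] False by (simp add: msum_commute[of _ A])
    have "f (msum A B) \<bullet> u = 0"
    proof (rule odd_valuation_zero[OF U(2,6) _ _ _ _ B])
      show "val V (\<lambda>B. f (msum A B) \<bullet> u)"
        by (rule val_compose[OF _ vm]) (rule bounded_linear.linear[OF bounded_linear_inner_left])
      show "tinv V (\<lambda>B. f (msum A B) \<bullet> u)" by (rule tinv_compose[OF tm])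
      show "hcont V (\<lambda>B. f (msum A B) \<bullet> u)" by (rule hcont_compose[OF bounded_linear_inner_left hm])
      fix w K assume w: "w \<in> V" "w \<noteq> 0" and K: "cbody V K"
      let ?K = "mirror w ` K"
      have cK: "cbody V ?K" by (rule cbody_mirror[OF U(2) w(1) K])
      obtain z where z: "z \<in> U" "mirror u ` A = (+) z ` A"
        using line_body_symmetric[of u A] A False u(2) Us by auto
      have wA: "mirror w ` A = A" by (rule mirror_fix_set) (use U(8) w(1) A in \<open>auto simp: cbody_def\<close>)
      have uK: "mirror u ` ?K = ?K" by (rule mirror_fix_set) (use VU[OF u(1)] cK in \<open>auto simp: cbody_def\<close>)
      \<comment> \<open>The rotation composed of \<open>mirror w\<close> and \<open>mirror u\<close>
        reflects \<open>K\<close> and merely translates \<open>A\<close>, while it reverses the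
        component along \<open>u\<close>.\<close>
      have "mirror u ` mirror w ` msum A K = (+) z ` msum A ?K"
        unfolding msum_mirror wA uK z(2) msum_translate ..
      moreover have "f (mirror u ` mirror w ` msum A K) = mirror u (mirror w (f (msum A K)))"
        using eqv u w U(3,4) msum_cbody[OF W(1) U(3,4) A K] unfolding equivariant_def by blast
      moreover have "f ((+) z ` msum A ?K) = f (msum A ?K)"
        using W(3) msum_cbody[OF W(1) U(3,4) A cK] z(1) U(3) unfolding tinv_def by blast
      ultimately have "f (msum A ?K) = mirror u (mirror w (f (msum A K)))" by simp
      then have "f (msum A ?K) \<bullet> u = f (msum A K) \<bullet> mirror w (mirror u u)" by (simp add: mirror_adjoint)
      also have "mirror w (mirror u u) = - u"
        using mirror_self[OF u(2)] mirror_fix[OF U(8)[OF u(1) w(1)]] linear_neg[OF linear_mirror[of w]] by simp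
      finally show "f (msum A ?K) \<bullet> u = - (f (msum A K) \<bullet> u)" by simp
    qed
    then have "proj U (f (msum A B)) = 0"
      by (intro proj_unique[OF U(1)]) (auto simp: Us span_singleton intro: span_zero)
    then show ?thesis .
  qed
qed

text \<open>The value lies in \<open>W\<close>, which a dimension count identifies with the sum of
  \<open>U\<close> and \<open>V\<close>; its projections onto both vanish by
  \<open>proj_product_zero\<close>, the second time with the factors exchanged.\<close>

lemma eq_val_prod_zero:
  fixes f :: "'a::euclidean_space set \<Rightarrow> 'a"
  assumes f: "eq_val W f"
    and IH: "\<And>U g K. eq_val U g \<Longrightarrow> dim U < dim W \<Longrightarrow> dim U > 1 \<Longrightarrow> cbody U K \<Longrightarrow> g K = (0::'a)"
  shows "prod_zero W f"
  unfolding prod_zero_def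
proof (intro allI impI)
  fix U V A B
  assume U: "subspace U" "subspace V" "U \<subseteq> W" "V \<subseteq> W" "dim U > 0" "dim V > 0" "dim U + dim V = dim W"
    and o: "\<forall>x\<in>U. \<forall>y\<in>V. x \<bullet> y = 0" and A: "cbody U A" and B: "cbody V B"
  have W: "subspace W" using f unfolding eq_val_def by blast
  let ?y = "f (msum A B)"
  have yW: "?y \<in> W" using f msum_cbody[OF W U(3,4) A B] unfolding eq_val_def by blast
  have pU: "proj U ?y = 0"
    by (rule proj_product_zero[where W = W and U = U and V = V and f = f and A = A and B = B])
      (fact f, erule (3) IH, use U o A B in auto)
  have o': "y \<bullet> x = 0" if "x \<in> U" "y \<in> V" for x y using o that by (simp add: inner_commute)
  have pV: "proj V (f (msum B A)) = 0"
    by (rule proj_product_zero[where W = W and U = V and V = U and f = f and A = B and B = A])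
      (fact f, erule (3) IH, use U o' A B in auto)
  have yU: "?y \<bullet> x = 0" if "x \<in> U" for x using proj_props(2)[OF U(1) that, of ?y] pU by simp
  have yV: "?y \<bullet> x = 0" if "x \<in> V" for x
    using proj_props(2)[OF U(2) that, of ?y] pV by (simp add: msum_commute[of B A])
  have "U \<inter> V \<subseteq> {0}"
  proof
    fix x assume "x \<in> U \<inter> V"
    then have "x \<bullet> x = 0" using o by blast
    then show "x \<in> {0}" by simp
  qed
  then have "dim (U \<inter> V) = 0" by (simp only: dim_eq_0)
  then have d: "dim {x + y | x y. x \<in> U \<and> y \<in> V} = dim W"
    using dim_sums_Int[OF U(1,2)] U(7) by linarith
  have sub: "{x + y | x y. x \<in> U \<and> y \<in> V} \<subseteq> W" using U(3,4) W subspace_add by blast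
  have "{x + y | x y. x \<in> U \<and> y \<in> V} = W"
    by (rule subspace_dim_equal[OF subspace_sums[OF U(1,2)] W sub]) (use d in simp)
  then obtain x y where "?y = x + y" "x \<in> U" "y \<in> V" using yW by blast
  then have "?y \<bullet> ?y = 0" using yU yV by (metis add.right_neutral inner_add_right)
  then show "f {a + b | a b. a \<in> A \<and> b \<in> B} = 0" unfolding msum_def by simp
qed

text \<open>Applying \<open>hom\<close> to numerator and denominator gives rational factors, and
  continuity gives the others. Real factors are wanted in the plane, where edges are rescaled to
  unit length.\<close>

lemma real_homogeneous:
  fixes f :: "'a::euclidean_space set \<Rightarrow> 'b::real_normed_vector"
  assumes W: "subspace W" and f: "hcont W f" "f {} = 0"
    and hom: "\<And>m K. m > 0 \<Longrightarrow> cbody W K \<Longrightarrow> f ((*\<^sub>R) (real m) ` K) = real m *\<^sub>R f K"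
    and c: "c > 0" and K: "cbody W K"
  shows "f ((*\<^sub>R) c ` K) = c *\<^sub>R f K"
proof (cases "K = {}")
  case True then show ?thesis using f(2) by simp
next
  case False
  have rat: "f ((*\<^sub>R) (real p / real q) ` K) = (real p / real q) *\<^sub>R f K" if "p > 0" "q > 0" for p q :: nat
  proof -
    let ?L = "(*\<^sub>R) (real p / real q) ` K"
    have "(*\<^sub>R) (real q) ` ?L = (*\<^sub>R) (real p) ` K" using that by (simp add: image_image)
    then have "real q *\<^sub>R f ?L = real p *\<^sub>R f K"
      using hom[OF that(2) scale_cbody[OF W K, of "real p / real q"]] hom[OF that(1) K] by simp
    then have "(1 / real q) *\<^sub>R (real q *\<^sub>R f ?L) = (1 / real q) *\<^sub>R (real p *\<^sub>R f K)" by simp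
    then show ?thesis using that by simp
  qed
  have "norm (f ((*\<^sub>R) c ` K) - c *\<^sub>R f K) < e" if e: "e > 0" for e
  proof -
    have ne: "(*\<^sub>R) c ` K \<noteq> {}" using False by simp
    obtain d where d: "d > 0" "\<And>L. cbody W L \<Longrightarrow> L \<noteq> {} \<Longrightarrow> near d ((*\<^sub>R) c ` K) L \<Longrightarrow> norm (f L - f ((*\<^sub>R) c ` K)) < e / 2"
      using f(1) scale_cbody[OF W K, of c] ne half_gt_zero[OF e] unfolding hcont_def by blast
    define M where "M = bnd K"
    have M: "M \<ge> 0" "\<And>x. x \<in> K \<Longrightarrow> norm x \<le> M" using bnd_props[OF K] by (auto simp: M_def)
    \<comment> \<open>The first bound keeps the multiples of \<open>K\<close> by \<open>c\<close>
      and by \<open>y\<close> within \<open>d\<close> of each other; the second keeps the norm of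
      \<open>(y - c)\<close> times \<open>f K\<close> at most \<open>e / 2\<close>.\<close>
    define r where "r = min (d / (M + 1)) (e / (2 * (norm (f K) + 1)))"
    have r: "r > 0" unfolding r_def using d e M
      by (simp add: add_nonneg_pos)
    obtain y where y: "y \<in> \<rat>" "c < y" "y < c + r" using Rats_dense_in_real[of c "c + r"] r by auto
    then obtain p q :: nat where pq: "q \<noteq> 0" "\<bar>y\<bar> = real p / real q" by (metis Rats_abs_nat_div_natE)
    then have yq: "y = real p / real q" using y c by simp
    have "p > 0" "q > 0" using pq(1) yq y c by (auto intro!: gr0I)
    then have fy: "f ((*\<^sub>R) y ` K) = y *\<^sub>R f K" using rat yq by simp
    have yc: "\<bar>y - c\<bar> < r" using y by simp
    have dd: "norm (c *\<^sub>R x - y *\<^sub>R x) \<le> d" if "x \<in> K" for x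
    proof -
      have "norm (c *\<^sub>R x - y *\<^sub>R x) = \<bar>y - c\<bar> * norm x" by (simp add: scaleR_left_diff_distrib[symmetric] abs_minus_commute)
      also have "\<dots> \<le> r * (M + 1)" using yc M that by (intro mult_mono) (auto intro: add_increasing2)
      also have "\<dots> \<le> (d / (M + 1)) * (M + 1)" using M by (intro mult_right_mono) (auto simp: r_def)
      finally show ?thesis using M by simp
    qed
    have "near d ((*\<^sub>R) c ` K) ((*\<^sub>R) y ` K)" unfolding near_def using dd by (auto simp: dist_norm)
    then have 1: "norm (f ((*\<^sub>R) y ` K) - f ((*\<^sub>R) c ` K)) < e / 2"
      using d(2) scale_cbody[OF W K] False by simp
    have "norm (y *\<^sub>R f K - c *\<^sub>R f K) = \<bar>y - c\<bar> * norm (f K)" by (simp add: scaleR_left_diff_distrib[symmetric])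
    also have "\<dots> \<le> (e / (2 * (norm (f K) + 1))) * norm (f K)" using yc by (intro mult_right_mono) (auto simp: r_def)
    also have "\<dots> \<le> (e / (2 * (norm (f K) + 1))) * (norm (f K) + 1)" using e by (intro mult_left_mono) auto
    also have "\<dots> = e / 2"
    proof -
      have k: "k > 0 \<Longrightarrow> (e / (2 * k)) * k = e / 2" for k :: real by simp
      show ?thesis by (rule k) (simp add: add_nonneg_pos)
    qed
    finally have 2: "norm (y *\<^sub>R f K - c *\<^sub>R f K) \<le> e / 2" .
    have eq: "f ((*\<^sub>R) c ` K) - c *\<^sub>R f K = (y *\<^sub>R f K - c *\<^sub>R f K) - (f ((*\<^sub>R) y ` K) - f ((*\<^sub>R) c ` K))" using fy by simp
    show ?thesis unfolding eq using norm_triangle_ineq4[of "y *\<^sub>R f K - c *\<^sub>R f K" "f ((*\<^sub>R) y ` K) - f ((*\<^sub>R) c ` K)"] 1 2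
      by linarith
  qed
  then have "norm (f ((*\<^sub>R) c ` K) - c *\<^sub>R f K) \<le> 0" by (meson less_irrefl not_le)
  then show ?thesis by simp
qed

text \<open>With \<open>dim W > 2\<close> the hyperplanes have dimension at least \<open>2\<close>,
  as both the induction hypothesis for the tangential part and \<open>rot_invariant_zero\<close> for
  the normal part require. The latter also asks for vanishing on cylinders, which comes from
  \<open>hom\<close>.\<close>

lemma eq_val_zero_higher:
  fixes f :: "'a::euclidean_space set \<Rightarrow> 'a"
  assumes cv: "cyl_val W f" and f: "eq_val W f" and d: "dim W > 2"
    and hom: "\<And>m K. m > 0 \<Longrightarrow> cbody W K \<Longrightarrow> f ((*\<^sub>R) (real m) ` K) = real m *\<^sub>R f K"
    and IH: "\<And>U g K. eq_val U g \<Longrightarrow> dim U < dim W \<Longrightarrow> dim U > 1 \<Longrightarrow> cbody U K \<Longrightarrow> g K = (0::'a)"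
    and K: "cbody W K"
  shows "f K = 0"
proof -
  interpret cv: cyl_val W f by (rule cv)
  have W: "subspace W" and eqv: "equivariant W f" using f unfolding eq_val_def by auto
  have "avg W f n F \<bullet> w = 0" if n: "n \<in> W" "n \<noteq> 0" and F: "cbody {x\<in>W. x \<bullet> n = 0} F" and w: "w \<in> W" for n F w
  proof -
    let ?H = "{x\<in>W. x \<bullet> n = 0}"
    note H = dim_hyperplane_in[OF W n]
    have dH: "dim ?H > 1" "dim ?H < dim W" using H(2) d by auto
    have cW: "cbody W K" if "cbody ?H K" for K using that unfolding cbody_def by blast
    have rot: "avg W f n (mirror a ` mirror b ` K) = mirror a (mirror b (avg W f n K))"
      if ab: "a \<in> ?H" "b \<in> ?H" "a \<noteq> 0" "b \<noteq> 0" and K: "cbody ?H K" for a b K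
    proof -
      have lin: "linear (\<lambda>x. mirror a (mirror b x))"
        using linear_compose[OF linear_mirror linear_mirror, of a b] by (simp add: o_def)
      have "avg W f (mirror a (mirror b n)) (mirror a ` mirror b ` K) = mirror a (mirror b (avg W f n K))"
        by (rule cv.avg_equivariant[OF _ _ lin _ cW[OF K]])
          (use eqv ab in \<open>auto simp: equivariant_def\<close>)
      \<comment> \<open>Rotations within the hyperplane leave its normal alone, so they act on the
        average for one and the same \<open>n\<close>.\<close>
      moreover have "mirror a (mirror b n) = n" using ab by (simp add: mirror_fix inner_commute)
      ultimately show ?thesis by simp
    qed
    have tv: "tinv ?H (avg W f n)" unfolding tinv_def using cv.avg_tinv cW by blast
    have "eq_val ?H (\<lambda>K. proj ?H (avg W f n K))"
      unfolding eq_val_def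
    proof (intro conjI allI impI)
      show "subspace ?H" by (rule H(1))
      show "val ?H (\<lambda>K. proj ?H (avg W f n K))" by (rule val_compose[OF linear_proj[OF H(1)] cv.avg_val[OF n]])
      show "tinv ?H (\<lambda>K. proj ?H (avg W f n K))" by (rule tinv_compose[OF tv])
      show "hcont ?H (\<lambda>K. proj ?H (avg W f n K))"
        by (rule hcont_compose[OF bounded_linear_proj[OF H(1)] cv.avg_hcont[OF n(1)]])
      show "proj ?H (avg W f n K) \<in> ?H" for K by (rule proj_props(1)[OF H(1)])
      show "equivariant ?H (\<lambda>K. proj ?H (avg W f n K))"
        unfolding equivariant_def
        using rot proj_mirror[OF H(1)] by simp
    qed
    then have tang: "proj ?H (avg W f n F) = 0" by (rule IH[OF _ dH(2,1) F])
    let ?g = "\<lambda>K. avg W f n K \<bullet> n"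
    have lin: "linear (\<lambda>x. x \<bullet> n)" by (rule bounded_linear.linear[OF bounded_linear_inner_left])
    have g: "val ?H ?g" "simple ?H ?g" "tinv ?H ?g" "hcont ?H ?g"
      using val_compose[OF lin cv.avg_val[OF n]] simple_compose[OF lin cv.avg_simple[OF n]]
        tinv_compose[OF tv, of "\<lambda>x. x \<bullet> n"] hcont_compose[OF bounded_linear_inner_left cv.avg_hcont[OF n(1)]] by blast+
    have "rot_invariant ?H ?g" unfolding rot_invariant_def
    proof (intro ballI impI allI)
      fix a b K assume ab: "a \<in> ?H" "b \<in> ?H" "a \<noteq> 0" "b \<noteq> 0" and K: "cbody ?H K"
      have "mirror b (mirror a n) = n" using ab by (simp add: mirror_fix inner_commute)
      then show "?g (mirror a ` mirror b ` K) = ?g K" using rot[OF ab K] by (simp add: mirror_adjoint)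
    qed
    moreover have "cyl_zero ?H ?g"
      by (rule homogeneous_cyl_zero[OF H(1) dH(1) g]) (use cv.avg_homogeneous hom cW in auto)
    ultimately have norm: "?g F = 0" using rot_invariant_zero[OF H(1) dH(1) g _ _ F] by blast
    let ?c = "(w \<bullet> n) / (n \<bullet> n)"
    have "w - ?c *\<^sub>R n \<in> ?H" using w n W by (auto simp: subspace_diff subspace_scale inner_diff_left)
    then have "avg W f n F \<bullet> (w - ?c *\<^sub>R n) = 0" using proj_props(2)[OF H(1), of _ "avg W f n F"] tang by simp
    then show ?thesis using norm by (simp add: inner_diff_right)
  qed
  then show ?thesis using cv.zero_of_avg[of W K] K f unfolding eq_val_def by blast
qed

section \<open>The plane\<close>

lemma plane_basis:
  fixes W :: "'a::euclidean_space set"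
  assumes W: "subspace W" "dim W = 2"
  obtains e1 e2 where "e1 \<in> W" "e2 \<in> W" "e1 \<bullet> e1 = 1" "e2 \<bullet> e2 = 1" "e1 \<bullet> e2 = 0"
    "\<And>x. x \<in> W \<Longrightarrow> x = (x \<bullet> e1) *\<^sub>R e1 + (x \<bullet> e2) *\<^sub>R e2"
proof -
  obtain a where a: "a \<in> W" "a \<noteq> 0" by (rule dim_pos_nonzero[of W]) (use W in auto)
  define e1 where "e1 = a /\<^sub>R norm a"
  have e1: "e1 \<in> W" "e1 \<bullet> e1 = 1" "e1 \<noteq> 0"
    using a W(1) by (auto simp: e1_def subspace_scale power2_norm_eq_inner[symmetric] power2_eq_square field_simps)
  let ?H = "{x\<in>W. x \<bullet> e1 = 0}"
  note H = dim_hyperplane_in[OF W(1) e1(1,3)]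
  obtain b where b: "b \<in> ?H" "b \<noteq> 0" by (rule dim_pos_nonzero[of ?H]) (use H W in auto)
  define e2 where "e2 = b /\<^sub>R norm b"
  have e2: "e2 \<in> ?H" "e2 \<bullet> e2 = 1" "e2 \<noteq> 0"
    using b W(1) by (auto simp: e2_def subspace_scale power2_norm_eq_inner[symmetric] power2_eq_square field_simps)
  have Hs: "?H = span {e2}" by (rule span_single_eq[OF H(1) _ e2(1,3)]) (use H(2) W(2) in simp)
  have e12: "e1 \<bullet> e2 = 0" using e2(1) by (simp add: inner_commute)
  have exp: "x = (x \<bullet> e1) *\<^sub>R e1 + (x \<bullet> e2) *\<^sub>R e2" if x: "x \<in> W" for x
  proof -
    have "x - (x \<bullet> e1) *\<^sub>R e1 \<in> ?H" using x e1 W(1) by (auto simp: subspace_diff subspace_scale inner_diff_left)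
    then obtain k where k: "x - (x \<bullet> e1) *\<^sub>R e1 = k *\<^sub>R e2" unfolding Hs by (auto simp: span_singleton)
    have "(x - (x \<bullet> e1) *\<^sub>R e1) \<bullet> e2 = k" unfolding k using e2 by simp
    moreover have "e1 \<bullet> e2 = 0" using e2(1) by (simp add: inner_commute)
    ultimately have "k = x \<bullet> e2" by (simp add: inner_diff_left)
    then show ?thesis using k by (simp add: algebra_simps)
  qed
  show ?thesis by (rule that[OF e1(1) _ e1(2) e2(2) e12 exp]) (use e2 in auto)
qed

text \<open>One linear map \<open>L\<close> describes the averages for all edges: it is read off on
  a single reference edge, carried to all unit edges by rotations, and to all lengths by
  homogeneity.\<close>

lemma eq_val_zero_plane:
  fixes f :: "'a::euclidean_space set \<Rightarrow> 'a"
  assumes cv: "cyl_val W f" and f: "eq_val W f" and d: "dim W = 2"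
    and hom: "\<And>m K. m > 0 \<Longrightarrow> cbody W K \<Longrightarrow> f ((*\<^sub>R) (real m) ` K) = real m *\<^sub>R f K"
    and K: "cbody W K"
  shows "f K = 0"
proof -
  interpret cv: cyl_val W f by (rule cv)
  have W: "subspace W" and eqv: "equivariant W f" using f unfolding eq_val_def by auto
  have dW: "dim W > 0" using d by simp
  obtain e1 e2 where e: "e1 \<in> W" "e2 \<in> W" "e1 \<bullet> e1 = 1" "e2 \<bullet> e2 = 1" "e1 \<bullet> e2 = 0"
    and ex: "\<And>x. x \<in> W \<Longrightarrow> x = (x \<bullet> e1) *\<^sub>R e1 + (x \<bullet> e2) *\<^sub>R e2"
    using plane_basis[OF W d] by blast
  \<comment> \<open>The quarter turn taking \<open>e1\<close> to \<open>e2\<close>. For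
    \<open>x\<close> and \<open>y\<close> in the plane, \<open>J x \<bullet> y\<close> is their
    determinant, and its sign serves as orientation.\<close>
  define J where "J x = (x \<bullet> e1) *\<^sub>R e2 - (x \<bullet> e2) *\<^sub>R e1" for x
  have JW: "J x \<in> W" for x unfolding J_def using e W by (intro subspace_diff subspace_scale)
  have Jin: "J x \<bullet> y = (x \<bullet> e1) * (y \<bullet> e2) - (x \<bullet> e2) * (y \<bullet> e1)" for x y
    by (simp only: J_def inner_diff_left inner_scaleR_left inner_commute[of e2 y] inner_commute[of e1 y])
  have Jlin: "J (x + y) = J x + J y" "J (c *\<^sub>R x) = c *\<^sub>R J x" for x y c
    by (simp_all add: J_def algebra_simps inner_add_left)
  \<comment> \<open>Projecting to \<open>W\<close> makes the expansion in \<open>e1\<close> and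
    \<open>e2\<close> available for the average.\<close>
  define p where "p n F = proj W (avg W f n F)" for n F
  \<comment> \<open>Together with \<open>w2\<close> the components on the reference edge from
    \<open>0\<close> to \<open>e1\<close>, whose normal is \<open>e2\<close>; they determine the map
    common to all edges.\<close>
  define w1 where "w1 = p e2 (convex hull {0, e1}) \<bullet> e1"
  define w2 where "w2 = p e2 (convex hull {0, e1}) \<bullet> e2"
  have seg: "cbody W (convex hull {x, y})" if "x \<in> W" "y \<in> W" for x y
    by (rule cbody_hull[OF _ _ W]) (use that in auto)
  have pe: "p e2 (convex hull {0, e1}) = w1 *\<^sub>R e1 + w2 *\<^sub>R e2"
    unfolding w1_def w2_def by (rule ex) (simp add: p_def proj_props(1)[OF W])
  have unit: "p (J y) (convex hull {0, y}) = w1 *\<^sub>R y + w2 *\<^sub>R J y" if y: "y \<in> W" "y \<bullet> y = 1" for y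
  proof (cases "y = e1")
    case True
    then have "J y = e2" using e by (simp add: J_def)
    then show ?thesis using True pe by simp
  next
    case False
    define c s where "c = y \<bullet> e1" and "s = y \<bullet> e2"
    have y': "y = c *\<^sub>R e1 + s *\<^sub>R e2" using ex[OF y(1)] by (simp add: c_def s_def)
    have "y \<bullet> y = c * (y \<bullet> e1) + s * (y \<bullet> e2)"
      by (subst (2) y') (simp add: inner_add_right)
    then have cs: "c * c + s * s = 1" using y(2) by (simp add: c_def s_def)
    \<comment> \<open>\<open>mirror a\<close> exchanges \<open>e1\<close> and \<open>y\<close>.
      Preceded by \<open>mirror e2\<close>, which fixes \<open>e1\<close>, it is the rotation taking
      \<open>e1\<close> to \<open>y\<close> and \<open>e2\<close> to \<open>J y\<close>. The case
      \<open>y = e1\<close> is separate because \<open>a\<close> would be \<open>0\<close>.\<close>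
    define a where "a = e1 - y"
    have aW: "a \<in> W" using e y W by (simp add: a_def subspace_diff)
    have a0: "a \<noteq> 0" using False by (simp add: a_def)
    have aa: "a \<bullet> a = 2 - 2 * c" using e y(2) by (simp add: a_def c_def inner_diff_left inner_diff_right inner_commute)
    have c1: "1 - c \<noteq> 0" using aa a0 by auto
    have m1: "mirror a e1 = y"
    proof -
      have "2 * (e1 \<bullet> a) = a \<bullet> a" unfolding aa using e by (simp add: a_def c_def inner_diff_right inner_commute)
      then have "2 * (e1 \<bullet> a) / (a \<bullet> a) = 1" using a0 by (metis divide_self inner_eq_zero_iff)
      then have "mirror a e1 = e1 - 1 *\<^sub>R a" by (simp only: mirror_def)
      then show ?thesis by (simp add: a_def)
    qed
    have m2: "mirror a e2 = - J y"
    proof -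
      have "e2 \<bullet> a = - s" using e by (simp add: a_def s_def inner_diff_right inner_commute)
      then have k: "2 * (e2 \<bullet> a) / (a \<bullet> a) = - (s / (1 - c))" unfolding aa using c1 by (simp add: field_simps)
      have "a = (1 - c) *\<^sub>R e1 - s *\<^sub>R e2" unfolding a_def by (subst y') (simp add: algebra_simps)
      then have "mirror a e2 = e2 + (s / (1 - c)) *\<^sub>R ((1 - c) *\<^sub>R e1 - s *\<^sub>R e2)"
        unfolding mirror_def k by simp
      also have "\<dots> = s *\<^sub>R e1 + (1 - s * s / (1 - c)) *\<^sub>R e2"
      proof -
        have k: "s / (1 - c) * (1 - c) = s" "s / (1 - c) * s = s * s / (1 - c)" using c1 by simp_all
        have "e2 + q *\<^sub>R (r *\<^sub>R e1 - s *\<^sub>R e2) = (q * r) *\<^sub>R e1 + (1 - q * s) *\<^sub>R e2" for q r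
          by (simp add: algebra_simps)
        from this[of "s / (1 - c)" "1 - c"] show ?thesis unfolding k .
      qed
      also have "1 - s * s / (1 - c) = - c" using cs c1 by (simp add: field_simps)
      finally show ?thesis by (simp add: J_def c_def s_def)
    qed
    have e20: "e2 \<noteq> 0" using e by auto
    have b: "mirror e2 e1 = e1" "mirror e2 e2 = - e2"
      using e mirror_self[OF e20] by (auto simp: mirror_fix)
    have neg: "mirror a (- x) = - mirror a x" for x by (rule linear_neg[OF linear_mirror])
    have lin: "linear (\<lambda>x. mirror a (mirror e2 x))"
      using linear_compose[OF linear_mirror linear_mirror, of a e2] by (simp add: o_def)
    have z0: "mirror v 0 = 0" for v by (simp add: mirror_def)
    have "mirror a ` mirror e2 ` (convex hull {0, e1}) = convex hull {0, y}"
      by (simp add: convex_hull_linear_image[OF linear_mirror] b m1 z0)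
    moreover have "mirror a (mirror e2 e2) = J y" using b m2 neg by simp
    moreover have "avg W f (mirror a (mirror e2 e2)) (mirror a ` mirror e2 ` (convex hull {0, e1}))
        = mirror a (mirror e2 (avg W f e2 (convex hull {0, e1})))"
      by (rule cv.avg_equivariant[OF aW e(2) lin _ seg])
        (use eqv aW e a0 e20 subspace_0[OF W] in \<open>auto simp: equivariant_def\<close>)
    ultimately have "avg W f (J y) (convex hull {0, y}) = mirror a (mirror e2 (avg W f e2 (convex hull {0, e1})))"
      by simp
    then have "p (J y) (convex hull {0, y}) = mirror a (mirror e2 (p e2 (convex hull {0, e1})))"
      by (simp add: p_def proj_mirror[OF W aW] proj_mirror[OF W e(2)])
    also have "\<dots> = w1 *\<^sub>R y + w2 *\<^sub>R J y"
      unfolding pe using b m1 m2 neg by (simp add: mirror_add mirror_diff mirror_scale)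
    finally show ?thesis .
  qed
  have rh: "f ((*\<^sub>R) c ` K) = c *\<^sub>R f K" if "c > 0" "cbody W K" for c K
    by (rule real_homogeneous[OF W cv.f(4) cv.f_empty hom that])
  have edge: "p (J x) (convex hull {0, x}) = w1 *\<^sub>R x + w2 *\<^sub>R J x" if x: "x \<in> W" "x \<noteq> 0" for x
  proof -
    let ?c = "norm x" and ?y = "x /\<^sub>R norm x"
    have c: "?c > 0" using x by simp
    have y: "?y \<in> W" "?y \<bullet> ?y = 1"
      using x W by (auto simp: subspace_scale power2_norm_eq_inner[symmetric] power2_eq_square field_simps)
    have xy: "x = ?c *\<^sub>R ?y" using c by simp
    have "convex hull {0, x} = (*\<^sub>R) ?c ` (convex hull {0, ?y})"
      using c by (simp add: convex_hull_scaling[symmetric])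
    moreover have Jx: "J x = ?c *\<^sub>R J ?y" using Jlin(2)[of ?c ?y] xy by simp
    ultimately have "avg W f (J x) (convex hull {0, x}) = ?c *\<^sub>R avg W f (J ?y) (convex hull {0, ?y})"
      using cv.avg_homogeneous[OF c rh[OF c] seg[OF subspace_0[OF W] y(1)]] cv.avg_normal_scale[OF c] by simp
    then have "p (J x) (convex hull {0, x}) = ?c *\<^sub>R p (J ?y) (convex hull {0, ?y})"
      by (simp add: p_def linear_scale[OF linear_proj[OF W]])
    also have "\<dots> = ?c *\<^sub>R (w1 *\<^sub>R ?y + w2 *\<^sub>R J ?y)" unfolding unit[OF y] ..
    also have "\<dots> = w1 *\<^sub>R (?c *\<^sub>R ?y) + w2 *\<^sub>R (?c *\<^sub>R J ?y)"
      by (simp only: scaleR_right_distrib scaleR_left_commute[of ?c])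
    also have "\<dots> = w1 *\<^sub>R x + w2 *\<^sub>R J x"
      unfolding Jx[symmetric] xy[symmetric] ..
    finally show ?thesis .
  qed
  show ?thesis
  proof (rule zero_of_simplices[OF W dW cv.f(1,2,4) _ K])
    fix S assume S: "S \<subseteq> W" "\<not> affine_dependent S" "card S = dim W + 1"
    have fin: "finite S" using S(2) aff_independent_finite by blast
    obtain u b h where u: "\<And>s. s \<in> S \<Longrightarrow> u s \<in> W" "\<And>s. s \<in> S \<Longrightarrow> norm (u s) = 1"
      "\<And>s. s \<in> S \<Longrightarrow> h s > (0::real)" "\<And>s t. s \<in> S \<Longrightarrow> t \<in> S \<Longrightarrow> t \<noteq> s \<Longrightarrow> u s \<bullet> t = b s"
      "\<And>s. s \<in> S \<Longrightarrow> u s \<bullet> s = b s + h s"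
      "convex hull S = {x\<in>W. \<forall>s\<in>S. b s \<le> u s \<bullet> x}"
      "\<And>s. s \<in> S \<Longrightarrow> convex hull (S - {s}) = {x\<in>convex hull S. u s \<bullet> x = b s}"
      by (rule simplex_halfspaces[OF W dW S]) (rule that)
    define L where "L x = w1 *\<^sub>R x + w2 *\<^sub>R J x" for x
    have facet: "p (u r) (convex hull {q, q'}) = L (q' - q)"
      if q: "q \<in> S" "q' \<in> S" "r \<in> S" "q \<noteq> q'" "r \<noteq> q" "r \<noteq> q'" and D: "J (q' - q) \<bullet> (r - q) > 0" for q q' r
    proof -
      let ?x = "q' - q"
      have xW: "?x \<in> W" using q S W subspace_diff by blast
      have x0: "?x \<noteq> 0" using q by simp
      have xx: "?x \<bullet> ?x > 0" using x0 by simp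
      have ux: "u r \<bullet> ?x = 0" using u(4)[OF q(3)] q by (simp add: inner_diff_right)
      \<comment> \<open>The normal \<open>u r\<close> is orthogonal to the edge, hence a multiple of
        its quarter turn. The orientation \<open>D\<close> makes the factor \<open>\<mu>\<close>
        positive, and positive factors of the normal do not affect the average.\<close>
      define \<mu> where "\<mu> = (u r \<bullet> J ?x) / (?x \<bullet> ?x)"
      let ?A = "?x \<bullet> e1" and ?B = "?x \<bullet> e2" and ?C = "u r \<bullet> e1" and ?D = "u r \<bullet> e2"
      have ux': "?C * ?A + ?D * ?B = 0"
        using arg_cong[OF ex[OF xW], of "\<lambda>z. u r \<bullet> z"] ux
        by (simp only: inner_add_right inner_scaleR_right) (simp add: mult.commute)
      have xx': "?x \<bullet> ?x = ?A * ?A + ?B * ?B" by (subst (2) ex[OF xW]) (simp only: inner_add_right inner_scaleR_right)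
      have uJ: "u r \<bullet> J ?x = ?A * ?D - ?B * ?C" by (simp add: inner_commute[of "u r" "J ?x"] Jin)
      have i1: "?C * (?x \<bullet> ?x) = (u r \<bullet> J ?x) * (- ?B)"
      proof -
        have "?C * (?x \<bullet> ?x) - (u r \<bullet> J ?x) * (- ?B) = ?A * (?C * ?A + ?D * ?B)"
          unfolding xx' uJ by (simp add: algebra_simps)
        then show ?thesis using ux' by simp
      qed
      have i2: "?D * (?x \<bullet> ?x) = (u r \<bullet> J ?x) * ?A"
      proof -
        have "?D * (?x \<bullet> ?x) - (u r \<bullet> J ?x) * ?A = ?B * (?C * ?A + ?D * ?B)"
          unfolding xx' uJ by (simp add: algebra_simps)
        then show ?thesis using ux' by simp
      qed
      have CD: "?C = \<mu> * (- ?B)" "?D = \<mu> * ?A" using i1 i2 xx by (simp_all add: \<mu>_def field_simps)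
      have "u r = ?C *\<^sub>R e1 + ?D *\<^sub>R e2" by (rule ex[OF u(1)[OF q(3)]])
      also have "\<dots> = \<mu> *\<^sub>R J ?x" unfolding CD J_def by (simp add: scaleR_right_diff_distrib)
      finally have uJ: "u r = \<mu> *\<^sub>R J ?x" .
      have "u r \<bullet> (r - q) = h r" using u(4,5) q by (simp add: inner_diff_right)
      then have "\<mu> * (J ?x \<bullet> (r - q)) > 0" using u(3)[OF q(3)] uJ by (metis inner_scaleR_left)
      then have \<mu>: "\<mu> > 0" using D by (simp add: zero_less_mult_iff)
      have "convex hull {q, q'} = (+) q ` (convex hull {0, ?x})"
        by (simp add: convex_hull_translation[symmetric])
      then have "avg W f (u r) (convex hull {q, q'}) = avg W f (J ?x) (convex hull {0, ?x})"
        using cv.avg_tinv[OF seg[OF subspace_0[OF W] xW], of q] q S cv.avg_normal_scale[OF \<mu>] uJ by auto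
      then show ?thesis using edge[OF xW x0] by (simp add: p_def L_def)
    qed
    have "card S = 3" using S(3) d by simp
    then obtain x y z where xyz: "S = {x, y, z}" "x \<noteq> y" "y \<noteq> z" "x \<noteq> z" by (auto simp: card_3_iff)
    \<comment> \<open>A triangle is not contained in a line, so its orientation is not zero.\<close>
    have D0: "J (y - x) \<bullet> (z - x) \<noteq> 0"
    proof
      assume D: "J (y - x) \<bullet> (z - x) = 0"
      have yx: "y - x \<in> W" "y - x \<noteq> 0" using xyz S(1) W subspace_diff by auto
      have "J (y - x) \<noteq> 0"
      proof
        assume "J (y - x) = 0"
        then have "J (y - x) \<bullet> e2 = 0" "J (y - x) \<bullet> e1 = 0" by simp_all
        then have "(y - x) \<bullet> e1 = 0" "(y - x) \<bullet> e2 = 0" unfolding Jin using e by (simp_all add: inner_commute)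
        then show False using ex[OF yx(1)] yx(2) by simp
      qed
      moreover have "J (y - x) \<bullet> (y - x) = 0" unfolding Jin by simp
      then have "\<forall>v\<in>S. J (y - x) \<bullet> v = J (y - x) \<bullet> x" using D xyz(1) by (auto simp: inner_diff_right)
      then have "affine hull S \<subseteq> {v. J (y - x) \<bullet> v = J (y - x) \<bullet> x}"
        by (intro hull_minimal affine_hyperplane) auto
      then have "W \<subseteq> {v. J (y - x) \<bullet> v = J (y - x) \<bullet> x}" using affine_hull_card[OF W S] by simp
      then have "J (y - x) \<bullet> J (y - x) = J (y - x) \<bullet> x" "J (y - x) \<bullet> 0 = J (y - x) \<bullet> x"
        using JW[of "y - x"] subspace_0[OF W] by blast+
      then have "J (y - x) \<bullet> J (y - x) = 0" by simp
      ultimately show False by simp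
    qed
    have main: "f (convex hull S) = 0"
      if xyz: "S = {x, y, z}" "x \<noteq> y" "y \<noteq> z" "x \<noteq> z" and D: "J (y - x) \<bullet> (z - x) > 0" for x y z
    proof -
      \<comment> \<open>Cyclic permutation preserves the orientation, so each edge, traversed in
        this order, has the opposite vertex on its positive side.\<close>
      have D2: "J (z - y) \<bullet> (x - y) > 0" "J (x - z) \<bullet> (y - z) > 0"
        using D unfolding Jin inner_diff_left by (simp_all add: algebra_simps)
      have Sd: "S - {z} = {x, y}" "S - {x} = {y, z}" "S - {y} = {z, x}" using xyz by auto
      have "(\<Sum>s\<in>S. p (u s) (convex hull (S - {s}))) = L (y - x) + (L (z - y) + L (x - z))"
        using facet[of x y z] facet[of y z x] facet[of z x y] D D2 xyz Sd by (auto simp: algebra_simps)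
      also have "\<dots> = 0" unfolding L_def
        by (simp add: J_def algebra_simps inner_diff_left)
      finally have sum0: "(\<Sum>s\<in>S. p (u s) (convex hull (S - {s}))) = 0" .
      have fW: "f (convex hull S) \<in> W" using f cbody_hull[OF fin S(1) W] unfolding eq_val_def by blast
      have "measure lborel (annulus W) *\<^sub>R f (convex hull S) = (\<Sum>s\<in>S. - avg W f (u s) (convex hull (S - {s})))"
        by (rule cv.avg_facets[OF S u])
      then have "proj W (measure lborel (annulus W) *\<^sub>R f (convex hull S)) = - (\<Sum>s\<in>S. p (u s) (convex hull (S - {s})))"
        by (simp add: p_def sum_negf linear_neg[OF linear_proj[OF W]] linear_sum[OF linear_proj[OF W]])
      then have "measure lborel (annulus W) *\<^sub>R f (convex hull S) = 0"
        using sum0 proj_id[OF W subspace_scale[OF W fW]] by simp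
      then show ?thesis using measure_annulus[OF W dW] by simp
    qed
    show "f (convex hull S) = 0"
    proof (cases "J (y - x) \<bullet> (z - x) > 0")
      case True then show ?thesis using main xyz by blast
    next
      case False
      \<comment> \<open>Exchanging two vertices reverses the orientation.\<close>
      have "J (x - y) \<bullet> (z - y) = - (J (y - x) \<bullet> (z - x))"
        unfolding Jin inner_diff_left by (simp add: algebra_simps)
      then have "J (x - y) \<bullet> (z - y) > 0" using False D0 by simp
      moreover have "S = {y, x, z}" using xyz by auto
      ultimately show ?thesis using main xyz by metis
    qed
  qed
qed

theorem eq_val_zero:
  fixes f :: "'a::euclidean_space set \<Rightarrow> 'a"
  assumes "eq_val W f" "dim W > 1" "cbody W K"
  shows "f K = 0"
  using assms
proof (induction "dim W" arbitrary: W f K rule: less_induct)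
  case less
  note f = less.prems(1) and d = less.prems(2)
  have IH: "g K = 0" if "eq_val U g" "dim U < dim W" "dim U > 1" "cbody U K" for U and g :: "'a set \<Rightarrow> 'a" and K
    using less.hyps[OF that(2,1,3,4)] .
  have W: "subspace W" "val W f" "tinv W f" "hcont W f" using f unfolding eq_val_def by auto
  have pz: "prod_zero W f" using eq_val_prod_zero[OF f] IH by blast
  have sm: "simple W f" unfolding simple_def
  proof (intro allI impI)
    fix K assume K: "cbody W K" "thin W K"
    obtain a b where a: "a \<in> W" "a \<noteq> 0" "\<And>x. x \<in> K \<Longrightarrow> a \<bullet> x = b" using K(2) unfolding thin_def by blast
    let ?H = "{x\<in>W. x \<bullet> a = 0}"
    obtain z where z: "z \<in> W" "cbody ?H ((+) z ` K)" using hyperplane_translate[OF W(1) K(1) a(3)] by blast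
    note H = dim_hyperplane_in[OF W(1) a(1,2)]
    \<comment> \<open>A thin body, moved into the hyperplane orthogonal to \<open>a\<close>, is the
      product of itself with the point \<open>0\<close> of the line spanned by \<open>a\<close>;
      this is how simplicity follows from vanishing on products.\<close>
    have "f {x + y | x y. x \<in> (+) z ` K \<and> y \<in> {0}} = 0"
    proof (rule pz[unfolded prod_zero_def, rule_format, OF H(1) subspace_span, of "{a}"])
      show "span {a} \<subseteq> W" using a W by (simp add: span_minimal)
      show "cbody (span {a}) {0}" by (simp add: cbody_def span_zero)
      have "dim (span {a}) = 1" using a(2) by (simp add: dim_span)
      then show "0 < dim (span {a})" "dim ?H + dim (span {a}) = dim W" using H(2) by auto
      show "x \<bullet> y = 0" if "x \<in> ?H" "y \<in> span {a}" for x y using that by (auto simp: span_singleton)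
    qed (use H(2) d z in auto)
    then have "f ((+) z ` K) = 0" by (simp add: image_def)
    then show "f K = 0" using W(3) K(1) z(1) unfolding tinv_def by simp
  qed
  have cv: "cyl_val W f"
    by unfold_locales (use W sm pz d prod_zero_cyl_zero in auto)
  have d0: "dim W > 0" using d by simp
  have hom: "f ((*\<^sub>R) (real m) ` K) = real m *\<^sub>R f K" if "m > 0" "cbody W K" for m K
    by (rule degree_one[OF W(1) d0 W(2) sm W(3,4) pz that])
  show ?case
  proof (cases "dim W = 2")
    case True
    show ?thesis by (rule eq_val_zero_plane[OF cv f True hom less.prems(3)])
  next
    case False
    then have "dim W > 2" using d by simp
    then show ?thesis using eq_val_zero_higher[OF cv f _ hom _ less.prems(3)] IH by blast
  qed
qed

section \<open>Valuations with linear translation behaviour\<close>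

lemma near_isometry:
  assumes "\<And>x y. dist (g x) (g y) = dist x y" "near d K L"
  shows "near d (g ` K) (g ` L)"
  using assms unfolding near_def by simp

lemma val_image:
  fixes f :: "'a::euclidean_space set \<Rightarrow> 'b::real_normed_vector" and g :: "'a \<Rightarrow> 'a"
  assumes f: "val UNIV f" and g: "inj g" "\<And>K. cbody UNIV K \<Longrightarrow> cbody UNIV (g ` K)"
  shows "val UNIV (\<lambda>K. f (g ` K))"
  unfolding val_def
proof (intro conjI allI impI)
  show "f (g ` {}) = 0" using f by (simp add: val_def)
  fix K L :: "'a set" assume KL: "cbody UNIV K" "cbody UNIV L" "convex (K \<union> L)"
  have "cbody UNIV (K \<union> L)" using KL by (auto simp: cbody_def compact_Un)
  then have "convex (g ` K \<union> g ` L)" using g(2) by (metis cbody_def image_Un)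
  then show "f (g ` (K \<union> L)) + f (g ` (K \<inter> L)) = f (g ` K) + f (g ` L)"
    using f g(2) KL unfolding val_def image_Un image_Int[OF g(1)] by blast
qed

lemma hcont_image:
  fixes f :: "'a::euclidean_space set \<Rightarrow> 'b::real_normed_vector" and g :: "'a \<Rightarrow> 'a"
  assumes f: "hcont UNIV f" and g: "\<And>x y. dist (g x) (g y) = dist x y"
    and c: "\<And>K. cbody UNIV K \<Longrightarrow> cbody UNIV (g ` K)"
  shows "hcont UNIV (\<lambda>K. f (g ` K))"
  unfolding hcont_def
proof (intro allI impI)
  fix K :: "'a set" and e :: real
  assume K: "cbody UNIV K" "K \<noteq> {}" and e: "e > 0"
  have "g ` K \<noteq> {}" using K by simp
  then obtain d where d: "d > 0"
    "\<And>L. cbody UNIV L \<Longrightarrow> L \<noteq> {} \<Longrightarrow> near d (g ` K) L \<Longrightarrow> norm (f L - f (g ` K)) < e"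
    using f c[OF K(1)] e unfolding hcont_def by meson
  have "norm (f (g ` L) - f (g ` K)) < e" if "cbody UNIV L" "L \<noteq> {}" "near d K L" for L
    using d(2)[OF c[OF that(1)]] that near_isometry[OF g] by simp
  then show "\<exists>d>0. \<forall>L. cbody UNIV L \<longrightarrow> L \<noteq> {} \<longrightarrow> near d K L \<longrightarrow> norm (f (g ` L) - f (g ` K)) < e"
    using d(1) by blast
qed

lemma val_sum:
  fixes f :: "'i \<Rightarrow> 'a::euclidean_space set \<Rightarrow> 'b::real_normed_vector"
  assumes "\<And>i. i \<in> I \<Longrightarrow> val W (f i)"
  shows "val W (\<lambda>K. \<Sum>i\<in>I. f i K)"
  using assms unfolding val_def by (simp flip: sum.distrib)

lemma hcont_sum:
  fixes f :: "'i \<Rightarrow> 'a::euclidean_space set \<Rightarrow> 'b::real_normed_vector"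
  assumes "finite I" "\<And>i. i \<in> I \<Longrightarrow> hcont W (f i)"
  shows "hcont W (\<lambda>K. \<Sum>i\<in>I. f i K)"
  using assms
proof (induction I)
  case empty
  show ?case by (auto simp: hcont_def intro: exI[of _ 1])
next
  case (insert i I)
  then show ?case using hcont_combine[of W "f i" "\<lambda>K. \<Sum>i\<in>I. f i K" "-1"] by simp
qed

lemma cbody_translate_UNIV: "cbody UNIV K \<Longrightarrow> cbody UNIV ((+) x ` K)"
  by (rule cbody_translate) auto

lemma cbody_mirror_UNIV: "cbody UNIV K \<Longrightarrow> cbody UNIV (mirror v ` K)"
  by (rule cbody_mirror) auto

lemma mirror_translate: "mirror v ` (+) x ` K = (+) (mirror v x) ` mirror v ` K"
  by (simp add: image_image mirror_add)

lemma mirror_image_twice: "mirror v ` mirror v ` K = K"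
  by (simp add: image_image)

lemma dist_mirror: "dist (mirror v x) (mirror v y) = dist x y"
  by (simp add: dist_norm flip: linear_diff[OF linear_mirror])

text \<open>The increments of \<open>r\<close> along a basis inherit additivity and continuity from
  \<open>r\<close>. Evaluating \<open>r\<close> after two successive translations shows that
  \<open>\<Phi>\<close> is translation invariant, and the invariance of \<open>r\<close> under pairs
  of reflections makes \<open>\<Phi>\<close> equivariant, so \<open>eq_val_zero\<close>
  applies.\<close>

lemma affine_val_tinv:
  fixes r :: "'a::euclidean_space set \<Rightarrow> real"
  assumes dim: "DIM('a) > 1" and r: "val UNIV r" "hcont UNIV r"
    and inv: "\<And>a b K. a \<noteq> 0 \<Longrightarrow> b \<noteq> 0 \<Longrightarrow> cbody UNIV K \<Longrightarrow> r (mirror a ` mirror b ` K) = r K"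
    and aff: "\<And>K. cbody UNIV K \<Longrightarrow> \<exists>l. \<forall>x. r ((+) x ` K) = r K + l \<bullet> x"
  shows "tinv UNIV r"
proof -
  define \<Phi> where "\<Phi> K = (\<Sum>i\<in>Basis. (r ((+) i ` K) - r K) *\<^sub>R i)" for K
  have \<Phi>: "r ((+) x ` K) = r K + \<Phi> K \<bullet> x" if K: "cbody UNIV K" for K x
  proof -
    obtain l where l: "\<And>x. r ((+) x ` K) = r K + l \<bullet> x" using aff[OF K] by blast
    have "\<Phi> K = l" unfolding \<Phi>_def l by (simp add: euclidean_representation)
    then show ?thesis using l by simp
  qed
  have "val UNIV (\<lambda>K. (r ((+) i ` K) - r K) *\<^sub>R i)" for i
    using val_compose[OF linear_scaleR_left
        val_combine[OF val_image[OF r(1), of "(+) i"] r(1), of 1]]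
    by (simp add: cbody_translate_UNIV)
  then have v: "val UNIV \<Phi>" unfolding \<Phi>_def by (rule val_sum)
  have "hcont UNIV (\<lambda>K. (r ((+) i ` K) - r K) *\<^sub>R i)" for i
    using hcont_compose[OF bounded_linear_scaleR_left
        hcont_combine[OF hcont_image[OF r(2), of "(+) i"] r(2), of 1]]
    by (simp add: cbody_translate_UNIV)
  then have h: "hcont UNIV \<Phi>" unfolding \<Phi>_def by (intro hcont_sum) auto
  have t: "tinv UNIV \<Phi>"
    unfolding tinv_def
  proof (intro allI impI)
    fix K x assume K: "cbody UNIV (K :: 'a set)"
    have "\<Phi> ((+) x ` K) \<bullet> y = \<Phi> K \<bullet> y" for y
    proof -
      have "r ((+) (y + x) ` K) = r ((+) y ` (+) x ` K)" by (simp add: image_image add.assoc)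
      then show ?thesis
        using \<Phi>[OF K, of "y + x"] \<Phi>[OF K, of x] \<Phi>[OF cbody_translate_UNIV[OF K], of y x]
        by (simp add: inner_add_right)
    qed
    then show "\<Phi> ((+) x ` K) = \<Phi> K" by (rule euclidean_eqI)
  qed
  have e: "equivariant UNIV \<Phi>"
    unfolding equivariant_def
  proof (intro ballI allI impI)
    fix a b :: 'a and K assume ab: "a \<noteq> 0" "b \<noteq> 0" and K: "cbody UNIV (K :: 'a set)"
    let ?m = "mirror a ` mirror b ` K"
    have m: "cbody UNIV ?m" using K by (simp add: cbody_mirror_UNIV)
    have "\<Phi> ?m \<bullet> y = mirror a (mirror b (\<Phi> K)) \<bullet> y" for y
    proof -
      have "(+) y ` ?m = mirror a ` mirror b ` (+) (mirror b (mirror a y)) ` K"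
        by (simp add: mirror_translate)
      then have "r ((+) y ` ?m) = r ((+) (mirror b (mirror a y)) ` K)"
        using inv[OF ab cbody_translate_UNIV[OF K]] by simp
      then show ?thesis
        using \<Phi>[OF m, of y] \<Phi>[OF K, of "mirror b (mirror a y)"] inv[OF ab K]
        by (simp add: mirror_adjoint)
    qed
    then show "\<Phi> ?m = mirror a (mirror b (\<Phi> K))"
      by (rule euclidean_eqI)
  qed
  have "\<Phi> K = 0" if "cbody UNIV K" for K
    by (rule eq_val_zero[of UNIV]) (use dim v h t e that in \<open>simp_all add: eq_val_def\<close>)
  then show ?thesis using \<Phi> by (simp add: tinv_def)
qed

lemma mirror_invariant_val:
  fixes r :: "'a::euclidean_space set \<Rightarrow> real"
  assumes r: "val UNIV r" "hcont UNIV r" "tinv UNIV r"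
    and inv: "\<And>a b K. a \<noteq> 0 \<Longrightarrow> b \<noteq> 0 \<Longrightarrow> cbody UNIV K \<Longrightarrow> r (mirror a ` mirror b ` K) = r K"
    and e: "e \<noteq> 0" and K: "cbody UNIV K"
  shows "r (mirror e ` K) = r K"
proof -
  let ?s = "\<lambda>K. r K - 1 *\<^sub>R r (mirror e ` K)"
  have inj: "inj (mirror e)" by (metis injI mirror_mirror)
  have v: "val UNIV ?s"
    by (rule val_combine[OF r(1) val_image[OF r(1) inj cbody_mirror_UNIV]])
  have h: "hcont UNIV ?s"
    by (rule hcont_combine[OF r(2) hcont_image[OF r(2) dist_mirror cbody_mirror_UNIV]])
  have t: "tinv UNIV ?s"
    using r(3) unfolding tinv_def by (simp add: mirror_translate cbody_mirror_UNIV)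
  have odd: "?s (mirror u ` L) = - ?s L" if "u \<noteq> 0" "cbody UNIV L" for u L
    using inv[OF e that] inv[OF that(1) e cbody_mirror_UNIV[OF that(2)], of e]
    by (simp add: mirror_image_twice)
  have "?s K = 0"
    by (rule odd_valuation_zero[OF _ _ v t h odd K]) auto
  then show ?thesis by simp
qed

section \<open>Coordinates\<close>

lemma mirror_axis_nth:
  "(mirror (axis k 1) x :: real^'n) $ i = (if i = k then - x $ i else x $ i)"
  by (simp add: mirror_def inner_axis inner_axis_axis) (simp add: axis_def)

lemma orthogonal_mirror: "orthogonal_transformation (mirror v)"
  by (simp add: orthogonal_transformation_def linear_mirror mirror_inner)

lemma det_mirror_axis: "det (matrix (mirror (axis k 1 :: real^'n))) = - 1"
proof -
  have "matrix (mirror (axis k 1 :: real^'n)) $ i $ j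
      = (if i \<noteq> j then 0 else if i = k then - 1 else 1)" for i j
    by (simp add: matrix_def mirror_axis_nth) (simp add: axis_def)
  then have "det (matrix (mirror (axis k 1 :: real^'n))) = (\<Prod>i\<in>UNIV. if i = k then - 1 else 1)"
    by (subst det_diagonal) simp_all
  then show ?thesis by simp
qed

text \<open>An orthogonal map taking a coordinate axis to the direction of \<open>v\<close>
  conjugates the diagonal reflection of that axis into \<open>mirror v\<close>, and conjugation
  preserves the determinant.\<close>

lemma det_mirror:
  fixes v :: "real^'n"
  assumes "v \<noteq> 0"
  shows "det (matrix (mirror v)) = - 1"
proof -
  fix k :: 'n
  let ?u = "axis k 1 :: real^'n"
  have "norm (norm v *\<^sub>R ?u) = norm v" by simp
  then obtain f where f: "orthogonal_transformation f" "f (norm v *\<^sub>R ?u) = v"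
    by (rule orthogonal_transformation_exists)
  have lin: "linear f" using f(1) by (simp add: orthogonal_transformation_def)
  have v: "norm v *\<^sub>R f ?u = v" using f(2) linear_scale[OF lin] by simp
  have "mirror v (f x) = f (mirror ?u x)" for x
  proof -
    have fi: "f x \<bullet> f ?u = x \<bullet> ?u" "f ?u \<bullet> f ?u = 1"
      using f(1) by (simp_all add: orthogonal_transformation_def inner_axis_axis)
    have "mirror (norm v *\<^sub>R f ?u) (f x) = f x - (2 * (x \<bullet> ?u)) *\<^sub>R f ?u"
      using assms by (simp add: mirror_def fi field_simps)
    then show ?thesis
      unfolding v by (simp add: mirror_def linear_diff[OF lin] linear_scale[OF lin] inner_axis_axis)
  qed
  then have "mirror v \<circ> f = f \<circ> mirror ?u" by auto
  then have "matrix (mirror v) ** matrix f = matrix f ** matrix (mirror ?u)"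
    by (metis matrix_compose lin linear_mirror)
  then have "det (matrix (mirror v)) * det (matrix f) = det (matrix f) * det (matrix (mirror ?u))"
    by (metis det_mul)
  moreover have "det (matrix f) \<noteq> 0"
    using f(1) det_orthogonal_matrix[of "matrix f"] by (auto simp: orthogonal_transformation_matrix)
  ultimately show ?thesis
    unfolding det_mirror_axis by (metis mult.commute mult_cancel_right)
qed

text \<open>Supplies the value \<open>0\<close> on the empty set that \<open>val\<close> expects.
  \<open>is_valuation\<close> says nothing about that value, since two bodies with convex union
  intersect.\<close>

definition normalised :: "((real^'n) set \<Rightarrow> complex) \<Rightarrow> (real^'n) set \<Rightarrow> complex" where
  "normalised \<phi> K = (if K = {} then 0 else \<phi> K)"

lemma body_cbody: "K \<in> convex_bodies \<longleftrightarrow> cbody UNIV K \<and> K \<noteq> {}"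
  by (auto simp: convex_bodies_def cbody_def)

lemma val_normalised:
  assumes "is_valuation \<phi>"
  shows "val UNIV (normalised \<phi>)"
  unfolding val_def
proof (intro conjI allI impI)
  show "normalised \<phi> {} = 0" by (simp add: normalised_def)
  fix K L :: "(real^'a) set"
  assume K: "cbody UNIV K" "cbody UNIV L" "convex (K \<union> L)"
  show "normalised \<phi> (K \<union> L) + normalised \<phi> (K \<inter> L) = normalised \<phi> K + normalised \<phi> L"
  proof (cases "K = {} \<or> L = {}")
    case True
    then show ?thesis by (auto simp: normalised_def)
  next
    case False
    have "closed K" "closed L" using K by (auto simp: cbody_def compact_imp_closed)
    moreover have "connected (K \<union> L)" using K(3) by (rule convex_connected)
    ultimately have "K \<inter> L \<noteq> {}"
      using False unfolding connected_closed by blast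
    moreover have "K \<in> convex_bodies" "L \<in> convex_bodies" "K \<union> L \<in> convex_bodies"
      using K False by (auto simp: convex_bodies_def cbody_def compact_Un)
    ultimately show ?thesis using assms False by (simp add: normalised_def is_valuation_def)
  qed
qed

lemma hausdorff_dist_near:
  assumes "near d K L" "K \<noteq> {}" "L \<noteq> {}"
  shows "hausdorff_dist K L \<le> d"
proof -
  have "infdist x L \<le> d" if "x \<in> K" for x
    using assms(1) that by (auto simp: near_def intro: infdist_le2)
  moreover have "infdist y K \<le> d" if "y \<in> L" for y
    using assms(1) that by (auto simp: near_def dist_commute intro: infdist_le2)
  ultimately show ?thesis
    using assms(2,3) unfolding hausdorff_dist_def by (auto intro!: max.boundedI cSUP_least)
qed

lemma hcont_normalised:
  assumes "hausdorff_continuous \<phi>"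
  shows "hcont UNIV (normalised \<phi>)"
  unfolding hcont_def
proof (intro allI impI)
  fix K :: "(real^'a) set" and e :: real
  assume K: "cbody UNIV K" "K \<noteq> {}" and e: "e > 0"
  then have "K \<in> convex_bodies" by (simp add: body_cbody)
  then obtain d where d: "d > 0"
    "\<And>L. L \<in> convex_bodies \<Longrightarrow> hausdorff_dist K L < d \<Longrightarrow> norm (\<phi> L - \<phi> K) < e"
    using assms e unfolding hausdorff_continuous_def by blast
  have "norm (normalised \<phi> L - normalised \<phi> K) < e"
    \<comment> \<open>\<open>near\<close> is a bound by \<open>\<le>\<close>, while the assumed
      continuity uses \<open><\<close>; halving \<open>d\<close> bridges the two.\<close>
    if L: "cbody UNIV L" "L \<noteq> {}" "near (d / 2) K L" for L
    using d L K hausdorff_dist_near[OF L(3) K(2) L(2)] by (simp add: normalised_def body_cbody)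
  then show "\<exists>d>0. \<forall>L. cbody UNIV L \<longrightarrow> L \<noteq> {} \<longrightarrow> near d K L \<longrightarrow>
      norm (normalised \<phi> L - normalised \<phi> K) < e"
    using d(1) by (intro exI[of _ "d / 2"]) auto
qed

text \<open>The determinants \<open>-1\<close> of the two reflections multiply to \<open>1\<close>,
  so their product is among the matrices of \<open>SO_invariant\<close>.\<close>

lemma normalised_mirror_pair:
  assumes "SO_invariant \<phi>" "a \<noteq> 0" "b \<noteq> 0" "cbody UNIV K"
  shows "normalised \<phi> (mirror a ` mirror b ` K) = normalised \<phi> K"
proof (cases "K = {}")
  case False
  let ?A = "matrix (mirror a) ** matrix (mirror b)"
  have "orthogonal_matrix ?A"
    using orthogonal_mirror[of a] orthogonal_mirror[of b]
    by (auto simp: orthogonal_transformation_matrix intro: orthogonal_matrix_mul)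
  moreover have "det ?A = 1" using assms by (simp add: det_mul det_mirror)
  moreover have "(\<lambda>x. ?A *v x) ` K = mirror a ` mirror b ` K"
    by (simp add: matrix_vector_mul_assoc[symmetric] image_image matrix_vector_mul(2)[OF linear_mirror, THEN fun_cong])
  ultimately show ?thesis
    using assms(1,4) False unfolding SO_invariant_def by (metis body_cbody image_is_empty normalised_def)
qed simp

section \<open>Polynomial behaviour of degree at most one\<close>

lemma polynomial_valuation_0:
  "is_polynomial_valuation 0 \<phi> \<longleftrightarrow> (\<forall>K\<in>convex_bodies. \<forall>x. \<phi> ((+) x ` K) = \<phi> K)"
proof -
  have "{\<alpha> :: 'a \<Rightarrow> nat. (\<Sum>i\<in>UNIV. \<alpha> i) \<le> 0} = {\<lambda>_. 0}" by auto
  then have *: "is_polynomial_valuation 0 \<phi> \<longleftrightarrow>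
      (\<forall>K\<in>convex_bodies. \<exists>c :: ('a \<Rightarrow> nat) \<Rightarrow> complex. \<forall>x. \<phi> ((+) x ` K) = c (\<lambda>_. 0))"
    by (simp add: is_polynomial_valuation_def add.commute)
  show ?thesis
  proof
    assume L: "is_polynomial_valuation 0 \<phi>"
    show "\<forall>K\<in>convex_bodies. \<forall>x. \<phi> ((+) x ` K) = \<phi> K"
    proof (intro ballI allI)
      fix K :: "(real^'a) set" and x assume "K \<in> convex_bodies"
      then obtain c :: "('a \<Rightarrow> nat) \<Rightarrow> complex" where c: "\<And>x. \<phi> ((+) x ` K) = c (\<lambda>_. 0)"
        using L * by blast
      show "\<phi> ((+) x ` K) = \<phi> K" using c[of x] c[of 0] by simp
    qed
  next
    assume "\<forall>K\<in>convex_bodies. \<forall>x. \<phi> ((+) x ` K) = \<phi> K"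
    then show "is_polynomial_valuation 0 \<phi>"
      unfolding * by (intro ballI exI[of _ "\<lambda>_. \<phi> K" for K]) simp
  qed
qed

lemma multi_indices_1:
  "{\<alpha> :: 'n::finite \<Rightarrow> nat. (\<Sum>i\<in>UNIV. \<alpha> i) \<le> 1}
    = insert (\<lambda>_. 0) (range (\<lambda>i j. if j = i then 1 else 0))"
proof (intro equalityI subsetI)
  fix \<alpha> :: "'n \<Rightarrow> nat"
  assume "\<alpha> \<in> {\<alpha>. (\<Sum>i\<in>UNIV. \<alpha> i) \<le> 1}"
  then have a: "(\<Sum>i\<in>UNIV. \<alpha> i) \<le> 1" by simp
  show "\<alpha> \<in> insert (\<lambda>_. 0) (range (\<lambda>i j. if j = i then 1 else 0))"
  proof (cases "\<forall>i. \<alpha> i = 0")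
    case False
    then obtain i where i: "\<alpha> i \<noteq> 0" by blast
    have "(\<Sum>i\<in>UNIV. \<alpha> i) = \<alpha> i + (\<Sum>j\<in>UNIV - {i}. \<alpha> j)" by (rule sum.remove) auto
    then have 1: "\<alpha> i = 1" "(\<Sum>j\<in>UNIV - {i}. \<alpha> j) = 0" using a i by linarith+
    then have "\<alpha> j = 0" if "j \<noteq> i" for j using that by simp
    then have "\<alpha> = (\<lambda>j. if j = i then 1 else 0)" using 1 by auto
    then show ?thesis by blast
  qed auto
qed auto

lemma polynomial_valuation_1:
  "is_polynomial_valuation 1 \<phi> \<longleftrightarrow> (\<forall>K\<in>convex_bodies. \<exists>c l. \<forall>x.
     \<phi> ((+) x ` K) = c + (\<Sum>i\<in>UNIV. l i * complex_of_real (x $ i)))"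
proof -
  let ?d = "\<lambda>i j :: 'a. if j = i then 1 else (0::nat)"
  have inj: "inj ?d" by (rule injI) (metis zero_neq_one)
  have nz: "?d i \<noteq> (\<lambda>_. 0)" for i by (auto simp: fun_eq_iff)
  have p: "(\<Prod>j\<in>UNIV. complex_of_real (x $ j) ^ ?d i j) = complex_of_real (x $ i)" for x :: "real^'a" and i
  proof -
    have "(\<Prod>j\<in>UNIV. complex_of_real (x $ j) ^ ?d i j)
        = (\<Prod>j\<in>UNIV. if j = i then complex_of_real (x $ j) else 1)"
      by (rule prod.cong) auto
    then show ?thesis by simp
  qed
  have "(\<Sum>\<alpha>\<in>{\<alpha> :: 'a \<Rightarrow> nat. (\<Sum>i\<in>UNIV. \<alpha> i) \<le> 1}. c \<alpha> * (\<Prod>i\<in>UNIV. complex_of_real (x $ i ^ \<alpha> i)))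
      = c (\<lambda>_. 0) + (\<Sum>i\<in>UNIV. c (?d i) * complex_of_real (x $ i))"
    for c :: "('a \<Rightarrow> nat) \<Rightarrow> complex" and x :: "real^'a"
    unfolding multi_indices_1 using nz[symmetric]
    by (subst sum.insert) (auto simp: sum.reindex[OF inj] p)
  then have *: "is_polynomial_valuation 1 \<phi> \<longleftrightarrow>
      (\<forall>K\<in>convex_bodies. \<exists>c :: ('a \<Rightarrow> nat) \<Rightarrow> complex. \<forall>x.
        \<phi> ((+) x ` K) = c (\<lambda>_. 0) + (\<Sum>i\<in>UNIV. c (?d i) * complex_of_real (x $ i)))"
    by (simp add: is_polynomial_valuation_def add.commute)
  have "(\<exists>c :: ('a \<Rightarrow> nat) \<Rightarrow> complex. P (c (\<lambda>_. 0)) (\<lambda>i. c (?d i))) \<longleftrightarrow> (\<exists>c l. P c l)" for P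
  proof
    assume "\<exists>c l. P c l"
    then obtain c l where cl: "P c l" by blast
    \<comment> \<open>The constant and the linear coefficients are assembled into one function on
      exponents; the value on any other exponent is arbitrary.\<close>
    let ?c = "\<lambda>\<alpha>. if \<alpha> = (\<lambda>_. 0) then c else l (inv ?d \<alpha>)"
    have "(\<lambda>i. ?c (?d i)) = l" by (simp add: nz inv_f_f[OF inj])
    then have "P (?c (\<lambda>_. 0)) (\<lambda>i. ?c (?d i))" using cl by simp
    then show "\<exists>c :: ('a \<Rightarrow> nat) \<Rightarrow> complex. P (c (\<lambda>_. 0)) (\<lambda>i. c (?d i))"
      by (rule exI[of _ ?c])
  qed blast
  from this[of "\<lambda>c l. \<forall>x. \<phi> ((+) x ` K) = c + (\<Sum>i\<in>UNIV. l i * complex_of_real (x $ i))" for K]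
  show ?thesis unfolding * by blast
qed

lemma Omega_1_translation_invariant:
  assumes dim: "CARD('n::finite) \<ge> 2" and \<phi>: "\<phi> \<in> (Omega 1 :: ((real^'n) set \<Rightarrow> complex) set)"
  shows "is_polynomial_valuation 0 \<phi>"
proof -
  have v: "val UNIV (normalised \<phi>)" and h: "hcont UNIV (normalised \<phi>)"
    and so: "SO_invariant \<phi>" and p: "is_polynomial_valuation 1 \<phi>"
    using \<phi> by (auto simp: Omega_def val_normalised hcont_normalised)
  \<comment> \<open>\<open>g\<close> stands for the real and for the imaginary part; compatibility
    with real factors turns the complex affine polynomial in \<open>x\<close> into a real
    one.\<close>
  have "tinv UNIV (\<lambda>K. g (normalised \<phi> K))" if g: "bounded_linear g"
    "\<And>z t. g (z * complex_of_real t) = g z * t" for g :: "complex \<Rightarrow> real"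
  proof (rule affine_val_tinv)
    have lin: "linear g" using g(1) by (rule bounded_linear.linear)
    show "DIM(real^'n) > 1" using dim by simp
    show "val UNIV (\<lambda>K. g (normalised \<phi> K))" by (rule val_compose[OF lin v])
    show "hcont UNIV (\<lambda>K. g (normalised \<phi> K))" by (rule hcont_compose[OF g(1) h])
    show "g (normalised \<phi> (mirror a ` mirror b ` K)) = g (normalised \<phi> K)"
      if "a \<noteq> 0" "b \<noteq> 0" "cbody UNIV K" for a b K
      using normalised_mirror_pair[OF so that] by simp
    show "\<exists>l. \<forall>x. g (normalised \<phi> ((+) x ` K)) = g (normalised \<phi> K) + l \<bullet> x" if K: "cbody UNIV K" for K
    proof (cases "K = {}")
      case True
      then show ?thesis by (auto intro: exI[of _ 0])
    next
      case False
      then have "K \<in> convex_bodies" using K by (simp add: body_cbody)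
      then obtain c l where cl: "\<And>x. \<phi> ((+) x ` K) = c + (\<Sum>i\<in>UNIV. l i * complex_of_real (x $ i))"
        using p unfolding polynomial_valuation_1 by metis
      have "g (\<phi> ((+) x ` K)) = g c + (\<chi> i. g (l i)) \<bullet> x" for x
        unfolding cl by (simp add: linear_add[OF lin] linear_sum[OF lin] g(2) inner_vec_def)
      from this this[of 0] show ?thesis
        using False by (auto simp: normalised_def intro!: exI[of _ "\<chi> i. g (l i)"])
    qed
  qed
  from this[of Re] this[of Im]
  have "tinv UNIV (\<lambda>K. Re (normalised \<phi> K))" "tinv UNIV (\<lambda>K. Im (normalised \<phi> K))"
    by (simp_all add: bounded_linear_Re bounded_linear_Im)
  then have "normalised \<phi> ((+) x ` K) = normalised \<phi> K" if "cbody UNIV K" for x K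
    using that by (simp add: tinv_def complex_eq_iff)
  then show ?thesis
    unfolding polynomial_valuation_0 Ball_def body_cbody by (metis image_is_empty normalised_def)
qed

lemma Omega_0_O_invariant:
  assumes \<phi>: "\<phi> \<in> (Omega 0 :: ((real^'n) set \<Rightarrow> complex) set)"
  shows "O_invariant \<phi>"
proof -
  have v: "val UNIV (normalised \<phi>)" and h: "hcont UNIV (normalised \<phi>)"
    and so: "SO_invariant \<phi>" and p: "is_polynomial_valuation 0 \<phi>"
    using \<phi> by (auto simp: Omega_def val_normalised hcont_normalised)
  have t: "tinv UNIV (normalised \<phi>)"
    using p unfolding polynomial_valuation_0 body_cbody Ball_def tinv_def by (simp add: normalised_def)
  have m: "normalised \<phi> (mirror e ` K) = normalised \<phi> K" if "e \<noteq> 0" "cbody UNIV K" for e K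
  proof -
    have "g (normalised \<phi> (mirror e ` K)) = g (normalised \<phi> K)"
      if g: "bounded_linear g" for g :: "complex \<Rightarrow> real"
      by (rule mirror_invariant_val[OF val_compose[OF bounded_linear.linear[OF g] v]
            hcont_compose[OF g h] tinv_compose[OF t] _ \<open>e \<noteq> 0\<close> \<open>cbody UNIV K\<close>])
        (simp add: normalised_mirror_pair[OF so])
    then show ?thesis by (simp add: complex_eq_iff bounded_linear_Re bounded_linear_Im)
  qed
  show ?thesis
    unfolding O_invariant_def
  proof (intro allI impI ballI)
    fix A :: "real^'n^'n" and K :: "(real^'n) set"
    assume A: "orthogonal_matrix A" and K: "K \<in> convex_bodies"
    show "\<phi> ((\<lambda>x. A *v x) ` K) = \<phi> K"
    proof (cases "det A = 1")
      case True
      then show ?thesis using so A K by (simp add: SO_invariant_def)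
    next
      case False
      fix k :: 'n
      define e where "e = (axis k 1 :: real^'n)"
      have e: "e \<noteq> 0" by (simp add: e_def axis_eq_0_iff)
      \<comment> \<open>Composition with one reflection turns an orthogonal matrix of determinant
        \<open>-1\<close> into a rotation.\<close>
      let ?B = "A ** matrix (mirror e)"
      have "det A = - 1" using False det_orthogonal_matrix[OF A] by blast
      then have B: "orthogonal_matrix ?B" "det ?B = 1"
        using A orthogonal_mirror[of e] det_mirror[OF e]
        by (auto simp: det_mul orthogonal_transformation_matrix intro: orthogonal_matrix_mul)
      have mK: "mirror e ` K \<in> convex_bodies"
        using K by (simp add: body_cbody cbody_mirror_UNIV)
      have "(\<lambda>x. A *v x) ` K = (\<lambda>x. ?B *v x) ` mirror e ` K"
        by (simp add: matrix_vector_mul_assoc[symmetric] image_image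
            matrix_vector_mul(2)[OF linear_mirror, THEN fun_cong])
      then have "\<phi> ((\<lambda>x. A *v x) ` K) = \<phi> (mirror e ` K)"
        using so B mK by (simp add: SO_invariant_def)
      also have "\<dots> = \<phi> K"
        using m[OF e, of K] K by (simp add: body_cbody normalised_def)
      finally show ?thesis .
    qed
  qed
qed

lemma polynomial_valuation_0_imp_1:
  assumes "is_polynomial_valuation 0 \<phi>"
  shows "is_polynomial_valuation 1 \<phi>"
  unfolding polynomial_valuation_1
proof
  fix K :: "(real^'a) set"
  assume "K \<in> convex_bodies"
  then show "\<exists>c l. \<forall>x. \<phi> ((+) x ` K) = c + (\<Sum>i\<in>UNIV. l i * complex_of_real (x $ i))"
    using assms unfolding polynomial_valuation_0 by (intro exI[of _ "\<phi> K"] exI[of _ "\<lambda>_. 0"]) simp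
qed

theorem theorem4p1:
  assumes "CARD('n::finite) \<ge> 2"
  shows "(Omega 1 :: ((real^'n) set \<Rightarrow> complex) set) = Omega 0
         \<and> (Omega 0 :: ((real^'n) set \<Rightarrow> complex) set) = Omega' 1"
proof -
  have 10: "(Omega 1 :: ((real^'n) set \<Rightarrow> complex) set) = Omega 0"
    using Omega_1_translation_invariant[OF assms] polynomial_valuation_0_imp_1
    unfolding Omega_def by blast
  have "Omega' 1 \<subseteq> (Omega 1 :: ((real^'n) set \<Rightarrow> complex) set)"
    by (auto simp: Omega_def Omega'_def O_invariant_def SO_invariant_def)
  moreover have "(Omega 0 :: ((real^'n) set \<Rightarrow> complex) set) \<subseteq> Omega' 1"
    using Omega_0_O_invariant polynomial_valuation_0_imp_1 by (auto simp: Omega_def Omega'_def)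
  ultimately show ?thesis using 10 by blast
qed

end
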